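(* Let $\Delta$ be a locally finite thick semi-regular right-angled building of type $(W,S)$ with base chamber $c_0$, and let $U$ be its universal group with respect to transitive permutation groups $(G^s)_{s\in S}$ (defined using directed legal colorings with respect to $c_0$). Let $w=s_1\cdots s_{n-1}s_n$ be a reduced word in the free monoid $M_S$ on $S$. 1. The group $U_{c_0}|_{\mathsf S(c_0,w)}$ is permutationally isomorphic to the generalized wreath product $G=X_w\text{--}\mathrm{WR}_{i\in S_w}G_0^{s_i}$ with respect to the partial order $\prec_w$. 2. Under this isomorphism, the subgroup $D_w\le U_{c_0}|_{\mathsf S(c_0,w)}$ corresponds to the subgroup $D(n)\le G$. 3. If $w'=s_1\cdots s_{n-1}$, then $U_{c_0}|_{\mathsf S(c_0,w)}\cong D_w\rtimes U_{c_0}|_{\mathsf S(c_0,w')}$.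
   Context: **Building and universal group.** A Coxeter system $(W,S)$ is right-angled if for all distinct $s,t\in S$ the order of $st$ is $2$ or $\infty$. $(q_s)_{s\in S}$ is a family of natural numbers with $q_s\ge 3$, $Y_s=\{1,\dots,q_s\}$, and $\Delta$ is the unique (locally finite) building of type $(W,S)$ in which every $s$-panel has exactly $q_s$ chambers. $\mathrm{Ch}(\Delta)$ is its set of chambers and $\delta$ its $W$-valued Weyl distance. Distinct chambers $c,d$ are $s$-adjacent if $\delta(c,d)=s$; $s$-panels are the classes of "equal or $s$-adjacent", and $\mathcal P_{s,c}$ is the $s$-panel containing $c$. A residue of type $J\subseteq S$ is a connected component of the graph on chambers keeping only edges with labels in $J$; $\mathrm{proj}_{\mathcal R}(c)$ is the unique chamber of the residue $\mathcal R$ closest to $c$. $\mathrm{Aut}(\Delta)$ is the group of type-preserving automorphisms. Two $s$-panels lie in a common $s$-tree-wall if they are contained in a common residue of type $\{s\}\cup\{t\in S\setminus\{s\}:ts=st\}$. A weak legal $s$-coloring is a map $h_s\colon\mathrm{Ch}(\Delta)\to Y_s$ bijective on every $s$-panel with $h_s(c)=h_s(\mathrm{proj}_{\mathcal P_2}(c))$ for all $s$-panels $\mathcal P_1,\mathcal P_2$ in a common $s$-tree-wall and all $c\in\mathcal P_1$; it is a directed legal $s$-coloring with respect to $c_0$ if moreover $h_s(\mathrm{proj}_{\mathcal P}(c_0))=1$ for every $s$-panel $\mathcal P$. For each $s\in S$ fix a directed legal $s$-coloring $h_s$ with respect to $c_0$ and a transitive $G^s\le\mathrm{Sym}(Y_s)$;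 $G_0^s$ is the stabilizer of $1$ in $G^s$. The universal group is $$U=\{g\in\mathrm{Aut}(\Delta)\mid (h_s|_{\mathcal P_{s,gc}})\circ g\circ(h_s|_{\mathcal P_{s,c}})^{-1}\in G^s\ \forall s\in S,\ c\in\mathrm{Ch}(\Delta)\},$$ $U_{c_0}$ is the stabilizer of $c_0$, $\mathsf S(c_0,w)=\{v\mid\delta(c_0,v)=w\}$ ($w$ being viewed in $W$), and $U_{c_0}|_{\mathsf S(c_0,w)}$ is the permutation group induced on $\mathsf S(c_0,w)$. **The poset $(S_w,\prec_w)$.** Let $S_w=\{1,\dots,n\}$. For a reduced word $v$ of length $n$, a $v$-elementary transposition is $(i\ \,i+1)\in\mathrm{Sym}(n)$ such that the $i$-th and $(i+1)$-st letters of $v$ commute in $W$; applying it to $v$ swaps these two letters. $\mathrm{Rep}(w)$ is the set of all products $\sigma=\sigma_k\cdots\sigma_1$ (composed right to left), where each $\sigma_i$ is an elementary transposition of the word obtained from $w$ by successively applying $\sigma_1,\dots,\sigma_{i-1}$; thus $\sigma(i)$ is the position, in the resulting word, of the letter that was in position $i$ of $w$. Define $i\prec_w j$ iff $\sigma(i)>\sigma(j)$ for all $\sigma\in\mathrm{Rep}(w)$. **$X_w$ and $D_w$.** $X_i=\{2,\dots,q_{s_i}\}$ and $X_w=\prod_{i=1}^nX_i$. The sphere $\mathsf S(c_0,w)$ is indexed by $X_w$: $v\in\mathsf S(c_0,w)$ corresponds to $(h_{s_1}(v_1),\dots,h_{s_n}(v_n))$, where $(c_0,v_1,\dots,v_n=v)$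 is the unique gallery of type $s_1\cdots s_n$ from $c_0$ to $v$. Restricting to the first $n-1$ coordinates, each element of $U_{c_0}|_{\mathsf S(c_0,w)}$ induces an element of $U_{c_0}|_{\mathsf S(c_0,w')}$, and $D_w=\{g\in U_{c_0}|_{\mathsf S(c_0,w)}\mid g\text{ fixes }\mathsf S(c_0,w')\text{ pointwise}\}$. **Generalized wreath products.** Let $(P,\prec)$ be a finite (strict) poset, let $H^p$ be a permutation group on a set $X_p$ for each $p\in P$, and let $X=\prod_{p\in P}X_p$. For $x,y\in X$ put $x\sim_p y$ iff $x_t=y_t$ for all $t\succ p$, and $x\simeq_p y$ iff $x_t=y_t$ for all $t\succeq p$. Then $X\text{--}\mathrm{WR}_{p\in P}H^p$ is the group of all $g\in\mathrm{Sym}(X)$ such that $g$ and $g^{-1}$ preserve all relations $\sim_p$ and $\simeq_p$, and such that for each $x\in X$, $p\in P$ there is $g_{p,x}\in H^p$ with $(g.y)_p=g_{p,x}.y_p$ for all $y\in X$ with $y\sim_p x$. Here it is applied with $P=S_w$ and $H^i=G_0^{s_i}$ acting on $X_i$. The subgroup $D(n)$ of $G$ is $\{g\in G\mid (g.x)_i=x_i\text{ for all }x\in X_w\text{ and all }i\ne n\}$. *)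

theory Defs
  imports
    "HOL-Algebra.Multiplicative_Group"
    "HOL-Algebra.Group_Action"
    "HOL-Algebra.Generated_Groups"
    "HOL-Combinatorics.Transposition"
begin

section \<open>Coxeter systems\<close>

definition word_val :: "('a, 'm) monoid_scheme \<Rightarrow> 'a list \<Rightarrow> 'a"
  where "word_val W u = foldr (mult W) u \<one>\<^bsub>W\<^esub>"

text \<open>
  Insertion of a Coxeter relator \<open>(s t)\<^sup>m\<close>, \<open>m\<close> being the order of \<open>s t\<close>, at an arbitrary place of
  a word over \<open>S\<close>. \<^const>\<open>group.ord\<close> is \<open>0\<close> on elements of infinite order, so those pairs
  contribute the empty relator only; \<open>s = t\<close> contributes \<open>s s\<close>, so that inverses of the
  generators are not needed and words in the free monoid suffice.
\<close>

inductive coxeter_step :: "('a, 'm) monoid_scheme \<Rightarrow> 'a set \<Rightarrow> 'a list \<Rightarrow> 'a list \<Rightarrow> bool"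
  for W S where
  "\<lbrakk>a \<in> lists S; b \<in> lists S; s \<in> S; t \<in> S\<rbrakk> \<Longrightarrow>
     coxeter_step W S (a @ b)
       (a @ concat (replicate (group.ord W (s \<otimes>\<^bsub>W\<^esub> t)) [s, t]) @ b)"

text \<open>\<open>W = \<langle>S | (s t)\<^sup>m\<^sup>(\<^sup>s\<^sup>,\<^sup>t\<^sup>) = 1\<rangle>\<close>, where \<open>m(s,t)\<close> is the order of \<open>s t\<close>.\<close>

locale coxeter_system = group W for W (structure) +
  fixes S
  assumes gens_closed: "S \<subseteq> carrier W"
    and gens_generate: "generate W S = carrier W"
    and gens_involution: "s \<in> S \<Longrightarrow> s \<noteq> \<one> \<and> s \<otimes> s = \<one>"
    and presentation: "\<lbrakk>u \<in> lists S; v \<in> lists S\<rbrakk> \<Longrightarrow>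
          word_val W u = word_val W v \<longleftrightarrow> equivclp (coxeter_step W S) u v"

locale right_angled_coxeter_system = coxeter_system +
  assumes right_angled: "\<lbrakk>s \<in> S; t \<in> S; s \<noteq> t\<rbrakk> \<Longrightarrow> ord (s \<otimes> t) = 2 \<or> ord (s \<otimes> t) = 0"

definition cox_length :: "('a, 'm) monoid_scheme \<Rightarrow> 'a set \<Rightarrow> 'a \<Rightarrow> nat"
  where "cox_length W S x = (LEAST k. \<exists>u \<in> lists S. word_val W u = x \<and> length u = k)"

definition reduced_word :: "('a, 'm) monoid_scheme \<Rightarrow> 'a set \<Rightarrow> 'a list \<Rightarrow> bool"
  where "reduced_word W S u \<longleftrightarrow> u \<in> lists S \<and> length u = cox_length W S (word_val W u)"


section \<open>Buildings\<close>

text \<open>Buildings as \<open>W\<close>-metric spaces: chambers \<open>C\<close> and Weyl distance \<open>\<delta>\<close>.\<close>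

locale building = coxeter_system W S for W (structure) and S +
  fixes C :: "'c set" and \<delta>
  assumes nonempty: "C \<noteq> {}"
    and dist_closed: "\<lbrakk>x \<in> C; y \<in> C\<rbrakk> \<Longrightarrow> \<delta> x y \<in> carrier W"
    and WD1: "\<lbrakk>x \<in> C; y \<in> C\<rbrakk> \<Longrightarrow> \<delta> x y = \<one> \<longleftrightarrow> x = y"
    and WD2: "\<lbrakk>x \<in> C; y \<in> C; x' \<in> C; s \<in> S; \<delta> x' x = s\<rbrakk> \<Longrightarrow>
          \<delta> x' y = s \<otimes> \<delta> x y \<or> \<delta> x' y = \<delta> x y"
    and WD2': "\<lbrakk>x \<in> C; y \<in> C; x' \<in> C; s \<in> S; \<delta> x' x = s;
          cox_length W S (s \<otimes> \<delta> x y) = cox_length W S (\<delta> x y) + 1\<rbrakk> \<Longrightarrow>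
          \<delta> x' y = s \<otimes> \<delta> x y"
    and WD3: "\<lbrakk>x \<in> C; y \<in> C; s \<in> S\<rbrakk> \<Longrightarrow> \<exists>x' \<in> C. \<delta> x' x = s \<and> \<delta> x' y = s \<otimes> \<delta> x y"

locale right_angled_building = building W S C \<delta> + right_angled_coxeter_system W S
  for W (structure) and S C \<delta>

definition panel :: "'c set \<Rightarrow> ('c \<Rightarrow> 'c \<Rightarrow> 'a) \<Rightarrow> 'a \<Rightarrow> 'c \<Rightarrow> 'c set"
  where "panel C \<delta> s c = {d \<in> C. d = c \<or> \<delta> c d = s}"

definition panels :: "'c set \<Rightarrow> ('c \<Rightarrow> 'c \<Rightarrow> 'a) \<Rightarrow> 'a \<Rightarrow> 'c set set"
  where "panels C \<delta> s = panel C \<delta> s ` C"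

definition semi_regular ::
    "'a set \<Rightarrow> 'c set \<Rightarrow> ('c \<Rightarrow> 'c \<Rightarrow> 'a) \<Rightarrow> ('a \<Rightarrow> nat) \<Rightarrow> bool"
  where "semi_regular S C \<delta> q \<longleftrightarrow> (\<forall>s \<in> S. \<forall>P \<in> panels C \<delta> s. finite P \<and> card P = q s)"

definition residue :: "'c set \<Rightarrow> ('c \<Rightarrow> 'c \<Rightarrow> 'a) \<Rightarrow> 'a set \<Rightarrow> 'c \<Rightarrow> 'c set"
  where "residue C \<delta> J c = {d. (c, d) \<in> {(x, y). x \<in> C \<and> y \<in> C \<and> \<delta> x y \<in> J}\<^sup>*}"

definition residues :: "'c set \<Rightarrow> ('c \<Rightarrow> 'c \<Rightarrow> 'a) \<Rightarrow> 'a set \<Rightarrow> 'c set set"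
  where "residues C \<delta> J = residue C \<delta> J ` C"

definition proj ::
    "('a, 'm) monoid_scheme \<Rightarrow> 'a set \<Rightarrow> ('c \<Rightarrow> 'c \<Rightarrow> 'a) \<Rightarrow> 'c set \<Rightarrow> 'c \<Rightarrow> 'c"
  where "proj W S \<delta> R c = (THE d. is_arg_min (\<lambda>d. cox_length W S (\<delta> c d)) (\<lambda>d. d \<in> R) d)"

definition same_tree_wall ::
    "('a, 'm) monoid_scheme \<Rightarrow> 'a set \<Rightarrow> 'c set \<Rightarrow> ('c \<Rightarrow> 'c \<Rightarrow> 'a) \<Rightarrow> 'a
      \<Rightarrow> 'c set \<Rightarrow> 'c set \<Rightarrow> bool"
  where "same_tree_wall W S C \<delta> s P1 P2 \<longleftrightarrow>
    (\<exists>R \<in> residues C \<delta> ({s} \<union> {t \<in> S - {s}. t \<otimes>\<^bsub>W\<^esub> s = s \<otimes>\<^bsub>W\<^esub> t}). P1 \<subseteq> R \<and> P2 \<subseteq> R)"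

text \<open>Letters of a word are numbered from 1, the chambers of a gallery from 0.\<close>

definition letter :: "'a list \<Rightarrow> nat \<Rightarrow> 'a"
  where "letter w i = w ! (i - 1)"

definition gallery :: "'c set \<Rightarrow> ('c \<Rightarrow> 'c \<Rightarrow> 'a) \<Rightarrow> 'a list \<Rightarrow> 'c list \<Rightarrow> bool"
  where "gallery C \<delta> w vs \<longleftrightarrow> vs \<in> lists C \<and> length vs = length w + 1 \<and>
    (\<forall>i \<in> {1..length w}. \<delta> (vs ! (i - 1)) (vs ! i) = letter w i)"

definition sphere ::
    "('a, 'm) monoid_scheme \<Rightarrow> 'c set \<Rightarrow> ('c \<Rightarrow> 'c \<Rightarrow> 'a) \<Rightarrow> 'c \<Rightarrow> 'a list \<Rightarrow> 'c set"
  where "sphere W C \<delta> c0 w = {v \<in> C. \<delta> c0 v = word_val W w}"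


section \<open>Permutation groups\<close>

text \<open>
  Permutations of \<open>\<Omega>\<close> are the extensional functions in \<^term>\<open>carrier (BijGroup \<Omega>)\<close>; a permutation
  group on \<open>\<Omega>\<close> is a set \<open>A\<close> with \<^term>\<open>subgroup A (BijGroup \<Omega>)\<close>.
\<close>

abbreviation perm_group :: "'x set \<Rightarrow> ('x \<Rightarrow> 'x) set \<Rightarrow> ('x \<Rightarrow> 'x) monoid"
  where "perm_group \<Omega> A \<equiv> (BijGroup \<Omega>)\<lparr>carrier := A\<rparr>"

definition stabilizer_on ::
    "('x \<Rightarrow> 'x) set \<Rightarrow> 'x \<Rightarrow> ('x \<Rightarrow> 'x) set"
  where "stabilizer_on A x = {g \<in> A. g x = x}"

definition induced_on :: "('x \<Rightarrow> 'x) set \<Rightarrow> 'x set \<Rightarrow> ('x \<Rightarrow> 'x) set"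
  where "induced_on A \<Omega> = (\<lambda>g. restrict g \<Omega>) ` A"

definition permutational_isomorphism ::
    "('x \<Rightarrow> 'y) \<Rightarrow> (('x \<Rightarrow> 'x) \<Rightarrow> ('y \<Rightarrow> 'y)) \<Rightarrow>
      'x set \<Rightarrow> ('x \<Rightarrow> 'x) set \<Rightarrow> 'y set \<Rightarrow> ('y \<Rightarrow> 'y) set \<Rightarrow> bool"
  where "permutational_isomorphism \<theta> \<Phi> \<Omega> A X G \<longleftrightarrow>
    subgroup A (BijGroup \<Omega>) \<and> subgroup G (BijGroup X) \<and>
    bij_betw \<theta> \<Omega> X \<and> \<Phi> \<in> iso (perm_group \<Omega> A) (perm_group X G) \<and>
    (\<forall>g \<in> A. \<forall>v \<in> \<Omega>. \<theta> (g v) = \<Phi> g (\<theta> v))"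

definition semidirect_product ::
    "('a, 'm) monoid_scheme \<Rightarrow> ('b, 'k) monoid_scheme \<Rightarrow> ('b \<Rightarrow> 'a \<Rightarrow> 'a) \<Rightarrow> ('a \<times> 'b) monoid"
  where "semidirect_product N K \<phi> =
    \<lparr>carrier = carrier N \<times> carrier K,
     mult = (\<lambda>(n, k) (n', k'). (n \<otimes>\<^bsub>N\<^esub> \<phi> k n', k \<otimes>\<^bsub>K\<^esub> k')),
     one = (\<one>\<^bsub>N\<^esub>, \<one>\<^bsub>K\<^esub>)\<rparr>"


section \<open>Colorings and universal groups\<close>

definition colors :: "('a \<Rightarrow> nat) \<Rightarrow> 'a \<Rightarrow> nat set"
  where "colors q s = {1..q s}"

definition weak_legal_coloring ::
    "('a, 'm) monoid_scheme \<Rightarrow> 'a set \<Rightarrow> 'c set \<Rightarrow> ('c \<Rightarrow> 'c \<Rightarrow> 'a) \<Rightarrow> ('a \<Rightarrow> nat)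
      \<Rightarrow> 'a \<Rightarrow> ('c \<Rightarrow> nat) \<Rightarrow> bool"
  where "weak_legal_coloring W S C \<delta> q s f \<longleftrightarrow>
    (\<forall>P \<in> panels C \<delta> s. bij_betw f P (colors q s)) \<and>
    (\<forall>P1 \<in> panels C \<delta> s. \<forall>P2 \<in> panels C \<delta> s. same_tree_wall W S C \<delta> s P1 P2 \<longrightarrow>
       (\<forall>c \<in> P1. f c = f (proj W S \<delta> P2 c)))"

definition directed_legal_coloring ::
    "('a, 'm) monoid_scheme \<Rightarrow> 'a set \<Rightarrow> 'c set \<Rightarrow> ('c \<Rightarrow> 'c \<Rightarrow> 'a) \<Rightarrow> ('a \<Rightarrow> nat)
      \<Rightarrow> 'c \<Rightarrow> 'a \<Rightarrow> ('c \<Rightarrow> nat) \<Rightarrow> bool"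
  where "directed_legal_coloring W S C \<delta> q c0 s f \<longleftrightarrow>
    weak_legal_coloring W S C \<delta> q s f \<and>
    (\<forall>P \<in> panels C \<delta> s. f (proj W S \<delta> P c0) = 1)"

definition building_auts :: "'c set \<Rightarrow> ('c \<Rightarrow> 'c \<Rightarrow> 'a) \<Rightarrow> ('c \<Rightarrow> 'c) set"
  where "building_auts C \<delta> = {g \<in> carrier (BijGroup C). \<forall>x \<in> C. \<forall>y \<in> C. \<delta> (g x) (g y) = \<delta> x y}"

text \<open>The composite \<open>(h\<^sub>s restricted to P\<^sub>s\<^sub>,\<^sub>g\<^sub>c) \<circ> g \<circ> (h\<^sub>s restricted to P\<^sub>s\<^sub>,\<^sub>c)\<^sup>-\<^sup>1\<close>.\<close>

definition local_action ::
    "'c set \<Rightarrow> ('c \<Rightarrow> 'c \<Rightarrow> 'a) \<Rightarrow> ('a \<Rightarrow> nat) \<Rightarrow> ('a \<Rightarrow> 'c \<Rightarrow> nat)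
      \<Rightarrow> ('c \<Rightarrow> 'c) \<Rightarrow> 'a \<Rightarrow> 'c \<Rightarrow> nat \<Rightarrow> nat"
  where "local_action C \<delta> q h g s c =
    (\<lambda>y \<in> colors q s. h s (g (inv_into (panel C \<delta> s c) (h s) y)))"

definition universal_group ::
    "'a set \<Rightarrow> 'c set \<Rightarrow> ('c \<Rightarrow> 'c \<Rightarrow> 'a) \<Rightarrow> ('a \<Rightarrow> nat) \<Rightarrow> ('a \<Rightarrow> 'c \<Rightarrow> nat)
      \<Rightarrow> ('a \<Rightarrow> (nat \<Rightarrow> nat) set) \<Rightarrow> ('c \<Rightarrow> 'c) set"
  where "universal_group S C \<delta> q h F =
    {g \<in> building_auts C \<delta>. \<forall>s \<in> S. \<forall>c \<in> C. local_action C \<delta> q h g s c \<in> F s}"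

definition sphere_group ::
    "('a, 'm) monoid_scheme \<Rightarrow> 'a set \<Rightarrow> 'c set \<Rightarrow> ('c \<Rightarrow> 'c \<Rightarrow> 'a) \<Rightarrow> ('a \<Rightarrow> nat)
      \<Rightarrow> ('a \<Rightarrow> 'c \<Rightarrow> nat) \<Rightarrow> ('a \<Rightarrow> (nat \<Rightarrow> nat) set) \<Rightarrow> 'c \<Rightarrow> 'a list \<Rightarrow> ('c \<Rightarrow> 'c) set"
  where "sphere_group W S C \<delta> q h F c0 w =
    induced_on (stabilizer_on (universal_group S C \<delta> q h F) c0) (sphere W C \<delta> c0 w)"


section \<open>The poset of positions of a reduced word\<close>

text \<open>
  \<open>rep_word W w \<sigma> v\<close>: the word \<open>v\<close> arises from \<open>w\<close> by successive elementary transpositions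
  with product \<open>\<sigma>\<close>. Note that \<open>v ! (i - 1)\<close> is the \<open>i\<close>-th letter of \<open>v\<close>.
\<close>

inductive rep_word ::
    "('a, 'm) monoid_scheme \<Rightarrow> 'a list \<Rightarrow> (nat \<Rightarrow> nat) \<Rightarrow> 'a list \<Rightarrow> bool"
  for W w where
  rep_id: "rep_word W w id w"
| rep_step: "\<lbrakk>rep_word W w \<sigma> v; 1 \<le> i; i < length v;
     letter v i \<otimes>\<^bsub>W\<^esub> letter v (i + 1) = letter v (i + 1) \<otimes>\<^bsub>W\<^esub> letter v i\<rbrakk> \<Longrightarrow>
     rep_word W w (transpose i (i + 1) \<circ> \<sigma>) (v[i - 1 := v ! i, i := v ! (i - 1)])"

definition Rep :: "('a, 'm) monoid_scheme \<Rightarrow> 'a list \<Rightarrow> (nat \<Rightarrow> nat) set"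
  where "Rep W w = {\<sigma>. \<exists>v. rep_word W w \<sigma> v}"

definition positions :: "'a list \<Rightarrow> nat set"
  where "positions w = {1..length w}"

definition prec :: "('a, 'm) monoid_scheme \<Rightarrow> 'a list \<Rightarrow> nat \<Rightarrow> nat \<Rightarrow> bool"
  where "prec W w i j \<longleftrightarrow>
    i \<in> positions w \<and> j \<in> positions w \<and> (\<forall>\<sigma> \<in> Rep W w. \<sigma> i > \<sigma> j)"


section \<open>Generalized wreath products\<close>

context
  fixes P :: "'p set" and prc :: "'p \<Rightarrow> 'p \<Rightarrow> bool"
begin

definition wr_sim :: "'p \<Rightarrow> ('p \<Rightarrow> 'x) \<Rightarrow> ('p \<Rightarrow> 'x) \<Rightarrow> bool"
  where "wr_sim p x y \<longleftrightarrow> (\<forall>t \<in> P. prc p t \<longrightarrow> x t = y t)"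

definition wr_simeq :: "'p \<Rightarrow> ('p \<Rightarrow> 'x) \<Rightarrow> ('p \<Rightarrow> 'x) \<Rightarrow> bool"
  where "wr_simeq p x y \<longleftrightarrow> (\<forall>t \<in> P. prc p t \<or> t = p \<longrightarrow> x t = y t)"

definition preserves_rel :: "'y set \<Rightarrow> ('y \<Rightarrow> 'y \<Rightarrow> bool) \<Rightarrow> ('y \<Rightarrow> 'y) \<Rightarrow> bool"
  where "preserves_rel X r g \<longleftrightarrow> (\<forall>x \<in> X. \<forall>y \<in> X. r x y \<longrightarrow> r (g x) (g y))"

definition wreath_product ::
    "('p \<Rightarrow> 'x set) \<Rightarrow> ('p \<Rightarrow> ('x \<Rightarrow> 'x) set) \<Rightarrow> (('p \<Rightarrow> 'x) \<Rightarrow> ('p \<Rightarrow> 'x)) set"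
  where "wreath_product Xs H =
    {g \<in> carrier (BijGroup (PiE P Xs)).
       (\<forall>p \<in> P. \<forall>f \<in> {g, inv_into (PiE P Xs) g}.
          preserves_rel (PiE P Xs) (wr_sim p) f \<and> preserves_rel (PiE P Xs) (wr_simeq p) f) \<and>
       (\<forall>x \<in> PiE P Xs. \<forall>p \<in> P. \<exists>k \<in> H p. \<forall>y \<in> PiE P Xs. wr_sim p y x \<longrightarrow> g y p = k (y p))}"

end

definition coordinate_subgroup ::
    "'p set \<Rightarrow> ('p \<Rightarrow> 'x set) \<Rightarrow> (('p \<Rightarrow> 'x) \<Rightarrow> ('p \<Rightarrow> 'x)) set \<Rightarrow> 'p
      \<Rightarrow> (('p \<Rightarrow> 'x) \<Rightarrow> ('p \<Rightarrow> 'x)) set"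
  where "coordinate_subgroup P Xs G i =
    {g \<in> G. \<forall>x \<in> PiE P Xs. \<forall>j \<in> P. j \<noteq> i \<longrightarrow> g x j = x j}"


section \<open>Coordinates on spheres\<close>

definition coord_range :: "('a \<Rightarrow> nat) \<Rightarrow> 'a list \<Rightarrow> nat \<Rightarrow> nat set"
  where "coord_range q w i = {2..q (letter w i)}"

definition coord_space :: "('a \<Rightarrow> nat) \<Rightarrow> 'a list \<Rightarrow> (nat \<Rightarrow> nat) set"
  where "coord_space q w = PiE (positions w) (coord_range q w)"

text \<open>\<open>G\<^sub>0\<^sup>s\<close> for \<open>s = s\<^sub>i\<close>, as a permutation group on \<open>X\<^sub>i\<close>.\<close>

definition local_group ::
    "('a \<Rightarrow> nat) \<Rightarrow> ('a \<Rightarrow> (nat \<Rightarrow> nat) set) \<Rightarrow> 'a list \<Rightarrow> nat \<Rightarrow> (nat \<Rightarrow> nat) set"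
  where "local_group q F w i = induced_on (stabilizer_on (F (letter w i)) 1) (coord_range q w i)"

definition word_wreath ::
    "('a, 'm) monoid_scheme \<Rightarrow> ('a \<Rightarrow> nat) \<Rightarrow> ('a \<Rightarrow> (nat \<Rightarrow> nat) set) \<Rightarrow> 'a list
      \<Rightarrow> ((nat \<Rightarrow> nat) \<Rightarrow> (nat \<Rightarrow> nat)) set"
  where "word_wreath W q F w =
    wreath_product (positions w) (prec W w) (coord_range q w) (local_group q F w)"

definition coords ::
    "'c set \<Rightarrow> ('c \<Rightarrow> 'c \<Rightarrow> 'a) \<Rightarrow> ('a \<Rightarrow> 'c \<Rightarrow> nat) \<Rightarrow> 'c \<Rightarrow> 'a list \<Rightarrow> 'c \<Rightarrow> nat \<Rightarrow> nat"
  where "coords C \<delta> h c0 w v =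
    (let vs = (THE vs. gallery C \<delta> w vs \<and> vs ! 0 = c0 \<and> vs ! length w = v)
     in (\<lambda>i \<in> positions w. h (letter w i) (vs ! i)))"

text \<open>
  The permutation \<open>g\<close> of the sphere at \<open>w\<close> induces one of the sphere at \<^term>\<open>butlast w\<close>
  by restricting coordinates to all positions but the last.
\<close>

definition lies_over ::
    "'c set \<Rightarrow> ('c \<Rightarrow> 'c \<Rightarrow> 'a) \<Rightarrow> ('a \<Rightarrow> 'c \<Rightarrow> nat) \<Rightarrow> 'c \<Rightarrow> 'a list \<Rightarrow> 'c \<Rightarrow> 'c \<Rightarrow> bool"
  where "lies_over C \<delta> h c0 w v u \<longleftrightarrow>
    restrict (coords C \<delta> h c0 w v) (positions (butlast w)) = coords C \<delta> h c0 (butlast w) u"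

definition induced_map ::
    "('a, 'm) monoid_scheme \<Rightarrow> 'c set \<Rightarrow> ('c \<Rightarrow> 'c \<Rightarrow> 'a) \<Rightarrow> ('a \<Rightarrow> 'c \<Rightarrow> nat) \<Rightarrow> 'c
      \<Rightarrow> 'a list \<Rightarrow> ('c \<Rightarrow> 'c) \<Rightarrow> 'c \<Rightarrow> 'c"
  where "induced_map W C \<delta> h c0 w g =
    (\<lambda>u \<in> sphere W C \<delta> c0 (butlast w).
       THE u'. u' \<in> sphere W C \<delta> c0 (butlast w) \<and>
         (\<exists>v \<in> sphere W C \<delta> c0 w. lies_over C \<delta> h c0 w v u \<and> lies_over C \<delta> h c0 w (g v) u'))"

definition last_kernel ::
    "('a, 'm) monoid_scheme \<Rightarrow> 'a set \<Rightarrow> 'c set \<Rightarrow> ('c \<Rightarrow> 'c \<Rightarrow> 'a) \<Rightarrow> ('a \<Rightarrow> nat)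
      \<Rightarrow> ('a \<Rightarrow> 'c \<Rightarrow> nat) \<Rightarrow> ('a \<Rightarrow> (nat \<Rightarrow> nat) set) \<Rightarrow> 'c \<Rightarrow> 'a list \<Rightarrow> ('c \<Rightarrow> 'c) set"
  where "last_kernel W S C \<delta> q h F c0 w =
    {g \<in> sphere_group W S C \<delta> q h F c0 w.
       \<forall>u \<in> sphere W C \<delta> c0 (butlast w). induced_map W C \<delta> h c0 w g u = u}"

end

theory Submission
  imports Defs
begin

text \<open>
  The universal group is transparent in coordinates. A chamber is reached from \<open>c\<^sub>0\<close> by a gallery
  of reduced type, and in the gallery each step is determined by its type \<open>s\<close> and by the color
  \<open>a \<ge> 2\<close> of the chamber it leads to; the color 1 marks the chamber of the panel nearest to \<open>c\<^sub>0\<close>.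
  So chambers are colored reduced words. Two colored words give the same chamber iff they
  differ by exchanging neighbouring commuting letters together with their colors: the solution of
  the word problem in a right-angled Coxeter group (\<open>red_unique\<close>) handles the types, and constancy
  of the colors along tree-walls says precisely that the colors travel with their letters
  (\<open>ch_swap\<close>, \<open>ch_eq_imp_trace_eq\<close>).

  Consider a letter of such a word. Move every letter that can be moved behind it. What remains in
  front, its past, consists of the positions above it in the order \<open>\<prec>\<^sub>w\<close> (\<open>kept_eq_prec\<close>).
  An automorphism fixing \<open>c\<^sub>0\<close> acts on galleries. Applied to the gallery starting with the past of
  \<open>i\<close>, this shows that the new color at \<open>i\<close> depends only on the old colors at \<open>i\<close> and above \<open>i\<close>,
  and that for fixed colors above \<open>i\<close> it is obtained by the local action at one panel
  (\<open>aut_coord\<close>). This is membership in the generalized wreath product (\<open>aut_perm_in_wreath\<close>).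

  Conversely, choose for each letter \<open>s\<close> and each possible colored past a permutation in \<open>G\<^sub>0\<^sup>s\<close>
  and apply it to the colors of all the letters \<open>s\<close> having this past. The past does not change
  under rearrangement, so this is a well-defined map on chambers; it preserves adjacency, hence the
  Weyl distance, and its local actions are the chosen permutations (\<open>recolor_extension\<close>). Given an
  element of the wreath product, its local permutations are prescribed at the pasts that occur
  in \<open>w\<close> and the identity at all others (\<open>wreath_extension\<close>). This proves that restriction to the
  sphere has the whole wreath product as its image.

  The last claim compares \<open>w\<close> with \<open>w' = s\<^sub>1\<dots>s\<^sub>n\<^sub>-\<^sub>1\<close>. An automorphism commutes with dropping the last
  chamber of a gallery, so restricting coordinates is restricting automorphisms to the smaller
  sphere, and \<open>D\<^sub>w\<close> is the kernel of this homomorphism. It is split: the extension constructed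
  from \<open>w'\<close> alone uses the identity at the past of the last letter, so it leaves the last
  coordinate alone. Together with the action on the smaller sphere this determines it on the
  larger one, so these extensions multiply correctly (\<open>lift_exists\<close>, \<open>section_exists\<close>).

  Throughout, the last letter of a colored word stands at the head of the list, and distances are
  measured towards \<open>c\<^sub>0\<close>. The axioms of a building extend a gallery at its first chamber, so with
  this convention extending a gallery away from \<open>c\<^sub>0\<close> is adding an element to a list.
\<close>


section \<open>Words up to commutation\<close>

text \<open>
  Closing under adding a letter in front, rather than exchanging letters at an arbitrary place, suits
  invariants defined by recursion on the list.
\<close>

inductive trace_eq :: "('x \<Rightarrow> 'x \<Rightarrow> bool) \<Rightarrow> 'x list \<Rightarrow> 'x list \<Rightarrow> bool"
  for I where
  tr_refl: "trace_eq I u u"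
| tr_swap: "I x y \<Longrightarrow> trace_eq I (x # y # u) (y # x # u)"
| tr_Cons: "trace_eq I u v \<Longrightarrow> trace_eq I (x # u) (x # v)"
| tr_trans: "trace_eq I u v \<Longrightarrow> trace_eq I v z \<Longrightarrow> trace_eq I u z"

declare tr_trans [trans]

lemma trace_eq_sym:
  assumes "trace_eq I u v" "symp I"
  shows "trace_eq I v u"
  using assms(1)
  by (induction rule: trace_eq.induct) (auto intro: trace_eq.intros sympD[OF assms(2)])

lemma trace_eq_set: "trace_eq I u v \<Longrightarrow> set u = set v"
  by (induction rule: trace_eq.induct) auto

lemma trace_eq_length: "trace_eq I u v \<Longrightarrow> length u = length v"
  by (induction rule: trace_eq.induct) auto

lemma trace_eq_distinct: "trace_eq I u v \<Longrightarrow> distinct u = distinct v"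
  by (induction rule: trace_eq.induct) (auto dest: trace_eq_set)

lemma trace_eq_append_left: "trace_eq I u v \<Longrightarrow> trace_eq I (p @ u) (p @ v)"
  by (induction p) (auto intro: trace_eq.intros)

lemma trace_eq_append_right: "trace_eq I u v \<Longrightarrow> trace_eq I (u @ p) (v @ p)"
  by (induction rule: trace_eq.induct) (auto intro: trace_eq.intros)

lemma trace_eq_rev: "trace_eq I u v \<Longrightarrow> symp I \<Longrightarrow> trace_eq I (rev u) (rev v)"
proof (induction rule: trace_eq.induct)
  case (tr_swap x y u)
  then have "trace_eq I [y, x] [x, y]" by (auto intro: trace_eq.intros dest: sympD)
  then show ?case using trace_eq_append_left by fastforce
qed (auto intro: trace_eq.intros trace_eq_append_right)

lemma trace_eq_map:
  "trace_eq I u v \<Longrightarrow> (\<And>x y. I x y \<Longrightarrow> J (f x) (f y)) \<Longrightarrow> trace_eq J (map f u) (map f v)"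
  by (induction rule: trace_eq.induct) (auto intro: trace_eq.intros)

lemma trace_eq_move:
  "(\<And>d. d \<in> set u \<Longrightarrow> I c d) \<Longrightarrow> trace_eq I (c # u @ v) (u @ c # v)"
proof (induction u)
  case (Cons d u)
  then show ?case
    using tr_trans[OF tr_swap[of I c d "u @ v"] tr_Cons[of I "c # u @ v" "u @ c # v" d]] by simp
qed (auto intro: trace_eq.intros)

text \<open>
  Used to compare two chambers whose types are known to agree up to rearrangement: one of the
  words can be rearranged, with its colors, to have literally the same letters as the other.
\<close>

lemma trace_eq_lift:
  assumes "trace_eq I u v" and "map f cs = u"
  shows "\<exists>ds. map f ds = v \<and> trace_eq (\<lambda>x y. I (f x) (f y)) cs ds"
  using assms
proof (induction arbitrary: cs rule: trace_eq.induct)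
  case (tr_swap x y u)
  then obtain a b r where cs: "cs = a # b # r" "x = f a" "y = f b" "u = map f r"
    by (auto simp: map_eq_Cons_conv)
  then show ?case using tr_swap.hyps by (intro exI[of _ "b # a # r"]) (auto intro: trace_eq.intros)
next
  case (tr_Cons u v x)
  then obtain a r where cs: "cs = a # r" "x = f a" "u = map f r"
    by (auto simp: map_eq_Cons_conv)
  with tr_Cons.IH[of r] obtain ds where "map f ds = v" "trace_eq (\<lambda>x y. I (f x) (f y)) r ds" by auto
  then show ?case using cs by (intro exI[of _ "a # ds"]) (auto intro: trace_eq.intros)
next
  case (tr_trans u v z)
  then obtain ds where ds: "map f ds = v" "trace_eq (\<lambda>x y. I (f x) (f y)) cs ds" by blast
  with tr_trans.IH(2)[of ds] obtain es where
    "map f es = z" "trace_eq (\<lambda>x y. I (f x) (f y)) ds es" by blast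
  with ds show ?case by (blast intro: trace_eq.tr_trans)
qed (auto intro: trace_eq.intros)

text \<open>
  \<open>J\<close> is a set of letters that come after the word. Going back from the end of the word, a letter
  independent of everything in \<open>J\<close> can be moved to the end; any other letter has to stay and
  blocks in its turn, so it is added to \<open>J\<close>.
\<close>

fun kept :: "('l \<Rightarrow> 'l \<Rightarrow> bool) \<Rightarrow> 'l set \<Rightarrow> ('l \<times> 'x) list \<Rightarrow> ('l \<times> 'x) list"
  where
  "kept I J [] = []"
| "kept I J (c # u) =
     (if \<forall>j \<in> J. I (fst c) j then kept I J u else c # kept I (insert (fst c) J) u)"

fun dropped :: "('l \<Rightarrow> 'l \<Rightarrow> bool) \<Rightarrow> 'l set \<Rightarrow> ('l \<times> 'x) list \<Rightarrow> ('l \<times> 'x) list"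
  where
  "dropped I J [] = []"
| "dropped I J (c # u) =
     (if \<forall>j \<in> J. I (fst c) j then c # dropped I J u else dropped I (insert (fst c) J) u)"

abbreviation indep_fst :: "('l \<Rightarrow> 'l \<Rightarrow> bool) \<Rightarrow> 'l \<times> 'x \<Rightarrow> 'l \<times> 'x \<Rightarrow> bool"
  where "indep_fst I \<equiv> \<lambda>x y. I (fst x) (fst y)"

lemma dropped_indep: "d \<in> set (dropped I J u) \<Longrightarrow> j \<in> J \<Longrightarrow> I (fst d) j"
  by (induction I J u rule: dropped.induct) (auto split: if_splits)

lemma trace_eq_dropped_kept:
  assumes "symp I"
  shows "trace_eq (indep_fst I) u (dropped I J u @ kept I J u)"
proof (induction u arbitrary: J)
  case (Cons c u)
  show ?case
  proof (cases "\<forall>j \<in> J. I (fst c) j")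
    case True
    then show ?thesis using Cons by (auto intro: trace_eq.intros)
  next
    case False
    let ?J = "insert (fst c) J"
    have "trace_eq (indep_fst I) (c # u) (c # dropped I ?J u @ kept I ?J u)"
      using Cons by (auto intro: trace_eq.intros)
    moreover have "trace_eq (indep_fst I) (c # dropped I ?J u @ kept I ?J u)
        (dropped I ?J u @ c # kept I ?J u)"
      by (rule trace_eq_move) (metis dropped_indep insertI1 assms sympD)
    ultimately show ?thesis using False by (auto intro: tr_trans)
  qed
qed (auto intro: trace_eq.intros)

lemma kept_map: "kept I J (map (apsnd f) u) = map (apsnd f) (kept I J u)"
  by (induction u arbitrary: J) auto

text \<open>
  As \<open>j\<close> is not independent of itself, all its occurrences are blocked.
\<close>

lemma count_kept:
  "j \<in> J \<Longrightarrow> \<not> I j j \<Longrightarrow> count_list (map fst (kept I J u)) j = count_list (map fst u) j"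
  by (induction u arbitrary: J) (simp_all, blast+)

text \<open>
  The colored past of a letter \<open>s\<close> standing after \<open>u\<close>, recorded in a form that does not depend on the
  arrangement of the past: for each letter \<open>r\<close>, the sequence of the colors of the occurrences of
  \<open>r\<close>. Rearranging exchanges distinct letters only and so keeps these sequences.
\<close>

definition key :: "('l \<Rightarrow> 'l \<Rightarrow> bool) \<Rightarrow> 'l \<Rightarrow> ('l \<times> 'x) list \<Rightarrow> 'l \<Rightarrow> 'x list"
  where "key I s u r = map snd (filter (\<lambda>c. fst c = r) (kept I {s} u))"

lemma filter_kept_trace_eq:
  assumes "symp I" "irreflp I" and "trace_eq (indep_fst I) u v"
  shows "filter (\<lambda>c. fst c = r) (kept I J u) = filter (\<lambda>c. fst c = r) (kept I J v)"
  using assms(3)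
proof (induction arbitrary: J rule: trace_eq.induct)
  case (tr_swap x y u)
  have "I (fst y) (fst x)" using tr_swap sympD[OF assms(1), of "fst x" "fst y"] by simp
  moreover have "fst x \<noteq> fst y"
  proof
    assume "fst x = fst y"
    with tr_swap have "I (fst x) (fst x)" by simp
    with irreflpD[OF assms(2)] show False by blast
  qed
  ultimately have I: "I (fst x) (fst y)" "I (fst y) (fst x)" "fst x \<noteq> fst y"
    using tr_swap by auto
  \<comment> \<open>As \<open>x\<close> and \<open>y\<close> are independent, adding one of them to \<open>J\<close> is irrelevant for the other.\<close>
  let ?P = "\<lambda>z. \<forall>j \<in> J. I (fst z) j"
  have xy: "kept I J (x # y # u) =
      (if ?P x then kept I J (y # u) else x #
        (if ?P y then kept I (insert (fst x) J) u
         else y # kept I (insert (fst y) (insert (fst x) J)) u))"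
    using I by (simp only: kept.simps ball_simps simp_thms)
  have yx: "kept I J (y # x # u) =
      (if ?P y then kept I J (x # u) else y #
        (if ?P x then kept I (insert (fst y) J) u
         else x # kept I (insert (fst y) (insert (fst x) J)) u))"
    using I by (simp only: kept.simps ball_simps simp_thms insert_commute[of "fst y"])
  show ?case
    using I unfolding xy yx
    by (cases "?P x"; cases "?P y") (simp_all only: kept.simps if_True if_False filter.simps, auto)
next
  case (tr_trans u v z)
  show ?case using tr_trans.IH(1)[of J] tr_trans.IH(2)[of J] by (rule trans)
qed simp_all

lemma key_trace_eq:
  "symp I \<Longrightarrow> irreflp I \<Longrightarrow> trace_eq (indep_fst I) u v \<Longrightarrow> key I s u = key I s v"
  unfolding key_def by (intro ext) (metis filter_kept_trace_eq)

lemma key_Cons_indep: "I (fst c) s \<Longrightarrow> key I s (c # u) = key I s u"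
  by (auto simp: key_def)

lemma length_filter_fst: "length (filter (\<lambda>c. fst c = s) u) = count_list (map fst u) s"
  by (induction u) auto

text \<open>
  Together with the letter \<open>s\<close> this length tells which occurrence of \<open>s\<close> in a word is meant.
\<close>

lemma length_key: "\<not> I s s \<Longrightarrow> length (key I s u s) = count_list (map fst u) s"
  by (simp add: key_def length_filter_fst count_kept)

lemma key_map: "key I s (map (apsnd f) u) r = map f (key I s u r)"
  by (simp add: key_def kept_map filter_map comp_def)

lemma key_map_eqD:
  assumes "key I s (map (apsnd f) u) = key I s (map (apsnd g) u)" and "c \<in> set (kept I {s} u)"
  shows "f (snd c) = g (snd c)"
proof -
  have "map f (key I s u (fst c)) = map g (key I s u (fst c))"
    using assms(1) by (metis key_map)
  moreover have "snd c \<in> set (key I s u (fst c))"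
    using assms(2) by (auto simp: key_def)
  ultimately show ?thesis by (metis map_eq_conv)
qed


section \<open>The word problem in a right-angled Coxeter group\<close>

text \<open>
  Moves the first occurrence of \<open>s\<close> to the front, if possible, and removes it. Multiplication by an
  involution \<open>s\<close> is then \<open>push\<close> below: either \<open>s\<close> cancels against a letter of the word, or it is put in
  front.
\<close>

fun take_front :: "('l \<Rightarrow> 'l \<Rightarrow> bool) \<Rightarrow> 'l \<Rightarrow> 'l list \<Rightarrow> 'l list option"
  where
  "take_front I s [] = None"
| "take_front I s (x # u) =
     (if x = s then Some u else if I s x then map_option (Cons x) (take_front I s u) else None)"

definition push :: "('l \<Rightarrow> 'l \<Rightarrow> bool) \<Rightarrow> 'l \<Rightarrow> 'l list \<Rightarrow> 'l list"
  where "push I s u = (case take_front I s u of None \<Rightarrow> s # u | Some v \<Rightarrow> v)"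

fun irr :: "('l \<Rightarrow> 'l \<Rightarrow> bool) \<Rightarrow> 'l list \<Rightarrow> bool"
  where
  "irr I [] = True"
| "irr I (s # u) \<longleftrightarrow> irr I u \<and> take_front I s u = None"

locale independence =
  fixes I :: "'l \<Rightarrow> 'l \<Rightarrow> bool"
  assumes symI: "symp I" and irreflI: "irreflp I"
begin

lemma I_sym: "I s t \<Longrightarrow> I t s" using symI by (rule sympD)
lemma I_irrefl: "\<not> I s s" using irreflI by (simp add: irreflpD)

lemma tr_sym: "trace_eq I u v \<Longrightarrow> trace_eq I v u"
  by (rule trace_eq_sym[OF _ symI])

lemma take_front_trace_eq: "trace_eq I u v \<Longrightarrow> rel_option (trace_eq I) (take_front I s u) (take_front I s v)"
proof (induction rule: trace_eq.induct)
  case (tr_refl u)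
  then show ?case by (cases "take_front I s u") (simp_all add: trace_eq.tr_refl)
next
  case (tr_swap x y u)
  have yx: "I y x" using tr_swap by (rule I_sym)
  have "x \<noteq> y" using tr_swap I_irrefl by blast
  then show ?case using tr_swap yx
    by (cases "take_front I s u"; cases "s = x"; cases "s = y")
      (simp_all add: trace_eq.tr_refl trace_eq.tr_swap)
next
  case (tr_Cons u v x)
  then show ?case by (cases "take_front I s u"; cases "take_front I s v") (simp_all add: trace_eq.tr_Cons)
next
  case (tr_trans u v z)
  then show ?case
    by (cases "take_front I s u"; cases "take_front I s v"; cases "take_front I s z")
      (simp_all, blast intro: trace_eq.tr_trans)
qed

lemma take_front_None_trace_eq: "trace_eq I u v \<Longrightarrow> take_front I s u = None \<longleftrightarrow> take_front I s v = None"
  using take_front_trace_eq[of u v s] by (cases "take_front I s u"; cases "take_front I s v") auto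

lemma take_front_Some_trace_eq: "take_front I s u = Some v \<Longrightarrow> trace_eq I u (s # v)"
proof (induction u arbitrary: v)
  case (Cons x u)
  show ?case
  proof (cases "x = s")
    case False
    with Cons.prems obtain v' where v': "I s x" "take_front I s u = Some v'" "v = x # v'"
      by (auto split: if_splits)
    have "trace_eq I (x # u) (x # s # v')" using Cons.IH[OF v'(2)] by (rule tr_Cons)
    moreover have "trace_eq I (x # s # v') (s # x # v')" using I_sym[OF v'(1)] by (rule tr_swap)
    ultimately show ?thesis using v' by (auto intro: tr_trans)
  qed (use Cons in \<open>auto intro: tr_refl tr_swap tr_Cons\<close>)
qed auto

lemma irr_trace_eq: "trace_eq I u v \<Longrightarrow> irr I u \<longleftrightarrow> irr I v"
proof (induction rule: trace_eq.induct)
  case (tr_swap x y u)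
  then show ?case using I_sym[of x y] I_irrefl by (cases "x = y") auto
next
  case (tr_Cons u v x)
  then show ?case using take_front_None_trace_eq[of u v x] by simp
qed simp_all

lemma irr_take_front: "irr I u \<Longrightarrow> take_front I s u = Some v \<Longrightarrow> irr I v \<and> take_front I s v = None"
  using irr_trace_eq take_front_Some_trace_eq by (metis irr.simps(2))

lemma irr_push: "irr I u \<Longrightarrow> irr I (push I s u)"
  by (cases "take_front I s u") (auto simp: push_def dest: irr_take_front)

lemma push_trace_eq: "trace_eq I u v \<Longrightarrow> trace_eq I (push I s u) (push I s v)"
  using take_front_trace_eq[of u v s] tr_Cons[of I u v s]
  by (cases "take_front I s u"; cases "take_front I s v") (auto simp: push_def)

text \<open>
  The next two lemmas say that \<open>push\<close> satisfies the relations \<open>s s = 1\<close> and \<open>s t = t s\<close>.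
\<close>

lemma push_push: "irr I u \<Longrightarrow> trace_eq I (push I s (push I s u)) u"
  using tr_sym[OF take_front_Some_trace_eq[of s u]] irr_take_front[of u s] tr_refl[of I u]
  by (cases "take_front I s u") (simp_all add: push_def)

lemma take_front_commute:
  assumes "I s t" and "take_front I s u = Some v"
  shows "rel_option (trace_eq I) (take_front I t u) (map_option (Cons s) (take_front I t v))"
  using take_front_trace_eq[OF take_front_Some_trace_eq[OF assms(2)], of t] assms(1) I_sym[OF assms(1)] I_irrefl
  by (cases "s = t") auto

lemma push_commute:
  assumes st: "I s t"
  shows "trace_eq I (push I s (push I t u)) (push I t (push I s u))"
proof -
  have ts: "I t s" "s \<noteq> t" "t \<noteq> s" using st I_sym I_irrefl by auto
  show ?thesis
  proof (cases "take_front I s u")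
    case None
    show ?thesis
    proof (cases "take_front I t u")
      case None
      then show ?thesis using \<open>take_front I s u = None\<close> st ts by (auto simp: push_def intro: tr_refl tr_swap tr_Cons)
    next
      case (Some v)
      with take_front_commute[OF ts(1) this] \<open>take_front I s u = None\<close> have "take_front I s v = None"
        by (cases "take_front I s v") auto
      then show ?thesis using Some None st ts by (auto simp: push_def intro: tr_refl tr_swap tr_Cons)
    qed
  next
    case s: (Some v)
    show ?thesis
    proof (cases "take_front I t u")
      case None
      with take_front_commute[OF st s] have "take_front I t v = None"
        by (cases "take_front I t v") auto
      then show ?thesis using s None st ts by (auto simp: push_def intro: tr_refl tr_swap tr_Cons)
    next
      case t: (Some v')
      with take_front_commute[OF st s] obtain v'' where v'': "take_front I t v = Some v''" "trace_eq I v' (s # v'')"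
        by (cases "take_front I t v") auto
      have "trace_eq I (push I s v') (push I s (s # v''))" by (rule push_trace_eq[OF v''(2)])
      then show ?thesis using s t v'' by (simp add: push_def)
    qed
  qed
qed

lemma foldr_push_trace_eq: "trace_eq I u v \<Longrightarrow> trace_eq I (foldr (push I) a u) (foldr (push I) a v)"
  by (induction a) (auto intro: push_trace_eq)

lemma irr_foldr_push: "irr I u \<Longrightarrow> irr I (foldr (push I) a u)"
  by (induction a) (auto intro: irr_push)

lemma foldr_push_irr: "irr I u \<Longrightarrow> foldr (push I) u [] = u"
  by (induction u) (auto simp: push_def)

end


lemma word_val_simps [simp]:
  "word_val W [] = \<one>\<^bsub>W\<^esub>" "word_val W (s # u) = s \<otimes>\<^bsub>W\<^esub> word_val W u"
  by (simp_all add: word_val_def)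

definition commuting_gens :: "('a, 'm) monoid_scheme \<Rightarrow> 'a set \<Rightarrow> 'a \<Rightarrow> 'a \<Rightarrow> bool"
  where "commuting_gens W S s t \<longleftrightarrow> s \<in> S \<and> t \<in> S \<and> s \<noteq> t \<and> s \<otimes>\<^bsub>W\<^esub> t = t \<otimes>\<^bsub>W\<^esub> s"

context coxeter_system
begin

abbreviation (input) "len \<equiv> cox_length W S"
abbreviation (input) "wv \<equiv> word_val W"
abbreviation (input) "red \<equiv> reduced_word W S"

lemma gen_closed [simp, intro]: "s \<in> S \<Longrightarrow> s \<in> carrier W"
  using gens_closed by blast

lemma gen_sq [simp]: "s \<in> S \<Longrightarrow> s \<otimes> s = \<one>" using gens_involution by blast
lemma gen_ne_one: "s \<in> S \<Longrightarrow> s \<noteq> \<one>" using gens_involution by blast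
lemma inv_gen [simp]: "s \<in> S \<Longrightarrow> inv s = s" by (simp add: inv_equality)

lemma gen_cancel [simp]: "s \<in> S \<Longrightarrow> x \<in> carrier W \<Longrightarrow> s \<otimes> (s \<otimes> x) = x"
  by (simp add: m_assoc[symmetric])

lemma wv_closed [simp, intro]: "u \<in> lists S \<Longrightarrow> wv u \<in> carrier W"
  by (induction u) auto

lemma wv_append: "u \<in> lists S \<Longrightarrow> v \<in> lists S \<Longrightarrow> wv (u @ v) = wv u \<otimes> wv v"
  by (induction u) (auto simp: m_assoc)

lemma wv_rev: "u \<in> lists S \<Longrightarrow> wv (rev u) = inv (wv u)"
proof (induction u)
  case (Cons s u)
  then have "wv (rev u @ [s]) = wv (rev u) \<otimes> wv [s]" by (intro wv_append) auto
  with Cons show ?case by (auto simp: inv_mult_group)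
qed simp

lemma wv_surj:
  assumes "x \<in> carrier W"
  shows "\<exists>u \<in> lists S. wv u = x"
proof -
  have "x \<in> generate W S" using assms gens_generate by simp
  then show ?thesis
  proof (induction rule: generate.induct)
    case one
    show ?case by (rule bexI[of _ "[]"]) auto
  next
    case (incl s)
    then show ?case by (intro bexI[of _ "[s]"]) auto
  next
    case (inv s)
    then show ?case by (intro bexI[of _ "[s]"]) auto
  next
    case (eng x y)
    then show ?case by (metis wv_append append_in_lists_conv)
  qed
qed

lemma len_le: "u \<in> lists S \<Longrightarrow> len (wv u) \<le> length u"
  unfolding cox_length_def by (rule Least_le) blast

lemma reduced_word_exists:
  assumes "x \<in> carrier W"
  shows "\<exists>u. red u \<and> wv u = x"
proof -
  have "\<exists>u \<in> lists S. wv u = x \<and> length u = len x"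
    unfolding cox_length_def
    by (rule LeastI_ex) (use wv_surj[OF assms] in blast)
  then show ?thesis by (auto simp: reduced_word_def)
qed

lemma redD: "red u \<Longrightarrow> u \<in> lists S" "red u \<Longrightarrow> len (wv u) = length u"
  by (auto simp: reduced_word_def)

lemma len_inv_le: "x \<in> carrier W \<Longrightarrow> len (inv x) \<le> len x"
  using reduced_word_exists[of x] len_le[of "rev u" for u] wv_rev
  by (metis in_lists_conv_set length_rev reduced_word_def set_rev)

lemma len_inv: "x \<in> carrier W \<Longrightarrow> len (inv x) = len x"
  using len_inv_le[of x] len_inv_le[of "inv x"] by simp

lemma red_rev: "red u \<Longrightarrow> red (rev u)"
  by (auto simp: reduced_word_def wv_rev len_inv)

lemma len_one [simp]: "len \<one> = 0"
  using len_le[of "[]"] by simp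

lemma len_Suc_le: "s \<in> S \<Longrightarrow> x \<in> carrier W \<Longrightarrow> len (s \<otimes> x) \<le> Suc (len x)"
  using reduced_word_exists[of x] len_le[of "s # u" for u]
  by (metis redD length_Cons lists.Cons word_val_simps(2))

lemma red_ConsD: "red (s # u) \<Longrightarrow> s \<in> S \<and> red u \<and> len (s \<otimes> wv u) = len (wv u) + 1"
  using len_Suc_le[of s "wv u"] len_le[of u] by (auto simp: reduced_word_def)

lemma red_Cons_iff: "red (s # u) \<longleftrightarrow> s \<in> S \<and> red u \<and> len (s \<otimes> wv u) = len (wv u) + 1"
  using red_ConsD[of s u] by (auto simp: reduced_word_def)

lemma red_Nil [simp]: "red []"
  by (simp add: reduced_word_def)

lemma red_appendD2: "red (u @ v) \<Longrightarrow> red v"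
  by (induction u) (auto dest: red_ConsD)

lemma red_appendD1: "red (u @ v) \<Longrightarrow> red u"
  using red_rev[of "u @ v"] red_appendD2[of "rev v" "rev u"] red_rev[of "rev u"] by simp

lemma symp_commuting: "symp (commuting_gens W S)"
  by (rule sympI) (auto simp: commuting_gens_def)

lemma irreflp_commuting: "irreflp (commuting_gens W S)"
  by (rule irreflpI) (auto simp: commuting_gens_def)

lemma wv_trace_eq: "trace_eq (commuting_gens W S) u v \<Longrightarrow> u \<in> lists S \<Longrightarrow> wv u = wv v"
proof (induction rule: trace_eq.induct)
  case (tr_swap x y u)
  then show ?case by (auto simp: commuting_gens_def m_assoc[symmetric])
next
  case (tr_trans u v z)
  moreover have "v \<in> lists S" using tr_trans(1,5) trace_eq_set by (metis in_lists_conv_set)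
  ultimately show ?case by simp
qed auto

lemma red_trace_eq: "trace_eq (commuting_gens W S) u v \<Longrightarrow> red u \<Longrightarrow> red v"
  unfolding reduced_word_def by (metis wv_trace_eq trace_eq_length trace_eq_set in_lists_conv_set)

end

sublocale coxeter_system \<subseteq> independence "commuting_gens W S"
  by unfold_locales (rule symp_commuting, rule irreflp_commuting)

context right_angled_coxeter_system
begin

abbreviation (input) "ind \<equiv> commuting_gens W S"
abbreviation (input) "psh \<equiv> push (commuting_gens W S)"

text \<open>
  In a right-angled system the relators are \<open>s s\<close>, the empty word for infinite order, and \<open>s t s t\<close>,
  and the last one expresses that \<open>s\<close> and \<open>t\<close> commute.
\<close>

lemma push_relator:
  assumes "s \<in> S" "t \<in> S" and z: "irr ind z"
  shows "trace_eq ind (foldr psh (concat (replicate (ord (s \<otimes> t)) [s, t])) z) z"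
proof (cases "s = t")
  case True
  then have "ord (s \<otimes> t) = 1" using assms by simp
  then show ?thesis using True push_push[OF z] by simp
next
  case False
  then consider "ord (s \<otimes> t) = 0" | "ord (s \<otimes> t) = 2" using right_angled[OF assms(1,2) False] by metis
  then show ?thesis
  proof cases
    case 2
    then have "(s \<otimes> t) [^] (2::nat) = \<one>" using assms pow_ord_eq_1[of "s \<otimes> t"] by simp
    then have "(s \<otimes> t) \<otimes> (s \<otimes> t) = \<one>" using assms by (simp add: numeral_2_eq_2)
    then have "inv (s \<otimes> t) = s \<otimes> t" using assms by (simp add: inv_equality)
    then have "t \<otimes> s = s \<otimes> t" using assms by (simp add: inv_mult_group)
    then have st: "ind s t" using assms False by (simp add: commuting_gens_def)
    have "trace_eq ind (psh t (psh s (psh t z))) (psh t (psh t (psh s z)))"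
      by (intro push_trace_eq push_commute st)
    also have "trace_eq ind (psh t (psh t (psh s z))) (psh s z)"
      by (intro push_push irr_push z)
    finally have "trace_eq ind (psh s (psh t (psh s (psh t z)))) (psh s (psh s z))"
      by (intro push_trace_eq)
    also have "trace_eq ind (psh s (psh s z)) z" by (rule push_push[OF z])
    finally show ?thesis using 2 by (simp add: numeral_2_eq_2)
  qed (simp add: tr_refl)
qed

lemma push_coxeter_step:
  assumes "coxeter_step W S u v"
  shows "trace_eq ind (foldr psh v []) (foldr psh u [])"
  using assms
proof cases
  case (1 a b s t)
  have "irr ind (foldr psh b [])" by (rule irr_foldr_push) simp
  from foldr_push_trace_eq[OF push_relator[OF 1(5,6) this], of a]
  show ?thesis using 1 by simp
qed

lemma push_equiv:
  assumes "equivclp (coxeter_step W S) u v"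
  shows "trace_eq ind (foldr psh u []) (foldr psh v [])"
  using assms
proof (induction rule: equivclp_induct)
  case (step v z)
  then show ?case using push_coxeter_step tr_sym by (metis tr_trans)
qed (rule tr_refl)

text \<open>
  This solves the word problem. Letting the letters of a word act successively by \<open>push\<close> on the empty word
  respects the defining relations up to rearrangement, so it depends only on the element of \<open>W\<close>;
  and it reproduces a word in which nothing cancels.
\<close>

lemma irr_word_unique:
  assumes "u \<in> lists S" "v \<in> lists S" "irr ind u" "irr ind v" "wv u = wv v"
  shows "trace_eq ind u v"
  using push_equiv[of u v] presentation[of u v] assms by (simp add: foldr_push_irr)

lemma push_in_lists: "s \<in> S \<Longrightarrow> u \<in> lists S \<Longrightarrow> psh s u \<in> lists S"
  using take_front_Some_trace_eq[of s u, THEN trace_eq_set] by (cases "take_front ind s u") (auto simp: push_def)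

lemma wv_push: "s \<in> S \<Longrightarrow> u \<in> lists S \<Longrightarrow> wv (psh s u) = s \<otimes> wv u"
proof (cases "take_front ind s u")
  case (Some v)
  assume s: "s \<in> S" and u: "u \<in> lists S"
  have "trace_eq ind u (s # v)" by (rule take_front_Some_trace_eq[OF Some])
  with s u have "wv u = s \<otimes> wv v" "v \<in> lists S" using wv_trace_eq trace_eq_set by fastforce+
  then show ?thesis using s Some by (simp add: push_def)
qed (simp add: push_def)

lemma red_imp_irr:
  assumes "red u"
  shows "irr ind u"
  using assms
proof (induction u)
  case (Cons s u)
  then have su: "s \<in> S" "red u" "u \<in> lists S" using red_ConsD[of s u] redD by auto
  have "take_front ind s u = None"
  proof (rule ccontr)
    assume "take_front ind s u \<noteq> None"
    then obtain v where v: "take_front ind s u = Some v" by auto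
    have tr: "trace_eq ind u (s # v)" by (rule take_front_Some_trace_eq[OF v])
    have "wv v = s \<otimes> wv u" using wv_push[OF su(1,3)] v by (simp add: push_def)
    moreover have "v \<in> lists S" using push_in_lists[OF su(1,3)] v by (simp add: push_def)
    ultimately have "len (s \<otimes> wv u) \<le> length v" using len_le by metis
    moreover have "length u = Suc (length v)" using trace_eq_length[OF tr] by simp
    ultimately show False using Cons.prems redD by fastforce
  qed
  with su Cons.IH show ?case by simp
qed simp

lemma red_unique: "red u \<Longrightarrow> red v \<Longrightarrow> wv u = wv v \<Longrightarrow> trace_eq ind u v"
  by (intro irr_word_unique red_imp_irr redD(1))

lemma irr_imp_red:
  assumes "u \<in> lists S" "irr ind u"
  shows "red u"
proof -
  obtain v where v: "red v" "wv v = wv u" using reduced_word_exists assms by blast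
  have "trace_eq ind v u"
    by (rule irr_word_unique[OF redD(1)[OF v(1)] assms(1) red_imp_irr[OF v(1)] assms(2) v(2)])
  then show ?thesis using v(1) by (rule red_trace_eq)
qed

text \<open>
  Acting by \<open>push\<close> keeps a word reduced and changes its number of letters by one.
\<close>

lemma len_gen_mult:
  assumes "s \<in> S" "x \<in> carrier W"
  shows "len (s \<otimes> x) = len x + 1 \<or> len x = len (s \<otimes> x) + 1"
proof -
  obtain u where u: "red u" "wv u = x" using reduced_word_exists assms by blast
  have uS: "u \<in> lists S" "len x = length u" using redD u by auto
  have "red (psh s u)"
    by (rule irr_imp_red[OF push_in_lists[OF assms(1) uS(1)] irr_push[OF red_imp_irr[OF u(1)]]])
  then have "len (s \<otimes> x) = length (psh s u)"
    using wv_push[OF assms(1) uS(1)] u redD by metis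
  moreover have "length (psh s u) = length u + 1 \<or> length u = length (psh s u) + 1"
    using take_front_Some_trace_eq[of s u, THEN trace_eq_length]
    by (cases "take_front ind s u") (auto simp: push_def)
  ultimately show ?thesis using uS by auto
qed

lemma red_commuting: "ind s t \<Longrightarrow> red [s, t]"
  by (rule irr_imp_red) (auto simp: commuting_gens_def)

end


section \<open>Galleries, panels and Weyl distance\<close>

fun path :: "'c set \<Rightarrow> ('c \<Rightarrow> 'c \<Rightarrow> 'a) \<Rightarrow> 'c \<Rightarrow> 'a list \<Rightarrow> 'c \<Rightarrow> bool"
  where
  "path C \<delta> x [] y \<longleftrightarrow> x \<in> C \<and> x = y"
| "path C \<delta> x (s # u) y \<longleftrightarrow> x \<in> C \<and> (\<exists>z. \<delta> x z = s \<and> path C \<delta> z u y)"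

lemma path_in: "path C \<delta> x u y \<Longrightarrow> x \<in> C \<and> y \<in> C"
  by (induction u arbitrary: x) auto

lemma path_append: "path C \<delta> x (u @ v) y \<longleftrightarrow> (\<exists>z. path C \<delta> x u z \<and> path C \<delta> z v y)"
  by (induction u arbitrary: x) (auto dest: path_in)

context building
begin

lemma dist_refl [simp]: "x \<in> C \<Longrightarrow> \<delta> x x = \<one>" by (simp add: WD1)

lemma dist_gen_sym:
  assumes "x \<in> C" "y \<in> C" "\<delta> x y = s" "s \<in> S"
  shows "\<delta> y x = s"
proof -
  have "\<delta> x x = s \<otimes> \<delta> y x \<or> \<delta> x x = \<delta> y x" using assms by (intro WD2)
  moreover have "x \<noteq> y" using assms gen_ne_one[OF assms(4)] WD1[of x y] by blast
  ultimately have "s \<otimes> \<delta> y x = \<one>" using assms WD1[of y x] by auto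
  then have "s \<otimes> (s \<otimes> \<delta> y x) = s" using assms by simp
  then show ?thesis using assms dist_closed by simp
qed

lemma path_dist: "path C \<delta> x u y \<Longrightarrow> red u \<Longrightarrow> \<delta> x y = wv u"
proof (induction u arbitrary: x)
  case (Cons s u)
  then obtain z where z: "x \<in> C" "\<delta> x z = s" "path C \<delta> z u y" by auto
  have zy: "z \<in> C" "y \<in> C" using path_in[OF z(3)] by auto
  have s: "s \<in> S" "red u" "len (s \<otimes> wv u) = len (wv u) + 1" using red_ConsD[OF Cons.prems(2)] by auto
  have "\<delta> z y = wv u" using Cons.IH z s by simp
  then show ?case using WD2'[of z y x s] z zy s by simp
qed simp

lemma path_exists:
  assumes "u \<in> lists S" "x \<in> C" "y \<in> C" "\<delta> x y = wv u"
  shows "path C \<delta> x u y"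
  using assms
proof (induction u arbitrary: x)
  case Nil
  then show ?case using WD1 by simp
next
  case (Cons s u)
  then have s: "s \<in> S" "u \<in> lists S" by auto
  obtain z where z: "z \<in> C" "\<delta> z x = s" "\<delta> z y = s \<otimes> \<delta> x y" using WD3 Cons.prems s by blast
  then have "\<delta> z y = wv u" using Cons.prems s by simp
  moreover have "\<delta> x z = s" using dist_gen_sym z Cons.prems s by blast
  ultimately show ?case using Cons.IH[of z] Cons.prems z s by auto
qed

lemma path_rev: "path C \<delta> x u y \<Longrightarrow> u \<in> lists S \<Longrightarrow> path C \<delta> y (rev u) x"
proof (induction u arbitrary: x)
  case (Cons s u)
  then obtain z where z: "x \<in> C" "\<delta> x z = s" "path C \<delta> z u y" by auto
  have "z \<in> C" using path_in[OF z(3)] by auto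
  then have "path C \<delta> z [s] x" using z Cons.prems dist_gen_sym[of x z s] by simp
  moreover have "path C \<delta> y (rev u) z" using Cons z by auto
  ultimately show ?case by (auto simp: path_append)
qed auto

lemma dist_inv:
  assumes "x \<in> C" "y \<in> C"
  shows "\<delta> y x = inv (\<delta> x y)"
proof -
  obtain u where u: "red u" "wv u = \<delta> x y" using reduced_word_exists dist_closed assms by blast
  then have "path C \<delta> x u y" using path_exists redD assms by metis
  then have "path C \<delta> y (rev u) x" using path_rev redD u by blast
  then have "\<delta> y x = wv (rev u)" using path_dist red_rev u by blast
  then show ?thesis using u wv_rev redD by metis
qed

lemma len_dist_sym: "x \<in> C \<Longrightarrow> y \<in> C \<Longrightarrow> len (\<delta> y x) = len (\<delta> x y)"
  by (simp add: dist_inv[of x y] len_inv dist_closed)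

lemma panel_self: "x \<in> C \<Longrightarrow> x \<in> panel C \<delta> s x"
  by (simp add: panel_def)

lemma panel_in: "d \<in> panel C \<delta> s x \<Longrightarrow> d \<in> C"
  by (simp add: panel_def)

lemma panel_sym: "x \<in> C \<Longrightarrow> s \<in> S \<Longrightarrow> d \<in> panel C \<delta> s x \<Longrightarrow> x \<in> panel C \<delta> s d"
  using dist_gen_sym[of x d s] by (auto simp: panel_def)

lemma panel_dist:
  assumes "x \<in> C" "s \<in> S" "d \<in> panel C \<delta> s x" "e \<in> panel C \<delta> s x" "d \<noteq> e"
  shows "\<delta> d e = s"
proof (cases "d = x")
  case True
  then show ?thesis using assms by (auto simp: panel_def)
next
  case False
  then have d: "d \<in> C" "\<delta> x d = s" "\<delta> d x = s"
    using assms dist_gen_sym[of x d s] by (auto simp: panel_def)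
  have e: "e \<in> C" using assms by (auto simp: panel_def)
  show ?thesis
  proof (cases "e = x")
    case False
    then have "\<delta> x e = s" using assms by (auto simp: panel_def)
    with WD2[OF assms(1) e d(1) assms(2) d(3)] have "\<delta> d e = s \<otimes> s \<or> \<delta> d e = s" by simp
    then show ?thesis using assms d e WD1[of d e] by simp
  qed (use d in simp)
qed

lemma panel_eq:
  assumes "x \<in> C" "s \<in> S" "d \<in> panel C \<delta> s x"
  shows "panel C \<delta> s d = panel C \<delta> s x"
proof -
  have sub: "panel C \<delta> s d \<subseteq> panel C \<delta> s x" if "x \<in> C" "d \<in> panel C \<delta> s x" for x d
  proof
    fix e assume e: "e \<in> panel C \<delta> s d"
    have d: "d \<in> C" "x \<in> panel C \<delta> s d"
      using that assms(2) panel_sym panel_in by blast+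
    show "e \<in> panel C \<delta> s x"
      using panel_dist[OF d(1) assms(2) d(2) e] panel_in[OF e]
      by (cases "x = e") (simp_all add: panel_def)
  qed
  have "d \<in> C" "x \<in> panel C \<delta> s d"
    using assms panel_sym panel_in by blast+
  then show ?thesis using sub assms by blast
qed

abbreviation (input) ascends :: "'c \<Rightarrow> 'a \<Rightarrow> 'c \<Rightarrow> bool"
  where "ascends c s x \<equiv> len (s \<otimes> \<delta> x c) = len (\<delta> x c) + 1"

lemma ascends_dist:
  assumes "c \<in> C" "x \<in> C" "s \<in> S" "ascends c s x" "d \<in> panel C \<delta> s x" "d \<noteq> x"
  shows "\<delta> d c = s \<otimes> \<delta> x c"
  using assms WD2'[of x c d s] dist_gen_sym[of x d s] by (auto simp: panel_def)

lemma ascends_unique: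
  assumes "c \<in> C" "x \<in> C" "s \<in> S" "ascends c s x" "d \<in> panel C \<delta> s x" "ascends c s d"
  shows "d = x"
  using ascends_dist[OF assms(1-5)] assms dist_closed[of x c] by (cases "d = x") auto

text \<open>
  All the chambers of a panel have the same distance from \<open>c\<close> except one, which is nearer.
\<close>

lemma proj_panel:
  assumes "c \<in> C" "x \<in> C" "s \<in> S" "ascends c s x"
  shows "proj W S \<delta> (panel C \<delta> s x) c = x"
proof -
  have less: "len (\<delta> c x) < len (\<delta> c d)" if "d \<in> panel C \<delta> s x" "d \<noteq> x" for d
    using ascends_dist[OF assms that] assms panel_in[OF that(1)]
      len_dist_sym[of x c] len_dist_sym[of d c] by simp
  show ?thesis
    unfolding proj_def is_arg_min_def
    using less panel_self[OF assms(2)] by (intro the_equality) (auto, metis less_asym)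
qed

text \<open>
  The Weyl distance can be read off from any gallery of reduced type, and such galleries are
  mapped to galleries of the same type.
\<close>

lemma preserves_dist:
  assumes adj: "\<And>x y s. x \<in> C \<Longrightarrow> y \<in> C \<Longrightarrow> s \<in> S \<Longrightarrow> \<delta> x y = s \<Longrightarrow> \<delta> (g x) (g y) = s"
    and g: "\<And>x. x \<in> C \<Longrightarrow> g x \<in> C" and xy: "x \<in> C" "y \<in> C"
  shows "\<delta> (g x) (g y) = \<delta> x y"
proof -
  obtain u where u: "red u" "wv u = \<delta> x y" using reduced_word_exists dist_closed xy by blast
  have "path C \<delta> x u y" using path_exists redD xy u by metis
  moreover have "path C \<delta> (g x) u (g y)" if "path C \<delta> x u y" "u \<in> lists S" for x
    using that
  proof (induction u arbitrary: x)
    case (Cons s u)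
    then obtain z where z: "x \<in> C" "\<delta> x z = s" "path C \<delta> z u y" by auto
    then have "z \<in> C" using path_in by metis
    then have "\<delta> (g x) (g z) = s" using adj[of x z s] z Cons.prems by simp
    moreover have "path C \<delta> (g z) u (g y)" using Cons z by simp
    ultimately show ?case using g z by auto
  qed (use g in auto)
  ultimately show ?thesis using path_dist u redD by metis
qed

end


section \<open>Chambers as colored words\<close>

locale colored_building = right_angled_building W S C \<delta>
  for W (structure) and S C \<delta> +
  fixes c0 and q :: "'a \<Rightarrow> nat" and h
  assumes c0: "c0 \<in> C"
    and thick: "s \<in> S \<Longrightarrow> q s \<ge> 2"
    and legal: "s \<in> S \<Longrightarrow> directed_legal_coloring W S C \<delta> q c0 s (h s)"
begin

lemma h_bij: "s \<in> S \<Longrightarrow> x \<in> C \<Longrightarrow> bij_betw (h s) (panel C \<delta> s x) {1..q s}"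
  using legal[of s]
  by (auto simp: directed_legal_coloring_def weak_legal_coloring_def panels_def colors_def)

lemma h_range: "s \<in> S \<Longrightarrow> x \<in> C \<Longrightarrow> h s x \<in> {1..q s}"
  using h_bij[of s x] panel_self[of x s] by (auto simp: bij_betw_def)

lemma h_inj: "s \<in> S \<Longrightarrow> x \<in> C \<Longrightarrow> d \<in> panel C \<delta> s x \<Longrightarrow> e \<in> panel C \<delta> s x \<Longrightarrow>
    h s d = h s e \<longleftrightarrow> d = e"
  using h_bij[of s x] by (auto simp: bij_betw_def inj_on_def)

lemma h_ascends: "s \<in> S \<Longrightarrow> x \<in> C \<Longrightarrow> ascends c0 s x \<Longrightarrow> h s x = 1"
  using legal[of s] proj_panel[OF c0, of x s]
  by (auto simp: directed_legal_coloring_def panels_def)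

lemma h_other:
  assumes "s \<in> S" "x \<in> C" "ascends c0 s x" "d \<in> panel C \<delta> s x" "d \<noteq> x"
  shows "h s d \<in> {2..q s}"
  using assms h_ascends[of s x] h_inj[of s x d x] h_range[of s d] panel_in[OF assms(4)]
    panel_self[OF assms(2), of s] by (cases "h s d = 1") auto

text \<open>
  In a residue whose type is a pair of commuting generators \<open>s\<close>, \<open>t\<close>, opposite sides of a square lie
  in the same tree-wall, and the projection between them is along \<open>t\<close>.
\<close>

lemma h_tree_wall:
  assumes st: "ind s t" and xy: "x \<in> C" "y \<in> C" "\<delta> x y = t"
    and c: "c \<in> panel C \<delta> s x" and d: "d \<in> panel C \<delta> s y" "\<delta> c d = t"
  shows "h s c = h s d"
proof -
  have S: "s \<in> S" "t \<in> S" "s \<noteq> t" "s \<otimes> t = t \<otimes> s" using st by (auto simp: commuting_gens_def)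
  let ?J = "{s} \<union> {t \<in> S - {s}. t \<otimes> s = s \<otimes> t}"
  let ?E = "{(x, y). x \<in> C \<and> y \<in> C \<and> \<delta> x y \<in> ?J}"
  have xyE: "(x, y) \<in> ?E" using xy S by auto
  have panE: "(z, e) \<in> ?E\<^sup>*" if "z \<in> C" "e \<in> panel C \<delta> s z" for z e
    using that by (auto simp: panel_def)
  have "panel C \<delta> s x \<subseteq> residue C \<delta> ?J x" using panE xy by (auto simp: residue_def)
  moreover have "panel C \<delta> s y \<subseteq> residue C \<delta> ?J x"
    using panE[OF xy(2)] xyE unfolding residue_def
    by (auto intro: converse_rtrancl_into_rtrancl)
  ultimately have "same_tree_wall W S C \<delta> s (panel C \<delta> s x) (panel C \<delta> s y)"
    using xy by (auto simp: same_tree_wall_def residues_def)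
  then have "h s c = h s (proj W S \<delta> (panel C \<delta> s y) c)"
    using legal[OF S(1)] xy c
    by (auto simp: directed_legal_coloring_def weak_legal_coloring_def panels_def)
  moreover have "proj W S \<delta> (panel C \<delta> s d) c = d"
  proof (rule proj_panel)
    show cd: "c \<in> C" "d \<in> C" "s \<in> S" using c d S panel_in by auto
    have "\<delta> d c = t" using dist_gen_sym cd d S by blast
    then show "ascends c s d" using red_ConsD[OF red_commuting[OF st]] S by simp
  qed
  moreover have "panel C \<delta> s d = panel C \<delta> s y" by (rule panel_eq[OF xy(2) S(1) d(1)])
  ultimately show ?thesis by simp
qed

definition step :: "'a \<times> nat \<Rightarrow> 'c \<Rightarrow> 'c"
  where "step c x = inv_into (panel C \<delta> (fst c) x) (h (fst c)) (snd c)"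

text \<open>
  The end of the gallery that starts in \<open>c\<^sub>0\<close>, where the pair \<open>(s, a)\<close> stands for moving inside the
  \<open>s\<close>-panel to the chamber of color \<open>a\<close>.
\<close>

definition chamber :: "('a \<times> nat) list \<Rightarrow> 'c"
  where "chamber cs = foldr step cs c0"

text \<open>
  The color 1 is excluded: in a gallery leading away from \<open>c\<^sub>0\<close> it would mean not to move.
\<close>

definition proper :: "('a \<times> nat) list \<Rightarrow> bool"
  where "proper cs \<longleftrightarrow> red (map fst cs) \<and> (\<forall>c \<in> set cs. snd c \<in> {2..q (fst c)})"

lemma ch_simps [simp]: "chamber [] = c0" "chamber (c # cs) = step c (chamber cs)"
  by (simp_all add: chamber_def)

lemma step_in:
  "s \<in> S \<Longrightarrow> x \<in> C \<Longrightarrow> a \<in> {1..q s} \<Longrightarrow> step (s, a) x \<in> panel C \<delta> s x"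
  "s \<in> S \<Longrightarrow> x \<in> C \<Longrightarrow> a \<in> {1..q s} \<Longrightarrow> h s (step (s, a) x) = a"
  using h_bij[of s x] by (auto simp: step_def bij_betw_def inv_into_into f_inv_into_f)

lemma step_h: "s \<in> S \<Longrightarrow> x \<in> C \<Longrightarrow> d \<in> panel C \<delta> s x \<Longrightarrow> step (s, h s d) x = d"
  using h_bij[of s x] by (auto simp: step_def bij_betw_def)

lemma proper_ConsD:
  assumes "proper ((s, a) # cs)"
  shows "proper cs" "s \<in> S" "a \<in> {2..q s}" "a \<in> {1..q s}"
  using assms red_ConsD[of s "map fst cs"] by (auto simp: proper_def)

lemma proper_Nil [simp]: "proper []" by (simp add: proper_def)

lemma proper_appendD: "proper (u @ v) \<Longrightarrow> proper v"
  using red_appendD2[of "map fst u" "map fst v"] by (auto simp: proper_def)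

lemma ascends_word: "red (s # u) \<Longrightarrow> \<delta> x c0 = wv u \<Longrightarrow> ascends c0 s x"
  using red_ConsD[of s u] by simp

lemma ch_proper: "proper cs \<Longrightarrow> chamber cs \<in> C \<and> \<delta> (chamber cs) c0 = wv (map fst cs)"
proof (induction cs)
  case (Cons c cs)
  obtain s a where c: "c = (s, a)" by (cases c)
  note p = proper_ConsD[OF Cons.prems[unfolded c]]
  have x: "chamber cs \<in> C" "\<delta> (chamber cs) c0 = wv (map fst cs)" using Cons.IH p by auto
  have asc: "ascends c0 s (chamber cs)"
    using Cons.prems x by (intro ascends_word) (auto simp: proper_def c)
  have d: "step (s, a) (chamber cs) \<in> panel C \<delta> s (chamber cs)" "h s (step (s, a) (chamber cs)) = a"
    using step_in p x by auto
  then have "step (s, a) (chamber cs) \<noteq> chamber cs" using h_ascends[OF p(2) x(1) asc] p by auto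
  then have "\<delta> (step (s, a) (chamber cs)) c0 = s \<otimes> \<delta> (chamber cs) c0"
    using ascends_dist[OF c0 x(1) p(2) asc d(1)] by simp
  then show ?case using x c panel_in[OF d(1)] by simp
qed (simp add: c0)

lemma ch_in [simp]: "proper cs \<Longrightarrow> chamber cs \<in> C" using ch_proper by blast

lemma ch_Cons:
  assumes "proper ((s, a) # cs)"
  shows "ascends c0 s (chamber cs)" "chamber ((s, a) # cs) \<in> panel C \<delta> s (chamber cs)"
    "h s (chamber ((s, a) # cs)) = a" "h s (chamber cs) = 1" "\<delta> (chamber ((s, a) # cs)) (chamber cs) = s"
proof -
  note p = proper_ConsD[OF assms]
  have x: "chamber cs \<in> C" "\<delta> (chamber cs) c0 = wv (map fst cs)" using ch_proper p by auto
  show asc: "ascends c0 s (chamber cs)"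
    using assms x by (intro ascends_word) (auto simp: proper_def)
  show d: "chamber ((s, a) # cs) \<in> panel C \<delta> s (chamber cs)" "h s (chamber ((s, a) # cs)) = a"
    using step_in p x by auto
  show b: "h s (chamber cs) = 1" by (rule h_ascends[OF p(2) x(1) asc])
  have "chamber ((s, a) # cs) \<noteq> chamber cs" using d b p by auto
  then show "\<delta> (chamber ((s, a) # cs)) (chamber cs) = s"
    using panel_dist[OF x(1) p(2) d(1) panel_self[OF x(1)]] by simp
qed

text \<open>
  The color of a chamber can be read off, and the previous chamber of the gallery is the
  unique one of the panel that is nearest to \<open>c\<^sub>0\<close>.
\<close>

lemma ch_inj: "proper cs \<Longrightarrow> proper ds \<Longrightarrow> map fst cs = map fst ds \<Longrightarrow> chamber cs = chamber ds \<Longrightarrow> cs = ds"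
proof (induction cs arbitrary: ds)
  case (Cons c cs)
  obtain s a where c: "c = (s, a)" by (cases c)
  obtain b ds' where ds: "ds = (s, b) # ds'" "map fst cs = map fst ds'"
    using Cons.prems c by (cases ds) auto
  note p = Cons.prems(1)[unfolded c] and p' = Cons.prems(2)[unfolded ds]
  note P = proper_ConsD[OF p] and P' = proper_ConsD[OF p']
  have eq: "chamber ((s, a) # cs) = chamber ((s, b) # ds')" using Cons.prems c ds by simp
  have "a = b" using ch_Cons(3)[OF p] ch_Cons(3)[OF p'] eq by simp
  moreover have "panel C \<delta> s (chamber cs) = panel C \<delta> s (chamber ds')"
    using panel_eq[OF _ P(2) ch_Cons(2)[OF p]] panel_eq[OF _ P(2) ch_Cons(2)[OF p']] P P' eq by simp
  then have "chamber cs = chamber ds'"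
    using ascends_unique[OF c0 _ P(2) ch_Cons(1)[OF p'] _ ch_Cons(1)[OF p]] P P'
      panel_self[of "chamber cs" s] by simp
  ultimately show ?case using Cons.IH[of ds'] P P' c ds by simp
qed simp

lemma ch_extend:
  assumes "proper cs" "red (s # map fst cs)" "v \<in> panel C \<delta> s (chamber cs)" "v \<noteq> chamber cs"
  shows "proper ((s, h s v) # cs)" "chamber ((s, h s v) # cs) = v"
proof -
  have s: "s \<in> S" using assms(2) red_ConsD by blast
  have x: "chamber cs \<in> C" "\<delta> (chamber cs) c0 = wv (map fst cs)" using ch_proper assms(1) by auto
  show "proper ((s, h s v) # cs)"
    using assms(1,2) h_other[OF s x(1) ascends_word[OF assms(2) x(2)] assms(3,4)]
    by (auto simp: proper_def)
  show "chamber ((s, h s v) # cs) = v" using step_h[OF s x(1) assms(3)] by simp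
qed

lemma ch_surj:
  assumes "red u" "v \<in> C" "\<delta> v c0 = wv u"
  shows "\<exists>cs. proper cs \<and> map fst cs = u \<and> chamber cs = v"
  using assms
proof (induction u arbitrary: v)
  case Nil
  then show ?case using WD1[of v c0] c0 by simp
next
  case (Cons s u)
  have s: "s \<in> S" "red u" using red_ConsD[OF Cons.prems(1)] by auto
  obtain x where x: "x \<in> C" "\<delta> x v = s" "\<delta> x c0 = s \<otimes> \<delta> v c0"
    using WD3 Cons.prems s c0 by blast
  then have "\<delta> x c0 = wv u" using Cons.prems s redD by simp
  with Cons.IH s x obtain cs where cs: "proper cs" "map fst cs = u" "chamber cs = x" by blast
  have "v \<in> panel C \<delta> s (chamber cs)" "v \<noteq> chamber cs"
    using cs x Cons.prems s gen_ne_one[of s] by (auto simp: panel_def)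
  then show ?case using ch_extend[OF cs(1)] cs Cons.prems by (intro exI[of _ "(s, h s v) # cs"]) auto
qed

lemma proper_word_exists: "v \<in> C \<Longrightarrow> \<exists>cs. proper cs \<and> chamber cs = v"
  using ch_surj reduced_word_exists dist_closed c0 by metis

lemma proper_trace_eq: "trace_eq (indep_fst ind) cs ds \<Longrightarrow> proper cs \<Longrightarrow> proper ds"
  using red_trace_eq[OF trace_eq_map[of "indep_fst ind" cs ds ind fst]] trace_eq_set[of "indep_fst ind" cs ds]
  by (auto simp: proper_def)

text \<open>
  The heart of the dictionary. The chamber \<open>z\<close> can be reached both ways round a square
  \<open>x, y, z, w\<close>, with sides \<open>t, s, t, s\<close>. The colors of the steps on opposite sides agree because these
  panels lie in a common tree-wall.
\<close>

lemma ch_swap: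
  assumes st: "ind s t" and p: "proper ((s, a) # (t, b) # cs)"
  shows "chamber ((s, a) # (t, b) # cs) = chamber ((t, b) # (s, a) # cs)"
proof -
  have S: "s \<in> S" "t \<in> S" "s \<noteq> t" "s \<otimes> t = t \<otimes> s" "ind t s"
    using st by (auto simp: commuting_gens_def)
  define y z where "y = chamber ((t, b) # cs)" and "z = chamber ((s, a) # (t, b) # cs)"
  have py: "proper ((t, b) # cs)" using proper_ConsD[OF p] by auto
  have yz: "y \<in> C" "z \<in> C" "\<delta> z y = s" "h s z = a" "h t y = b"
    using ch_in[OF p] ch_in[OF py] ch_Cons[OF p] ch_Cons[OF py] by (auto simp: y_def z_def)
  have "red (map fst ((t, b) # (s, a) # cs))"
    using red_trace_eq[of "s # t # map fst cs" "t # s # map fst cs"] st p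
    by (auto simp: proper_def intro: tr_swap)
  moreover have "wv (map fst ((t, b) # (s, a) # cs)) = \<delta> z c0"
    using ch_proper[OF p] wv_trace_eq[OF tr_swap[of ind s t "map fst cs"]] st p
      redD(1)[of "s # t # map fst cs"]
    by (auto simp: proper_def z_def simp del: in_lists_conv_set)
  ultimately obtain ds where ds: "proper ds" "map fst ds = t # s # map fst cs" "chamber ds = z"
    using ch_surj[of "map fst ((t, b) # (s, a) # cs)" z] yz by auto
  then obtain b' a' cs' where ds': "ds = (t, b') # (s, a') # cs'" and cs': "map fst cs' = map fst cs"
    by (auto simp: map_eq_Cons_conv)
  have pw: "proper ((s, a') # cs')" and px: "proper cs'"
    using proper_ConsD[OF ds(1)[unfolded ds']] proper_ConsD(1) by auto
  define w x where "w = chamber ((s, a') # cs')" and "x = chamber cs'"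
  have w: "w \<in> C" "x \<in> C" "\<delta> z w = t" "\<delta> w x = s" "h s w = a'" "h t z = b'"
    using ch_in[OF pw] ch_in[OF px] ch_Cons[OF pw] ch_Cons[OF ds(1)[unfolded ds']] ds
    by (auto simp: w_def x_def ds')
  have zx: "\<delta> z x = s \<otimes> t"
    using WD2'[of w x z t] red_ConsD[OF red_commuting[OF S(5)]] w yz S by simp
  \<comment> \<open>The second gallery to \<open>z\<close> could start from a different \<open>x\<close>. Completing the square at \<open>x\<close> gives another
    gallery of the original type to \<open>z\<close>, so by uniqueness \<open>x\<close> is the old chamber and \<open>m = y\<close>.\<close>
  obtain m where m: "m \<in> C" "\<delta> m z = s" "\<delta> m x = s \<otimes> \<delta> z x" using WD3 yz w S by blast
  then have mx: "\<delta> m x = t" using zx S(1,2) by simp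
  then have mt: "m \<in> panel C \<delta> t (chamber cs')" "m \<noteq> chamber cs'"
    using m w mx dist_gen_sym[of m x t] S gen_ne_one[of t] by (auto simp: panel_def x_def)
  have rt: "red (t # map fst cs')" "red (s # t # map fst cs')"
    using py p cs' by (auto simp: proper_def)
  note pm = ch_extend[OF px rt(1) mt]
  have zm: "z \<in> panel C \<delta> s (chamber ((t, h t m) # cs'))" "z \<noteq> chamber ((t, h t m) # cs')"
    using m yz S gen_ne_one[of s] pm(2) by (auto simp: panel_def)
  have pz: "proper ((s, h s z) # (t, h t m) # cs')" "chamber ((s, h s z) # (t, h t m) # cs') = z"
    using ch_extend[OF pm(1) _ zm] rt(2) by simp_all
  have "(s, h s z) # (t, h t m) # cs' = (s, a) # (t, b) # cs"
    by (rule ch_inj[OF pz(1) p]) (use cs' pz(2) in \<open>auto simp: z_def\<close>)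
  then have "cs' = cs" "m = y" using pm(2) by (auto simp: y_def)
  have xs: "w \<in> panel C \<delta> s x" "z \<in> panel C \<delta> s y" "y \<in> panel C \<delta> t x" "z \<in> panel C \<delta> t w"
    "\<delta> w z = t" "\<delta> y z = s" "\<delta> x y = t" "\<delta> x w = s"
    using w yz m mx \<open>m = y\<close> S dist_gen_sym[of w x s] dist_gen_sym[of z y s]
      dist_gen_sym[of z w t] dist_gen_sym[of y x t] by (auto simp: panel_def)
  have "h s w = h s z"
    by (rule h_tree_wall[OF st w(2) yz(1) xs(7) xs(1,2,5)])
  moreover have "h t y = h t z"
    by (rule h_tree_wall[OF S(5) w(2) w(1) xs(8) xs(3,4,6)])
  ultimately have "ds = (t, b) # (s, a) # cs" using w yz \<open>cs' = cs\<close> ds' by auto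
  then show ?thesis using ds(3) z_def by simp
qed

lemma ch_trace_eq: "trace_eq (indep_fst ind) cs ds \<Longrightarrow> proper cs \<Longrightarrow> chamber cs = chamber ds"
proof (induction rule: trace_eq.induct)
  case (tr_swap x y u)
  then show ?case using ch_swap[of "fst x" "fst y" "snd x" "snd y" u] by simp
next
  case (tr_Cons u v x)
  then show ?case using proper_ConsD(1)[of "fst x" "snd x" u] by simp
next
  case (tr_trans u v z)
  then show ?case using proper_trace_eq by metis
qed simp

text \<open>
  The types of both words are reduced words for the same element. Rearranging the first word to the
  type of the second one does not change its chamber, and then \<open>ch_inj\<close> applies.
\<close>

lemma ch_eq_imp_trace_eq:
  assumes "proper cs" "proper ds" "chamber cs = chamber ds"
  shows "trace_eq (indep_fst ind) cs ds"
proof -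
  have "trace_eq ind (map fst cs) (map fst ds)"
    using assms ch_proper[of cs] ch_proper[of ds] by (intro red_unique) (auto simp: proper_def)
  from trace_eq_lift[OF this refl] obtain es where
    es: "map fst es = map fst ds" "trace_eq (indep_fst ind) cs es" by blast
  have "es = ds" using es assms proper_trace_eq ch_trace_eq by (intro ch_inj) auto
  then show ?thesis using es by simp
qed

end


section \<open>Automorphisms fixing the base chamber\<close>

text \<open>
  The color of a letter \<open>s\<close> is changed by a permutation that may depend on the colored past of that
  letter.
\<close>

fun recolor :: "('l \<Rightarrow> 'l \<Rightarrow> bool) \<Rightarrow> ('l \<Rightarrow> ('l \<Rightarrow> 'x list) \<Rightarrow> 'x \<Rightarrow> 'x) \<Rightarrow> ('l \<times> 'x) list \<Rightarrow> ('l \<times> 'x) list"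
  where
  "recolor I \<tau> [] = []"
| "recolor I \<tau> (c # cs) = (fst c, \<tau> (fst c) (key I (fst c) cs) (snd c)) # recolor I \<tau> cs"

lemma map_fst_recolor [simp]: "map fst (recolor I \<tau> cs) = map fst cs"
  by (induction cs) auto

lemma (in independence) recolor_trace_eq:
  "trace_eq (indep_fst I) cs ds \<Longrightarrow> trace_eq (indep_fst I) (recolor I \<tau> cs) (recolor I \<tau> ds)"
proof (induction rule: trace_eq.induct)
  case (tr_swap x y u)
  have "I (fst y) (fst x)" by (rule I_sym) (use tr_swap in simp)
  then show ?case using tr_swap key_Cons_indep[of I x "fst y" u] key_Cons_indep[of I y "fst x" u]
    by (auto intro: trace_eq.tr_swap)
next
  case (tr_Cons u v x)
  then show ?case using key_trace_eq[OF symI irreflI, of u v] by (auto intro: trace_eq.tr_Cons)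
next
  case (tr_trans u v z)
  then show ?case by (blast intro: trace_eq.tr_trans)
qed (auto intro: tr_refl)

lemma Bij_iff: "g \<in> carrier (BijGroup A) \<longleftrightarrow> g \<in> extensional A \<and> bij_betw g A A"
  by (auto simp: BijGroup_def Bij_def)

context colored_building
begin

text \<open>
  Every panel is described by its chamber nearest to \<open>c\<^sub>0\<close>.
\<close>

lemma panel_base:
  assumes "x \<in> C" "s \<in> S"
  shows "\<exists>cs. proper cs \<and> red (s # map fst cs) \<and> x \<in> panel C \<delta> s (chamber cs)"
proof (cases "ascends c0 s x")
  case True
  obtain cs where cs: "proper cs" "chamber cs = x" using proper_word_exists assms by blast
  then have "red (s # map fst cs)"
    using True assms ch_proper[of cs] by (auto simp: red_Cons_iff proper_def)
  then show ?thesis using cs assms panel_self by blast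
next
  case False
  then have len: "len (\<delta> x c0) = len (s \<otimes> \<delta> x c0) + 1"
    using len_gen_mult[of s "\<delta> x c0"] assms c0 dist_closed by auto
  obtain y where y: "y \<in> C" "\<delta> y x = s" "\<delta> y c0 = s \<otimes> \<delta> x c0"
    using WD3 assms c0 by blast
  obtain cs where cs: "proper cs" "chamber cs = y" using proper_word_exists y by blast
  have "s \<otimes> \<delta> y c0 = \<delta> x c0" using y assms c0 dist_closed by simp
  then have "red (s # map fst cs)"
    using len y cs assms ch_proper[of cs] by (auto simp: red_Cons_iff proper_def)
  then show ?thesis using cs y assms by (intro exI[of _ cs]) (auto simp: panel_def)
qed

context
  fixes \<tau> :: "'a \<Rightarrow> ('a \<Rightarrow> nat list) \<Rightarrow> nat \<Rightarrow> nat"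
  assumes \<tau>_bij: "\<And>s \<kappa>. s \<in> S \<Longrightarrow> bij_betw (\<tau> s \<kappa>) {1..q s} {1..q s}"
    and \<tau>_one: "\<And>s \<kappa>. s \<in> S \<Longrightarrow> \<tau> s \<kappa> 1 = 1"
begin

lemma \<tau>_bij2: "s \<in> S \<Longrightarrow> bij_betw (\<tau> s \<kappa>) {2..q s} {2..q s}"
proof -
  assume s: "s \<in> S"
  have "bij_betw (\<tau> s \<kappa>) ({1..q s} - {1}) ({1..q s} - {1})"
    using bij_betw_DiffI[OF \<tau>_bij[OF s] bij_betw_singletonI[of "\<tau> s \<kappa>" 1 1]] thick[OF s] \<tau>_one[OF s]
    by auto
  moreover have "{1..q s} - {1} = {2..q s}" by auto
  ultimately show ?thesis by simp
qed

lemma proper_recolor: "proper cs \<Longrightarrow> proper (recolor ind \<tau> cs)"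
proof (induction cs)
  case (Cons c cs)
  have p: "proper ((fst c, snd c) # cs)" using Cons.prems by simp
  note P = proper_ConsD[OF p]
  have "\<tau> (fst c) (key ind (fst c) cs) (snd c) \<in> {2..q (fst c)}"
    by (rule bij_betwE[OF \<tau>_bij2[OF P(2)], rule_format, OF P(3)])
  then show ?case using Cons.IH[OF P(1)] Cons.prems by (simp add: proper_def)
qed simp

lemma recolor_surj: "proper ds \<Longrightarrow> \<exists>cs. proper cs \<and> map fst cs = map fst ds \<and> recolor ind \<tau> cs = ds"
proof (induction ds)
  case (Cons d ds)
  have p: "proper ((fst d, snd d) # ds)" using Cons.prems by simp
  note P = proper_ConsD[OF p]
  obtain cs where cs: "proper cs" "map fst cs = map fst ds" "recolor ind \<tau> cs = ds"
    using Cons.IH P(1) by blast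
  have "snd d \<in> \<tau> (fst d) (key ind (fst d) cs) ` {2..q (fst d)}"
    using \<tau>_bij2[OF P(2)] P(3) by (auto simp: bij_betw_def)
  then obtain a where a: "a \<in> {2..q (fst d)}" "\<tau> (fst d) (key ind (fst d) cs) a = snd d" by auto
  then show ?case using cs Cons.prems
    by (intro exI[of _ "(fst d, a) # cs"]) (auto simp: proper_def)
qed simp

text \<open>
  The word chosen for a chamber is irrelevant, since \<open>recolor\<close> respects rearrangements.
\<close>

definition recolor_aut :: "'c \<Rightarrow> 'c"
  where "recolor_aut = (\<lambda>v \<in> C. chamber (recolor ind \<tau> (SOME cs. proper cs \<and> chamber cs = v)))"

lemma recolor_aut_ch:
  assumes "proper cs"
  shows "recolor_aut (chamber cs) = chamber (recolor ind \<tau> cs)"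
proof -
  let ?ds = "SOME ds. proper ds \<and> chamber ds = chamber cs"
  have ds: "proper ?ds" "chamber ?ds = chamber cs"
    using someI[of "\<lambda>ds. proper ds \<and> chamber ds = chamber cs" cs] assms by auto
  then have "trace_eq (indep_fst ind) (recolor ind \<tau> ?ds) (recolor ind \<tau> cs)"
    using assms by (intro recolor_trace_eq ch_eq_imp_trace_eq)
  then show ?thesis
    using ch_trace_eq proper_recolor[OF ds(1)] assms by (simp add: recolor_aut_def)
qed

lemma recolor_aut_in: "v \<in> C \<Longrightarrow> recolor_aut v \<in> C"
  using proper_word_exists[of v] recolor_aut_ch proper_recolor by auto

text \<open>
  The key belongs to the panel and not to the chamber, so on each panel the map acts on colors
  by a single permutation; this gives both adjacency and the local action.
\<close>

lemma recolor_aut_panel: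
  assumes "proper cs" "red (s # map fst cs)" "v \<in> panel C \<delta> s (chamber cs)"
  shows "recolor_aut v \<in> panel C \<delta> s (recolor_aut (chamber cs)) \<and>
    h s (recolor_aut v) = \<tau> s (key ind s cs) (h s v)"
proof -
  have s: "s \<in> S" using assms(2) red_ConsD by blast
  show ?thesis
  proof (cases "v = chamber cs")
    case True
    have "h s (chamber ds) = 1" if "proper ds" "red (s # map fst ds)" for ds
      using h_ascends[OF s, of "chamber ds"] ch_proper[OF that(1)] ascends_word[OF that(2), of "chamber ds"] by blast
    from this[OF assms(1,2)] this[OF proper_recolor[OF assms(1)]] show ?thesis
      using True assms s \<tau>_one panel_self[of "recolor_aut (chamber cs)" s]
        ch_in[OF proper_recolor[OF assms(1)]]
        recolor_aut_ch[OF assms(1)] by simp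
  next
    case False
    from ch_extend[OF assms this] have v: "proper ((s, h s v) # cs)" "chamber ((s, h s v) # cs) = v" .
    have "recolor_aut v = chamber (recolor ind \<tau> ((s, h s v) # cs))"
      using recolor_aut_ch[OF v(1)] v(2) by simp
    then show ?thesis
      using ch_Cons[of s "\<tau> s (key ind s cs) (h s v)" "recolor ind \<tau> cs"] proper_recolor[OF v(1)]
        recolor_aut_ch[OF assms(1)] by simp
  qed
qed

lemma recolor_aut_dist:
  assumes "x \<in> C" "y \<in> C"
  shows "\<delta> (recolor_aut x) (recolor_aut y) = \<delta> x y"
proof (rule preserves_dist[OF _ recolor_aut_in assms])
  fix x y s assume x: "x \<in> C" and y: "y \<in> C" and s: "s \<in> S" and xy: "\<delta> x y = s"
  obtain cs where cs: "proper cs" "red (s # map fst cs)" "x \<in> panel C \<delta> s (chamber cs)"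
    using panel_base x s by blast
  have "y \<in> panel C \<delta> s x" using xy y by (simp add: panel_def)
  then have y': "y \<in> panel C \<delta> s (chamber cs)" using panel_eq[OF _ s cs(3)] cs by simp
  have "x \<noteq> y" using xy x s gen_ne_one[of s] by auto
  then have "h s x \<noteq> h s y" using h_inj[OF s _ cs(3) y'] cs by simp
  then have "\<tau> s (key ind s cs) (h s x) \<noteq> \<tau> s (key ind s cs) (h s y)"
    using inj_on_eq_iff[OF bij_betw_imp_inj_on[OF \<tau>_bij[OF s]] h_range[OF s x] h_range[OF s y]]
    by blast
  then have "recolor_aut x \<noteq> recolor_aut y"
    using recolor_aut_panel[OF cs] recolor_aut_panel[OF cs(1,2) y'] by auto
  then show "\<delta> (recolor_aut x) (recolor_aut y) = s"
    using panel_dist[OF _ s] recolor_aut_panel[OF cs] recolor_aut_panel[OF cs(1,2) y']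
      recolor_aut_in[of "chamber cs"] cs by simp
qed

lemma recolor_aut_building_aut: "recolor_aut \<in> building_auts C \<delta>"
proof -
  have "inj_on recolor_aut C"
  proof (rule inj_onI)
    fix x y assume "x \<in> C" "y \<in> C" "recolor_aut x = recolor_aut y"
    then show "x = y" using recolor_aut_dist[of x y] recolor_aut_in[of x] WD1[of x y] by simp
  qed
  moreover have "recolor_aut ` C = C"
  proof
    show "C \<subseteq> recolor_aut ` C"
    proof
      fix v assume "v \<in> C"
      then obtain ds where ds: "proper ds" "chamber ds = v" using proper_word_exists by blast
      obtain cs where "proper cs" "recolor ind \<tau> cs = ds" using recolor_surj[OF ds(1)] by blast
      then show "v \<in> recolor_aut ` C" using recolor_aut_ch ds by (intro image_eqI[of _ _ "chamber cs"]) auto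
    qed
  qed (use recolor_aut_in in auto)
  moreover have "recolor_aut \<in> extensional C" by (simp add: recolor_aut_def)
  ultimately show ?thesis
    by (auto simp: building_auts_def Bij_iff bij_betw_def recolor_aut_dist)
qed

lemma recolor_aut_local:
  assumes "proper cs" "red (s # map fst cs)" "v \<in> panel C \<delta> s (chamber cs)"
  shows "local_action C \<delta> q h recolor_aut s v = restrict (\<tau> s (key ind s cs)) (colors q s)"
proof -
  have s: "s \<in> S" using assms(2) red_ConsD by blast
  have eq: "panel C \<delta> s v = panel C \<delta> s (chamber cs)" by (rule panel_eq) (use assms s in auto)
  show ?thesis unfolding local_action_def
  proof (rule restrict_ext)
    fix a assume a: "a \<in> colors q s"
    have "chamber cs \<in> C" using assms by simp
    note bij = h_bij[OF s this]
    have "inv_into (panel C \<delta> s v) (h s) a \<in> panel C \<delta> s (chamber cs)"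
      "h s (inv_into (panel C \<delta> s v) (h s) a) = a"
      using bij a unfolding eq by (auto simp: bij_betw_def colors_def inv_into_into f_inv_into_f)
    then show "h s (recolor_aut (inv_into (panel C \<delta> s v) (h s) a)) = \<tau> s (key ind s cs) a"
      using recolor_aut_panel[OF assms(1,2)] by simp
  qed
qed

lemma recolor_aut_universal:
  assumes "\<And>s \<kappa>. s \<in> S \<Longrightarrow> restrict (\<tau> s \<kappa>) (colors q s) \<in> F s"
  shows "recolor_aut \<in> stabilizer_on (universal_group S C \<delta> q h F) c0"
proof -
  have "recolor_aut c0 = c0" using recolor_aut_ch[of "[]"] by simp
  moreover have "local_action C \<delta> q h recolor_aut s v \<in> F s" if "s \<in> S" "v \<in> C" for s v
    using panel_base[OF that(2,1)] recolor_aut_local assms[OF that(1)] by metis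
  ultimately show ?thesis
    using recolor_aut_building_aut by (simp add: stabilizer_on_def universal_group_def)
qed

end

text \<open>
  This is the supply of elements of the universal group: the permutations of the colors can be
  prescribed independently for all keys.
\<close>

lemma recolor_extension:
  assumes F: "\<And>s. s \<in> S \<Longrightarrow> F s \<subseteq> carrier (BijGroup (colors q s))"
    and \<tau>: "\<And>s \<kappa>. s \<in> S \<Longrightarrow> \<tau> s \<kappa> \<in> stabilizer_on (F s) 1"
  shows "\<exists>g \<in> stabilizer_on (universal_group S C \<delta> q h F) c0.
    \<forall>cs. proper cs \<longrightarrow> g (chamber cs) = chamber (recolor ind \<tau> cs) \<and> proper (recolor ind \<tau> cs)"
proof -
  have B: "\<tau> s \<kappa> \<in> carrier (BijGroup (colors q s))" if "s \<in> S" for s \<kappa>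
    using F[OF that] \<tau>[OF that, of \<kappa>] by (auto simp: stabilizer_on_def)
  have bij: "bij_betw (\<tau> s \<kappa>) {1..q s} {1..q s}" "\<tau> s \<kappa> 1 = 1" if "s \<in> S" for s \<kappa>
    using B[OF that, of \<kappa>] \<tau>[OF that, of \<kappa>] by (auto simp: Bij_iff colors_def stabilizer_on_def)
  have "restrict (\<tau> s \<kappa>) (colors q s) \<in> F s" if "s \<in> S" for s \<kappa>
    using B[OF that, of \<kappa>] \<tau>[OF that, of \<kappa>]
    by (auto simp: Bij_iff stabilizer_on_def extensional_restrict)
  from recolor_aut_universal[OF bij this] show ?thesis
    using recolor_aut_ch[OF bij] proper_recolor[OF bij]
    by (intro bexI[of _ "recolor_aut \<tau>"]) auto
qed


abbreviation fixing_auts :: "('c \<Rightarrow> 'c) set"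
  where "fixing_auts \<equiv> stabilizer_on (building_auts C \<delta>) c0"

lemma fixing_autsD:
  assumes "g \<in> fixing_auts"
  shows "g c0 = c0" "x \<in> C \<Longrightarrow> g x \<in> C" "x \<in> C \<Longrightarrow> y \<in> C \<Longrightarrow> \<delta> (g x) (g y) = \<delta> x y"
    "g \<in> extensional C" "bij_betw g C C"
  using assms by (auto simp: stabilizer_on_def building_auts_def Bij_iff bij_betw_def)

lemma fixing_auts_inv:
  assumes "g \<in> fixing_auts"
  shows "restrict (inv_into C g) C \<in> fixing_auts"
proof -
  let ?i = "inv_into C g"
  note g = fixing_autsD[OF assms]
  have i: "?i x \<in> C" "g (?i x) = x" if "x \<in> C" for x
    using g(5) that by (auto simp: bij_betw_def inv_into_into f_inv_into_f)
  have "?i c0 = c0" using g(1,5) c0 by (metis bij_betw_inv_into_left)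
  moreover have "bij_betw (restrict ?i C) C C" using bij_betw_inv_into[OF g(5)] by simp
  moreover have "\<delta> (?i x) (?i y) = \<delta> x y" if "x \<in> C" "y \<in> C" for x y
    using g(3)[OF i(1)[OF that(1)] i(1)[OF that(2)]] i(2) that by simp
  ultimately show ?thesis
    using c0 by (auto simp: stabilizer_on_def building_auts_def Bij_iff)
qed

text \<open>
  The colored word of the image of a gallery under \<open>g\<close>; the types of the steps do not change.
\<close>

fun image_word :: "('c \<Rightarrow> 'c) \<Rightarrow> ('a \<times> nat) list \<Rightarrow> ('a \<times> nat) list"
  where
  "image_word g [] = []"
| "image_word g (c # cs) = (fst c, h (fst c) (g (chamber (c # cs)))) # image_word g cs"

lemma map_fst_image_word [simp]: "map fst (image_word g cs) = map fst cs"
  by (induction cs) auto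

lemma image_word_append: "\<exists>us. image_word g (cs @ ds) = us @ image_word g ds \<and> map fst us = map fst cs"
proof (induction cs)
  case (Cons c cs)
  then obtain us where "image_word g (cs @ ds) = us @ image_word g ds" "map fst us = map fst cs"
    by blast
  then show ?case by (intro exI[of _ "(fst c, h (fst c) (g (chamber (c # cs @ ds)))) # us"]) simp
qed simp

lemma image_word:
  assumes g: "g \<in> fixing_auts" and "proper cs"
  shows "proper (image_word g cs)" "chamber (image_word g cs) = g (chamber cs)"
proof -
  have "proper (image_word g cs) \<and> chamber (image_word g cs) = g (chamber cs)" using assms(2)
  proof (induction cs)
    case (Cons c cs)
    obtain s a where c: "c = (s, a)" by (cases c)
    note p = Cons.prems[unfolded c]
    note P = proper_ConsD[OF p]
    let ?v = "chamber ((s, a) # cs)"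
    have IH: "proper (image_word g cs)" "chamber (image_word g cs) = g (chamber cs)" using Cons.IH P by auto
    have "\<delta> (g (chamber cs)) (g ?v) = s"
      using fixing_autsD(3)[OF g, of "chamber cs" ?v] P(1,2) ch_in[OF p] ch_in[OF P(1)] ch_Cons(5)[OF p]
        dist_gen_sym[of ?v "chamber cs" s] by simp
    moreover have "g ?v \<in> C" "g (chamber cs) \<in> C" using fixing_autsD(2)[OF g] ch_in[OF p] ch_in[OF P(1)] by auto
    ultimately have "g ?v \<in> panel C \<delta> s (chamber (image_word g cs))" "g ?v \<noteq> chamber (image_word g cs)"
      using IH gen_ne_one[OF P(2)] by (auto simp: panel_def)
    moreover have "red (s # map fst (image_word g cs))" using p by (simp add: proper_def)
    ultimately show ?case using ch_extend[OF IH(1)] c by auto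
  qed (use fixing_autsD[OF g] in simp)
  then show "proper (image_word g cs)" "chamber (image_word g cs) = g (chamber cs)" by auto
qed

lemma image_word_unique:
  assumes "g \<in> fixing_auts" "proper cs" "proper ds" "map fst ds = map fst cs" "chamber ds = g (chamber cs)"
  shows "ds = image_word g cs"
  using assms image_word[OF assms(1,2)] by (intro ch_inj) auto

end


section \<open>Positions of a reduced word\<close>

text \<open>
  Coordinates as a colored word. With \<open>x = id\<close> the letters are labelled by their positions, which
  allows one to follow them through rearrangements.
\<close>

definition cword :: "'l list \<Rightarrow> (nat \<Rightarrow> 'x) \<Rightarrow> ('l \<times> 'x) list"
  where "cword w x = rev (map (\<lambda>i. (letter w i, x i)) [1..<Suc (length w)])"

lemma cword_Nil [simp]: "cword [] x = []" by (simp add: cword_def)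

lemma letter_snoc: "i \<in> positions w \<Longrightarrow> letter (w @ [s]) i = letter w i"
  by (auto simp: letter_def positions_def nth_append)

lemma cword_snoc: "cword (w @ [s]) x = (s, x (Suc (length w))) # cword w x"
proof -
  have "map (\<lambda>i. (letter (w @ [s]) i, x i)) [1..<Suc (length w)]
      = map (\<lambda>i. (letter w i, x i)) [1..<Suc (length w)]"
    using letter_snoc[of _ w s] by (auto simp: positions_def)
  then show ?thesis by (simp add: cword_def letter_def)
qed

lemma map_fst_cword [simp]: "map fst (cword w x) = rev w"
  by (induction w rule: rev_induct) (auto simp: cword_snoc)

lemma cword_cong: "(\<And>i. i \<in> positions w \<Longrightarrow> x i = y i) \<Longrightarrow> cword w x = cword w y"
  by (auto simp: cword_def positions_def)

lemma cword_eqD: "cword w x = cword w y \<Longrightarrow> i \<in> positions w \<Longrightarrow> x i = y i"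
  by (auto simp: cword_def positions_def simp del: upt_Suc)

lemma length_cword [simp]: "length (cword w x) = length w"
  by (simp add: cword_def del: upt_Suc)

lemma cword_map: "cword w x = map (apsnd x) (cword w id)"
  by (simp add: cword_def rev_map)

lemma distinct_cword: "distinct (cword w id)"
  by (auto simp: cword_def distinct_map inj_on_def)

lemma set_cword: "set (cword w x) = (\<lambda>i. (letter w i, x i)) ` positions w"
  by (auto simp: cword_def positions_def)

lemma letter_take: "i \<in> {1..k} \<Longrightarrow> letter (take k w) i = letter w i"
  by (auto simp: letter_def)

lemma cword_take:
  assumes "k \<le> length w"
  shows "cword (take k w) x = rev (map (\<lambda>i. (letter w i, x i)) [1..<Suc k])"
  using assms letter_take[of _ k w] by (auto simp: cword_def)

lemma cword_take_Suc:
  "k < length w \<Longrightarrow> cword (take (Suc k) w) x = (letter w (Suc k), x (Suc k)) # cword (take k w) x"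
  by (simp add: cword_take)

lemma cword_split:
  assumes "t \<in> positions w"
  shows "\<exists>p. cword w x = p @ (letter w t, x t) # cword (take (t - 1) w) x"
proof -
  have t: "1 \<le> t" "t \<le> length w" using assms by (auto simp: positions_def)
  then have "[1..<Suc (length w)] = [1..<t] @ t # [Suc t..<Suc (length w)]"
    by (metis upt_add_eq_append upt_conv_Cons le_SucI le_add_diff_inverse less_Suc_eq_le)
  then show ?thesis using t by (simp add: cword_take) (simp add: cword_def)
qed

lemma cword_surj:
  assumes "map fst ds = rev w"
  shows "\<exists>x \<in> extensional (positions w). ds = cword w x"
  using assms
proof (induction w arbitrary: ds rule: rev_induct)
  case (snoc s w)
  then obtain a ds' where ds: "ds = (s, a) # ds'" "map fst ds' = rev w"
    by (auto simp: map_eq_Cons_conv)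
  obtain x where x: "x \<in> extensional (positions w)" "ds' = cword w x" using snoc.IH ds by blast
  let ?x = "\<lambda>i \<in> positions (w @ [s]). if i = Suc (length w) then a else x i"
  have "cword w ?x = cword w x" by (rule cword_cong) (auto simp: positions_def)
  then have "ds = cword (w @ [s]) ?x" using ds x by (simp add: cword_snoc) (simp add: positions_def)
  moreover have "?x \<in> extensional (positions (w @ [s]))" by (rule restrict_extensional)
  ultimately show ?case by blast
qed (auto simp: positions_def)

context right_angled_coxeter_system
begin

text \<open>
  An elementary transposition exchanges letters that commute in \<open>W\<close>. In a reduced word two equal
  letters are never neighbours, so the two letters are distinct and independent;
  hence letters that are not independent keep their order.
\<close>

lemma rep_word_invariant:
  assumes "rep_word W w \<sigma> v" and w: "red w"
  shows "trace_eq ind w v \<and> bij_betw \<sigma> (positions w) (positions w) \<and>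
    (\<forall>i \<in> positions w. letter v (\<sigma> i) = letter w i) \<and>
    (\<forall>i \<in> positions w. \<forall>j \<in> positions w. i < j \<longrightarrow>
       \<not> ind (letter w i) (letter w j) \<longrightarrow> \<sigma> i < \<sigma> j)"
  using assms(1)
proof induction
  case rep_id
  then show ?case using bij_betw_id[of "positions w"] by (simp add: id_def tr_refl)
next
  case (rep_step \<sigma> v i)
  let ?\<tau> = "transpose i (i + 1)"
  let ?v = "v[i - 1 := v ! i, i := v ! (i - 1)]"
  have len: "length v = length w" using trace_eq_length rep_step.IH by metis
  have v: "red v" using red_trace_eq rep_step.IH w by blast
  define A x y B where "A = take (i - 1) v" and "x = v ! (i - 1)" and "y = v ! i" and "B = drop (i + 1) v"
  have lA: "length A = i - 1" using rep_step.hyps by (simp add: A_def)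
  have vA: "v = A @ x # y # B"
    using rep_step.hyps unfolding A_def x_def y_def B_def
    by (metis Cons_nth_drop_Suc Suc_diff_1 Suc_eq_plus1 Suc_le_eq append_take_drop_id less_imp_diff_less One_nat_def)
  have v': "?v = A @ y # x # B"
    using rep_step.hyps lA
    by (cases i) (auto simp: x_def[symmetric] y_def[symmetric] vA list_update_append nth_append)
  have xy: "x \<in> S" "y \<in> S" "x \<otimes> y = y \<otimes> x"
    using rep_step.hyps redD(1)[OF v] by (auto simp: x_def y_def letter_def)
  have "x \<noteq> y"
  proof
    assume "x = y"
    moreover have "red [x, y]" using v red_appendD2[of A] red_appendD1[of "[x, y]" B] vA by simp
    ultimately show False using redD(2)[of "[x, y]"] xy by simp
  qed
  then have xy': "ind x y" "ind y x" using xy by (auto simp: commuting_gens_def)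
  have "trace_eq ind v ?v"
    using trace_eq_append_left[OF tr_swap[of ind x y B, OF xy'(1)], of A] v' vA by simp
  then have tr: "trace_eq ind w ?v" using rep_step.IH by (blast intro: tr_trans)
  have inP: "i \<in> positions w" "i + 1 \<in> positions w" using rep_step.hyps len by (auto simp: positions_def)
  have tau: "bij_betw ?\<tau> (positions w) (positions w)"
    using inP by (simp add: bij_betw_transpose_iff)
  have bij: "bij_betw (?\<tau> \<circ> \<sigma>) (positions w) (positions w)"
    using rep_step.IH tau bij_betw_trans by blast
  have lett: "letter ?v (?\<tau> k) = letter v k" if "k \<in> positions w" for k
    using that rep_step.hyps len
    by (auto simp: letter_def transpose_def positions_def nth_list_update)
  have \<sigma>in: "\<sigma> k \<in> positions w" if "k \<in> positions w" for k
    using rep_step.IH that bij_betwE by blast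
  have ord: "(?\<tau> \<circ> \<sigma>) a < (?\<tau> \<circ> \<sigma>) b"
    if ab: "a \<in> positions w" "b \<in> positions w" "a < b" "\<not> ind (letter w a) (letter w b)" for a b
  proof -
    have less: "\<sigma> a < \<sigma> b" using rep_step.IH ab by blast
    have "\<not> (\<sigma> a = i \<and> \<sigma> b = i + 1)"
    proof
      assume eq: "\<sigma> a = i \<and> \<sigma> b = i + 1"
      then have "letter w a = x" "letter w b = y"
        using rep_step.IH ab by (auto simp: x_def y_def letter_def)
      then show False using ab xy' by simp
    qed
    then show ?thesis using less by (auto simp: transpose_def)
  qed
  show ?case
    using rep_step.IH by (intro conjI tr bij ballI impI ord) (simp_all add: lett \<sigma>in del: One_nat_def)
qed

lemma prec_dependent:
  assumes "red w" "a \<in> positions w" "b \<in> positions w" "a < b" "\<not> ind (letter w a) (letter w b)"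
  shows "prec W w b a"
  using rep_word_invariant[OF _ assms(1)] assms by (auto simp: prec_def Rep_def)

lemma prec_trans: "prec W w a b \<Longrightarrow> prec W w b c \<Longrightarrow> prec W w a c"
  by (force simp: prec_def)

text \<open>
  A letter is kept because a later letter blocks it, and that one is \<open>t\<close> or has itself been kept.
  Letters in a blocking pair never change their order, so the claim follows along the chain.
\<close>

lemma kept_prec:
  assumes "red w" "t \<in> positions w" "m \<le> length w"
    and "\<forall>j \<in> J. \<exists>b \<in> positions w. m < b \<and> letter w b = j \<and> (b = t \<or> prec W w t b)"
  shows "snd ` set (kept ind J (cword (take m w) id)) \<subseteq> {j. prec W w t j}"
  using assms(3,4)
proof (induction m arbitrary: J)
  case (Suc m)
  let ?s = "letter w (Suc m)"
  have cw: "cword (take (Suc m) w) id = (?s, Suc m) # cword (take m w) id"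
    using Suc.prems by (simp add: cword_take_Suc)
  show ?case
  proof (cases "\<forall>j \<in> J. ind ?s j")
    case True
    have "\<forall>j \<in> J. \<exists>b \<in> positions w. m < b \<and> letter w b = j \<and> (b = t \<or> prec W w t b)"
      using Suc.prems(2) Suc_lessD by blast
    then show ?thesis unfolding cw using Suc.IH[of J] Suc.prems(1) True by (simp add: id_def)
  next
    case False
    then obtain j where j: "j \<in> J" "\<not> ind ?s j" by blast
    obtain b where b: "b \<in> positions w" "Suc m < b" "letter w b = j" "b = t \<or> prec W w t b"
      using bspec[OF Suc.prems(2) j(1)] by blast
    have m: "Suc m \<in> positions w" using Suc.prems by (simp add: positions_def)
    have p: "prec W w t (Suc m)"
      using prec_dependent[OF assms(1) m b(1,2)] b(3,4) j(2) prec_trans[of w t b "Suc m"] by auto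
    have "\<forall>j \<in> insert ?s J. \<exists>b \<in> positions w. m < b \<and> letter w b = j \<and> (b = t \<or> prec W w t b)"
      using Suc.prems(2) Suc_lessD p m by blast
    then show ?thesis unfolding cw kept.simps fst_conv if_not_P[OF False]
      using Suc.IH[of "insert ?s J"] Suc.prems(1) p by (simp add: id_def)
  qed
qed simp

text \<open>
  \<open>L\<close> is the word of labelled letters that belongs to some element of \<open>Rep w\<close>. This predicate transports
  arguments about rearrangements to the permutations in the definition of the order on positions.
\<close>

definition represented :: "'a list \<Rightarrow> ('a \<times> nat) list \<Rightarrow> bool"
  where "represented w L \<longleftrightarrow> (\<exists>\<sigma>. rep_word W w \<sigma> (map fst L) \<and>
    (\<forall>j \<in> positions w. \<sigma> j \<in> positions w \<and> L ! (\<sigma> j - 1) = (letter w j, j)))"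

lemma represented_swap:
  assumes xy: "ind (fst x) (fst y)" and rep: "represented w (A @ x # y # B)"
    and len: "length (A @ x # y # B) = length w"
  shows "represented w (A @ y # x # B)"
proof -
  let ?L = "A @ x # y # B" and ?L' = "A @ y # x # B"
  obtain \<sigma> where s: "rep_word W w \<sigma> (map fst ?L)"
    "\<And>j. j \<in> positions w \<Longrightarrow> \<sigma> j \<in> positions w \<and> ?L ! (\<sigma> j - 1) = (letter w j, j)"
    using rep by (auto simp: represented_def)
  let ?i = "Suc (length A)"
  let ?\<tau> = "transpose ?i (?i + 1)"
  have "rep_word W w (?\<tau> \<circ> \<sigma>)
     ((map fst ?L)[?i - 1 := map fst ?L ! ?i, ?i := map fst ?L ! (?i - 1)])"
    by (rule rep_step[OF s(1)]) (use xy in \<open>auto simp: letter_def nth_append commuting_gens_def\<close>)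
  moreover have "(map fst ?L)[?i - 1 := map fst ?L ! ?i, ?i := map fst ?L ! (?i - 1)] = map fst ?L'"
    by (simp add: nth_append list_update_append)
  moreover have "?\<tau> k \<in> positions w \<and> ?L' ! (?\<tau> k - 1) = ?L ! (k - 1)" if "k \<in> positions w" for k
  proof -
    consider "k = ?i" | "k = ?i + 1" | "k < ?i" | "k > ?i + 1" by linarith
    then show ?thesis
    proof cases
      case 3
      then show ?thesis using that by (auto simp: transpose_def nth_append positions_def)
    next
      case 4
      then obtain d where "k = ?i + 2 + d" by (metis Suc_eq_plus1 add_2_eq_Suc' less_iff_Suc_add add_Suc_shift add_Suc)
      then show ?thesis using that by (auto simp: transpose_def nth_append positions_def)
    qed (use that len in \<open>auto simp: transpose_def nth_append positions_def\<close>)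
  qed
  ultimately show ?thesis using s(2) unfolding represented_def
    by (intro exI[of _ "?\<tau> \<circ> \<sigma>"]) auto
qed

lemma represented_trace_eq:
  assumes "trace_eq (indep_fst ind) u v"
  shows "length (p @ u) = length w \<Longrightarrow> represented w (p @ u) \<Longrightarrow> represented w (p @ v)"
  using assms
proof (induction arbitrary: p rule: trace_eq.induct)
  case (tr_swap x y u)
  then show ?case using represented_swap by auto
next
  case (tr_Cons u v x)
  then show ?case using tr_Cons.IH[of "p @ [x]"] by simp
next
  case (tr_trans u v z)
  then show ?case using trace_eq_length[OF tr_trans.hyps(1)] by simp
qed auto

lemma cword_rearrange:
  assumes "t \<in> positions w"
  shows "\<exists>B. trace_eq (indep_fst ind) (cword w id)
    (B @ (letter w t, t) # kept ind {letter w t} (cword (take (t - 1) w) id))"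
proof -
  let ?u = "cword (take (t - 1) w) id" and ?s = "letter w t"
  obtain p where p: "cword w id = p @ (?s, t) # ?u" using cword_split[OF assms, of id] by auto
  let ?d = "dropped ind {?s} ?u" and ?k = "kept ind {?s} ?u"
  have "trace_eq (indep_fst ind) ((?s, t) # ?u) ((?s, t) # ?d @ ?k)"
    by (intro tr_Cons trace_eq_dropped_kept symI)
  moreover have "trace_eq (indep_fst ind) ((?s, t) # ?d @ ?k) (?d @ (?s, t) # ?k)"
  proof (rule trace_eq_move)
    fix d assume "d \<in> set ?d"
    then show "ind (fst (?s, t)) (fst d)" using dropped_indep[of d ind "{?s}" ?u ?s] I_sym by auto
  qed
  ultimately have "trace_eq (indep_fst ind) ((?s, t) # ?u) (?d @ (?s, t) # ?k)" by (rule tr_trans)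
  from trace_eq_append_left[OF this, of p] show ?thesis by (intro exI[of _ "p @ ?d"]) (simp add: p)
qed

text \<open>
  For the inclusion from right to left, rearrange \<open>w\<close> so that exactly the kept letters precede \<open>t\<close>.
  The permutation doing this witnesses that no other position is above \<open>t\<close>.
\<close>

lemma kept_eq_prec:
  assumes "red w" "t \<in> positions w"
  shows "snd ` set (kept ind {letter w t} (cword (take (t - 1) w) id)) = {j. prec W w t j}"
proof
  let ?k = "kept ind {letter w t} (cword (take (t - 1) w) id)"
  have "\<exists>b \<in> positions w. t - 1 < b \<and> letter w b = letter w t \<and> (b = t \<or> prec W w t b)"
    using assms(2) by (intro bexI[of _ t]) (auto simp: positions_def)
  then show "snd ` set ?k \<subseteq> {j. prec W w t j}"
    using assms by (intro kept_prec) (auto simp: positions_def)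
  obtain B where B: "trace_eq (indep_fst ind) (cword w id) (B @ (letter w t, t) # ?k)"
    using cword_rearrange[OF assms(2)] by blast
  let ?L = "rev ?k @ (letter w t, t) # rev B"
  have sym: "symp (indep_fst ind :: 'a \<times> nat \<Rightarrow> 'a \<times> nat \<Rightarrow> bool)"
    by (rule sympI) (rule I_sym)
  have tr: "trace_eq (indep_fst ind) (rev (cword w id)) ?L"
    using trace_eq_rev[OF B sym] by simp
  have "distinct ?L" using trace_eq_distinct[OF tr] distinct_cword[of w] by simp
  have "represented w (rev (cword w id))"
    unfolding represented_def
  proof (intro exI conjI ballI)
    show "rep_word W w id (map fst (rev (cword w id)))"
      by (simp add: rev_map[symmetric] rep_id)
    fix j assume "j \<in> positions w"
    then show "id j \<in> positions w" "rev (cword w id) ! (id j - 1) = (letter w j, j)"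
      by (auto simp: cword_def positions_def nth_map simp del: upt_Suc)
  qed
  then have "represented w ?L"
    using represented_trace_eq[OF tr, of "[]" w] by simp
  then obtain \<sigma> where s: "rep_word W w \<sigma> (map fst ?L)"
    "\<And>j. j \<in> positions w \<Longrightarrow> \<sigma> j \<in> positions w \<and> ?L ! (\<sigma> j - 1) = (letter w j, j)"
    unfolding represented_def by blast
  have len: "length ?L = length w" using trace_eq_length[OF tr] by simp
  have "?L ! (\<sigma> t - 1) = ?L ! length ?k" "\<sigma> t - 1 < length ?L" "length ?k < length ?L"
    using s(2)[OF assms(2)] len by (auto simp: nth_append positions_def)
  then have t: "\<sigma> t - 1 = length ?k" using \<open>distinct ?L\<close> nth_eq_iff_index_eq by blast
  show "{j. prec W w t j} \<subseteq> snd ` set ?k"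
  proof clarify
    fix j assume j: "prec W w t j"
    then have jp: "j \<in> positions w" "\<sigma> j < \<sigma> t" using s(1) by (auto simp: prec_def Rep_def)
    then have "\<sigma> j - 1 < length ?k" using t s(2)[OF jp(1)] by (auto simp: positions_def)
    then have "(letter w j, j) \<in> set ?k"
      using s(2)[OF jp(1)] nth_mem[of "\<sigma> j - 1" "rev ?k"] by (simp add: nth_append)
    then show "j \<in> snd ` set ?k" by force
  qed
qed

end


section \<open>Coordinates\<close>

lemma count_list_take_less:
  assumes "p \<in> positions w" "letter w p = s" "p \<le> m"
  shows "count_list (take (p - 1) w) s < count_list (take m w) s"
proof -
  have p: "p - 1 < length (take m w)" "take m w ! (p - 1) = s" "take (p - 1) (take m w) = take (p - 1) w"
    using assms by (auto simp: positions_def letter_def min_def)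
  have "take m w = take (p - 1) w @ s # drop (Suc (p - 1)) (take m w)"
    using id_take_nth_drop[OF p(1)] p by simp
  then have "count_list (take m w) s = count_list (take (p - 1) w @ s # drop (Suc (p - 1)) (take m w)) s"
    by simp
  then show ?thesis by (simp add: count_list_append)
qed

context colored_building
begin

abbreviation (input) "chw w x \<equiv> chamber (cword w x)"
abbreviation (input) "crd w \<equiv> coords C \<delta> h c0 w"
abbreviation (input) "sph w \<equiv> sphere W C \<delta> c0 w"
abbreviation (input) "X w \<equiv> coord_space q w"

lemma proper_cword_iff:
  assumes "red w" "x \<in> extensional (positions w)"
  shows "proper (cword w x) \<longleftrightarrow> x \<in> X w"
  using assms red_rev
  by (auto simp: proper_def set_cword coord_space_def coord_range_def PiE_iff)

lemma proper_cword: "red w \<Longrightarrow> x \<in> X w \<Longrightarrow> proper (cword w x)"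
  using proper_cword_iff[of w x] by (auto simp: coord_space_def PiE_def)

lemma sphere_iff: "red w \<Longrightarrow> v \<in> sph w \<longleftrightarrow> v \<in> C \<and> \<delta> v c0 = wv (rev w)"
  using dist_inv[of v c0] dist_inv[of c0 v] c0 wv_closed[OF redD(1), of w] dist_closed[of c0 v]
  by (auto simp: sphere_def wv_rev[OF redD(1)])

lemma chw_in_sphere: "red w \<Longrightarrow> x \<in> X w \<Longrightarrow> chw w x \<in> sph w"
  using ch_proper[OF proper_cword, of w x] by (simp add: sphere_iff)

lemma sphere_word:
  assumes "red w" "v \<in> sph w"
  shows "\<exists>x \<in> X w. v = chw w x"
proof -
  obtain cs where cs: "proper cs" "map fst cs = rev w" "chamber cs = v"
    using ch_surj[OF red_rev[OF assms(1)], of v] assms by (auto simp: sphere_iff)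
  obtain x where "x \<in> extensional (positions w)" "cs = cword w x" using cword_surj[OF cs(2)] by blast
  then show ?thesis using cs proper_cword_iff[OF assms(1)] by blast
qed

lemma proper_cword_take: "proper (cword w x) \<Longrightarrow> i \<le> length w \<Longrightarrow> proper (cword (take i w) x)"
proof (induction "length w - i" arbitrary: i)
  case (Suc k)
  then have "proper (cword (take (Suc i) w) x)" "i < length w" by auto
  then show ?case using proper_ConsD(1) by (simp add: cword_take_Suc)
qed simp

lemma gallery_chw:
  assumes p: "proper (cword w x)"
  shows "gallery C \<delta> w (map (\<lambda>i. chamber (cword (take i w) x)) [0..<Suc (length w)])" (is "gallery C \<delta> w ?vs")
proof -
  have nth: "?vs ! i = chamber (cword (take i w) x)" if "i \<le> length w" for i
    using that by (simp del: upt_Suc)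
  have "\<delta> (?vs ! (i - 1)) (?vs ! i) = letter w i" if i: "i \<in> {1..length w}" for i
  proof -
    obtain k where k: "i = Suc k" "k < length w" using i by (cases i) auto
    let ?cs = "cword (take k w) x" and ?c = "(letter w i, x i)"
    have P: "proper (?c # ?cs)" using proper_cword_take[OF p, of i] k by (simp add: cword_take_Suc)
    have "\<delta> (chamber ?cs) (chamber (?c # ?cs)) = letter w i"
      using dist_gen_sym[OF _ _ ch_Cons(5)[OF P]] proper_ConsD[OF P] ch_in[OF P] by simp
    then show ?thesis using nth[of k] nth[of i] k by (simp add: cword_take_Suc)
  qed
  moreover have "?vs \<in> lists C" using proper_cword_take[OF p] by (auto simp del: upt_Suc)
  ultimately show ?thesis by (auto simp: gallery_def simp del: upt_Suc)
qed

text \<open>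
  The directed colorings turn any gallery of reduced type starting in \<open>c\<^sub>0\<close> into a colored word.
\<close>

lemma gallery_imp_chw:
  assumes w: "red w" and vs: "gallery C \<delta> w vs" "vs ! 0 = c0" and "i \<le> length w"
  defines "x \<equiv> \<lambda>i. h (letter w i) (vs ! i)"
  shows "proper (cword (take i w) x) \<and> vs ! i = chamber (cword (take i w) x)"
  using assms(4)
proof (induction i)
  case (Suc k)
  let ?s = "letter w (Suc k)" and ?cs = "cword (take k w) x"
  have IH: "proper ?cs" "vs ! k = chamber ?cs" using Suc by auto
  have "\<delta> (vs ! k) (vs ! Suc k) = ?s" "vs ! Suc k \<in> C"
    using vs(1) Suc.prems nth_mem[of "Suc k" vs] unfolding gallery_def by (force, auto)
  moreover have rd: "red (?s # map fst ?cs)"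
  proof -
    have "red (take (Suc k) w)" using red_appendD1[of "take (Suc k) w" "drop (Suc k) w"] w by simp
    then have "red (rev (take (Suc k) w))" by (rule red_rev)
    then show ?thesis using Suc.prems by (simp add: take_Suc_conv_app_nth letter_def)
  qed
  moreover have "?s \<noteq> \<one>" using red_ConsD[OF rd] gen_ne_one by blast
  ultimately have "vs ! Suc k \<in> panel C \<delta> ?s (chamber ?cs)" "vs ! Suc k \<noteq> chamber ?cs"
    using IH by (auto simp: panel_def)
  from ch_extend[OF IH(1) rd this] show ?case
    using Suc.prems by (simp add: cword_take_Suc x_def)
qed (use vs in simp)

lemma coords_chw:
  assumes w: "red w" and x: "x \<in> X w"
  shows "crd w (chw w x) = x"
proof -
  note p = proper_cword[OF assms]
  let ?vs = "map (\<lambda>i. chamber (cword (take i w) x)) [0..<Suc (length w)]"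
  have nth: "?vs ! i = chamber (cword (take i w) x)" if "i \<le> length w" for i
    using that by (simp del: upt_Suc)
  have "(THE vs. gallery C \<delta> w vs \<and> vs ! 0 = c0 \<and> vs ! length w = chw w x) = ?vs"
  proof (rule the_equality)
    show "gallery C \<delta> w ?vs \<and> ?vs ! 0 = c0 \<and> ?vs ! length w = chw w x"
      using gallery_chw[OF p] nth[of 0] nth[of "length w"] by (simp del: upt_Suc)
    fix vs assume vs: "gallery C \<delta> w vs \<and> vs ! 0 = c0 \<and> vs ! length w = chw w x"
    let ?y = "\<lambda>i. h (letter w i) (vs ! i)"
    have *: "proper (cword (take i w) ?y) \<and> vs ! i = chamber (cword (take i w) ?y)" if "i \<le> length w" for i
      using gallery_imp_chw[OF w, of vs i] vs that by blast
    have "cword w ?y = cword w x"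
      using *[of "length w"] p vs by (intro ch_inj) auto
    then have eq: "?y i = x i" if "i \<in> positions w" for i using cword_eqD that by metis
    have "cword (take i w) ?y = cword (take i w) x" if "i \<le> length w" for i
      using that eq by (intro cword_cong) (auto simp: positions_def)
    then show "vs = ?vs"
      using * vs nth by (intro nth_equalityI) (auto simp: gallery_def simp del: upt_Suc)
  qed
  then have crd: "crd w (chw w x) = (\<lambda>i \<in> positions w. h (letter w i) (?vs ! i))"
    by (simp only: coords_def Let_def)
  show ?thesis
  proof (rule extensionalityI)
    show "crd w (chw w x) \<in> extensional (positions w)" unfolding crd by simp
    show "x \<in> extensional (positions w)" using x by (auto simp: coord_space_def PiE_def)
    fix i assume i: "i \<in> positions w"
    then obtain k where k: "i = Suc k" "k < length w" by (cases i) (auto simp: positions_def)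
    have P: "proper ((letter w i, x i) # cword (take k w) x)"
      using proper_cword_take[OF p, of i] k by (simp add: cword_take_Suc)
    have "h (letter w i) (?vs ! i) = x i"
      using nth[of i] ch_Cons(3)[OF P] k by (simp add: cword_take_Suc del: upt_Suc)
    then show "crd w (chw w x) i = x i" using crd i by simp
  qed
qed

lemma coords_sphere:
  assumes "red w" "v \<in> sph w"
  shows "crd w v \<in> X w" "chw w (crd w v) = v"
  using sphere_word[OF assms] coords_chw[OF assms(1)] by auto

lemma coords_bij: "red w \<Longrightarrow> bij_betw (crd w) (sph w) (X w)"
  by (rule bij_betw_byWitness[where f' = "chw w"])
    (auto simp: coords_chw coords_sphere chw_in_sphere)

lemma coords_inv_into: "red w \<Longrightarrow> x \<in> X w \<Longrightarrow> inv_into (sph w) (crd w) x = chw w x"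
  using bij_betw_inv_into_left[OF coords_bij chw_in_sphere, of w x] by (simp add: coords_chw)

lemma sphere_aut: "red w \<Longrightarrow> g \<in> fixing_auts \<Longrightarrow> v \<in> sph w \<Longrightarrow> g v \<in> sph w"
  using fixing_autsD(1,2)[of g] fixing_autsD(3)[of g c0 v] c0 by (auto simp: sphere_def)

lemma aut_coords:
  assumes "red w" "g \<in> fixing_auts" "x \<in> X w"
  shows "crd w (g (chw w x)) \<in> X w" "chw w (crd w (g (chw w x))) = g (chw w x)"
    "image_word g (cword w x) = cword w (crd w (g (chw w x)))"
proof -
  have "g (chw w x) \<in> sph w" using assms sphere_aut chw_in_sphere by blast
  note c = coords_sphere[OF assms(1) this]
  show "crd w (g (chw w x)) \<in> X w" "chw w (crd w (g (chw w x))) = g (chw w x)" by (fact c)+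
  show "image_word g (cword w x) = cword w (crd w (g (chw w x)))"
    using image_word_unique[OF assms(2) proper_cword[OF assms(1,3)] proper_cword[OF assms(1) c(1)]] c(2)
    by simp
qed

text \<open>
  The letters in the past of the position \<open>t\<close>, labelled by their positions.
\<close>

abbreviation past :: "'a list \<Rightarrow> nat \<Rightarrow> ('a \<times> nat) list"
  where "past w t \<equiv> kept ind {letter w t} (cword (take (t - 1) w) id)"

text \<open>
  Rearrange \<open>w\<close> so that the past of \<open>t\<close> comes first, followed by \<open>t\<close>. The coordinate at \<open>t\<close> is then read
  off after an initial part of the gallery in which only the colors at \<open>t\<close> and above \<open>t\<close> occur, and
  automorphisms map initial parts to initial parts.
\<close>

lemma aut_coord:
  assumes w: "red w" and g: "g \<in> fixing_auts" and x: "x \<in> X w" and t: "t \<in> positions w"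
  shows "crd w (g (chw w x)) t = h (letter w t) (g (chamber ((letter w t, x t) # map (apsnd x) (past w t))))"
    "proper ((letter w t, x t) # map (apsnd x) (past w t))"
proof -
  let ?s = "letter w t" and ?y = "crd w (g (chw w x))"
  obtain B where B: "trace_eq (indep_fst ind) (cword w id) (B @ (?s, t) # past w t)"
    using cword_rearrange[OF t] by blast
  let ?L = "\<lambda>z. map (apsnd z) B @ (?s, z t) # map (apsnd z) (past w t)"
  have L: "trace_eq (indep_fst ind) (cword w z) (?L z)" for z :: "nat \<Rightarrow> nat"
  proof -
    have "trace_eq (indep_fst ind) (map (apsnd z) (cword w id)) (map (apsnd z) (B @ (?s, t) # past w t))"
      by (rule trace_eq_map[OF B]) simp
    then show ?thesis by (simp only: cword_map[of w z] map_append list.map apsnd_conv)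
  qed
  note y = aut_coords[OF w g x]
  have pL: "proper (?L x)" "chamber (?L x) = chw w x" "proper (?L ?y)" "chamber (?L ?y) = chw w ?y"
    using proper_trace_eq[OF L] ch_trace_eq[OF L] proper_cword[OF w] x y by auto
  show "proper ((?s, x t) # map (apsnd x) (past w t))" by (rule proper_appendD[OF pL(1)])
  have "?L ?y = image_word g (?L x)"
    by (rule image_word_unique[OF g pL(1,3)]) (use pL y in simp_all)
  moreover obtain us where us: "image_word g (?L x) = us @ image_word g ((?s, x t) # map (apsnd x) (past w t))"
    "map fst us = map fst (map (apsnd x) B)"
    using image_word_append by blast
  moreover have "length us = length B" using us(2) by (metis length_map)
  ultimately have "(?s, ?y t) # map (apsnd ?y) (past w t) = image_word g ((?s, x t) # map (apsnd x) (past w t))"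
    by (metis append_eq_append_conv length_map)
  then show "?y t = h ?s (g (chamber ((?s, x t) # map (apsnd x) (past w t))))" by simp
qed

lemma past_cong:
  assumes "red w" "t \<in> positions w" "\<And>j. prec W w t j \<Longrightarrow> x j = y j"
  shows "map (apsnd x) (past w t) = map (apsnd y) (past w t)"
proof (rule map_cong[OF refl])
  fix c assume "c \<in> set (past w t)"
  then have "snd c \<in> {j. prec W w t j}" using kept_eq_prec[OF assms(1,2)] by blast
  then show "apsnd x c = apsnd y c" using assms(3) by (cases c) auto
qed

lemma aut_coord_cong:
  assumes "red w" "g \<in> fixing_auts" "x \<in> X w" "y \<in> X w" "t \<in> positions w"
    and "x t = y t" "\<And>j. prec W w t j \<Longrightarrow> x j = y j"
  shows "crd w (g (chw w x)) t = crd w (g (chw w y)) t"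
proof -
  have "map (apsnd x) (past w t) = map (apsnd y) (past w t)"
    using assms(1,5,7) by (rule past_cong)
  then show ?thesis
    unfolding aut_coord(1)[OF assms(1,2,3,5)] aut_coord(1)[OF assms(1,2,4,5)] by (simp only: assms(6))
qed

lemma prec_positions: "prec W w i j \<Longrightarrow> i \<in> positions w \<and> j \<in> positions w"
  by (simp add: prec_def)

lemma aut_preserves:
  assumes "red w" "g \<in> fixing_auts" "p \<in> positions w"
    and f: "\<And>x. x \<in> X w \<Longrightarrow> f x = crd w (g (chw w x))"
  shows "preserves_rel (PiE (positions w) (coord_range q w)) (wr_sim (positions w) (prec W w) p) f"
    and "preserves_rel (PiE (positions w) (coord_range q w)) (wr_simeq (positions w) (prec W w) p) f"
proof -
  note simps = preserves_rel_def wr_sim_def wr_simeq_def coord_space_def[symmetric]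
  show "preserves_rel (PiE (positions w) (coord_range q w)) (wr_sim (positions w) (prec W w) p) f"
    unfolding simps
  proof (intro ballI impI)
    fix x y t assume *: "x \<in> X w" "y \<in> X w" "\<forall>t \<in> positions w. prec W w p t \<longrightarrow> x t = y t"
      "t \<in> positions w" "prec W w p t"
    have "x j = y j" if "prec W w t j" for j
    proof -
      have "prec W w p j" using *(5) that prec_trans[of w p t j] by auto
      then show ?thesis using *(3) prec_positions[of w p j] by blast
    qed
    then show "f x t = f y t" using aut_coord_cong[OF assms(1,2), of x y t] * f by simp
  qed
  show "preserves_rel (PiE (positions w) (coord_range q w)) (wr_simeq (positions w) (prec W w) p) f"
    unfolding simps
  proof (intro ballI impI)
    fix x y t assume *: "x \<in> X w" "y \<in> X w"
      "\<forall>t \<in> positions w. prec W w p t \<or> t = p \<longrightarrow> x t = y t"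
      "t \<in> positions w" "prec W w p t \<or> t = p"
    have "x j = y j" if "prec W w t j" for j
    proof -
      have "prec W w p j" using *(5) that prec_trans[of w p t j] by auto
      then show ?thesis using *(3) prec_positions[of w p j] by blast
    qed
    then show "f x t = f y t" using aut_coord_cong[OF assms(1,2), of x y t] * f by simp
  qed
qed

end


section \<open>Permutation groups\<close>

lemma BijGroup_simps:
  "carrier (BijGroup A) = Bij A"
  "\<one>\<^bsub>BijGroup A\<^esub> = (\<lambda>x \<in> A. x)"
  "g \<in> Bij A \<Longrightarrow> f \<in> Bij A \<Longrightarrow> g \<otimes>\<^bsub>BijGroup A\<^esub> f = compose A g f"
  by (simp_all add: BijGroup_def)

lemma BijD: "g \<in> Bij A \<Longrightarrow> g \<in> extensional A \<and> bij_betw g A A"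
  by (simp add: Bij_def)

lemma Bij_in: "g \<in> Bij A \<Longrightarrow> x \<in> A \<Longrightarrow> g x \<in> A"
  by (auto simp: Bij_def bij_betw_def)

lemma subgroup_BijGroupI:
  assumes "H \<subseteq> Bij A" "(\<lambda>x \<in> A. x) \<in> H"
    and "\<And>g. g \<in> H \<Longrightarrow> restrict (inv_into A g) A \<in> H"
    and "\<And>g f. g \<in> H \<Longrightarrow> f \<in> H \<Longrightarrow> compose A g f \<in> H"
  shows "subgroup H (BijGroup A)"
proof (rule group.subgroupI[OF group_BijGroup])
  fix g f assume g: "g \<in> H"
  then have gA: "g \<in> Bij A" using assms(1) by blast
  show "inv\<^bsub>BijGroup A\<^esub> g \<in> H" using assms(3)[OF g] inv_BijGroup[OF gA] by simp
  assume f: "f \<in> H"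
  then have "f \<in> Bij A" using assms(1) by blast
  then show "g \<otimes>\<^bsub>BijGroup A\<^esub> f \<in> H" using assms(4)[OF g f] gA by (simp add: BijGroup_simps)
qed (use assms in \<open>auto simp: BijGroup_simps\<close>)

lemma subgroup_BijGroupD:
  assumes "subgroup H (BijGroup A)"
  shows "H \<subseteq> Bij A" "(\<lambda>x \<in> A. x) \<in> H"
    and "g \<in> H \<Longrightarrow> restrict (inv_into A g) A \<in> H"
    and "g \<in> H \<Longrightarrow> f \<in> H \<Longrightarrow> compose A g f \<in> H"
proof -
  show H: "H \<subseteq> Bij A" using subgroup.subset[OF assms] by (simp add: BijGroup_simps)
  show "(\<lambda>x \<in> A. x) \<in> H" using subgroup.one_closed[OF assms] by (simp add: BijGroup_simps)
  show "restrict (inv_into A g) A \<in> H" if "g \<in> H"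
    using subgroup.m_inv_closed[OF assms that] inv_BijGroup[OF subsetD[OF H that]] by simp
  show "compose A g f \<in> H" if "g \<in> H" "f \<in> H"
    using subgroup.m_closed[OF assms that]
      BijGroup_simps(3)[OF subsetD[OF H that(1)] subsetD[OF H that(2)]] by simp
qed

lemma stabilizer_on_subgroup:
  assumes "subgroup H (BijGroup A)" "a \<in> A"
  shows "subgroup (stabilizer_on H a) (BijGroup A)"
proof -
  note H = subgroup_BijGroupD[OF assms(1)]
  have "inv_into A g a = a" if "g \<in> H" "g a = a" for g
    using that H(1) assms(2) by (metis BijD bij_betw_def inv_into_f_eq subsetD)
  then show ?thesis
    using H assms(2) by (intro subgroup_BijGroupI) (auto simp: stabilizer_on_def compose_def)
qed

lemma induced_on_subgroup:
  assumes "subgroup H (BijGroup A)" "B \<subseteq> A" and inv: "\<And>g. g \<in> H \<Longrightarrow> g ` B = B"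
  shows "subgroup (induced_on H B) (BijGroup B)"
proof -
  note H = subgroup_BijGroupD[OF assms(1)]
  have inj: "inj_on g A" if "g \<in> H" for g using H(1) that BijD by (metis bij_betw_def subsetD)
  have bij: "bij_betw g B B" if "g \<in> H" for g
    using inj[OF that] inv[OF that] assms(2) inj_on_subset by (auto simp: bij_betw_def)
  show ?thesis
  proof (rule subgroup_BijGroupI)
    show "induced_on H B \<subseteq> Bij B"
      using bij by (auto simp: induced_on_def Bij_def)
    have "restrict (\<lambda>x \<in> A. x) B = (\<lambda>x \<in> B. x)" using assms(2) by (auto simp: restrict_def fun_eq_iff)
    then show "(\<lambda>x \<in> B. x) \<in> induced_on H B"
      using H(2) unfolding induced_on_def by (metis image_eqI)
  next
    fix k assume "k \<in> induced_on H B"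
    then obtain g where g: "g \<in> H" "k = restrict g B" by (auto simp: induced_on_def)
    have "inv_into B k x = inv_into A g x" if x: "x \<in> B" for x
    proof (rule inv_into_f_eq)
      obtain y where y: "y \<in> B" "x = g y" using inv[OF g(1)] x by blast
      then have *: "inv_into A g x = y" using inj[OF g(1)] assms(2) by auto
      show "inv_into A g x \<in> B" "k (inv_into A g x) = x" using * y g by auto
      show "inj_on k B" using bij[OF g(1)] g by (simp add: bij_betw_def)
    qed
    then have "restrict (inv_into B k) B = restrict (restrict (inv_into A g) A) B"
      using assms(2) by (auto simp: restrict_def fun_eq_iff)
    then show "restrict (inv_into B k) B \<in> induced_on H B"
      using H(3)[OF g(1)] unfolding induced_on_def by blast
  next
    fix k l assume "k \<in> induced_on H B" "l \<in> induced_on H B"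
    then obtain g f where g: "g \<in> H" "k = restrict g B" "f \<in> H" "l = restrict f B"
      by (auto simp: induced_on_def)
    then have "compose B k l = restrict (compose A g f) B"
      using assms(2) inv[of f] by (auto simp: compose_def restrict_def fun_eq_iff)
    then show "compose B k l \<in> induced_on H B"
      using H(4) g unfolding induced_on_def by blast
  qed
qed

text \<open>
  The permutation group isomorphism induced by a bijection \<open>\<theta>\<close> between the underlying sets.
\<close>

definition conj_perm :: "('x \<Rightarrow> 'y) \<Rightarrow> 'x set \<Rightarrow> 'y set \<Rightarrow> ('x \<Rightarrow> 'x) \<Rightarrow> 'y \<Rightarrow> 'y"
  where "conj_perm \<theta> A B g = (\<lambda>y \<in> B. \<theta> (g (inv_into A \<theta> y)))"

lemma conj_perm_iso:
  assumes \<theta>: "bij_betw \<theta> A B"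
  shows "conj_perm \<theta> A B \<in> iso (BijGroup A) (BijGroup B)"
proof -
  let ?i = "inv_into A \<theta>"
  let ?back = "\<lambda>k. \<lambda>x \<in> A. ?i (k (\<theta> x))"
  have i: "?i y \<in> A" "\<theta> (?i y) = y" if "y \<in> B" for y
    using \<theta> that by (auto simp: bij_betw_def inv_into_into f_inv_into_f)
  have t: "\<theta> x \<in> B" "?i (\<theta> x) = x" if "x \<in> A" for x
    using \<theta> that by (auto simp: bij_betw_def)
  have B: "conj_perm \<theta> A B g \<in> Bij B" if "g \<in> Bij A" for g
  proof -
    have "bij_betw (\<theta> \<circ> (g \<circ> ?i)) B B"
      using bij_betw_trans[OF bij_betw_trans[OF bij_betw_inv_into[OF \<theta>]] \<theta>] BijD[OF that] by blast
    then have "bij_betw (conj_perm \<theta> A B g) B B"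
      by (rule bij_betw_cong[THEN iffD1, rotated]) (simp add: conj_perm_def)
    then show ?thesis by (simp add: Bij_def conj_perm_def)
  qed
  have A: "?back k \<in> Bij A" if "k \<in> Bij B" for k
  proof -
    have "bij_betw (?i \<circ> (k \<circ> \<theta>)) A A"
      using bij_betw_trans[OF bij_betw_trans[OF \<theta>] bij_betw_inv_into[OF \<theta>]] BijD[OF that] by blast
    then have "bij_betw (?back k) A A"
      by (rule bij_betw_cong[THEN iffD1, rotated]) simp
    then show ?thesis by (simp add: Bij_def)
  qed
  have "bij_betw (conj_perm \<theta> A B) (Bij A) (Bij B)"
  proof (rule bij_betw_byWitness[where f' = ?back])
    show "\<forall>g \<in> Bij A. ?back (conj_perm \<theta> A B g) = g"
    proof
      fix g assume g: "g \<in> Bij A"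
      show "?back (conj_perm \<theta> A B g) = g"
        by (rule extensionalityI[of _ A]) (use g t Bij_in[OF g] BijD[OF g] in \<open>auto simp: conj_perm_def\<close>)
    qed
    show "\<forall>k \<in> Bij B. conj_perm \<theta> A B (?back k) = k"
    proof
      fix k assume k: "k \<in> Bij B"
      show "conj_perm \<theta> A B (?back k) = k"
        by (rule extensionalityI[of _ B]) (use k i Bij_in[OF k] BijD[OF k] in \<open>auto simp: conj_perm_def\<close>)
    qed
  qed (use A B in auto)
  moreover have "conj_perm \<theta> A B \<in> hom (BijGroup A) (BijGroup B)"
  proof (rule homI)
    fix g f assume "g \<in> carrier (BijGroup A)" "f \<in> carrier (BijGroup A)"
    then have g: "g \<in> Bij A" "f \<in> Bij A" by (simp_all add: BijGroup_simps)
    have "conj_perm \<theta> A B (compose A g f) = compose B (conj_perm \<theta> A B g) (conj_perm \<theta> A B f)"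
      using i t Bij_in[OF g(2)] by (auto simp: conj_perm_def compose_def restrict_def fun_eq_iff)
    then show "conj_perm \<theta> A B (g \<otimes>\<^bsub>BijGroup A\<^esub> f) =
        conj_perm \<theta> A B g \<otimes>\<^bsub>BijGroup B\<^esub> conj_perm \<theta> A B f"
      using g B by (simp add: BijGroup_simps)
  qed (use B in \<open>auto simp: BijGroup_simps\<close>)
  ultimately show ?thesis by (simp add: iso_def BijGroup_simps)
qed

text \<open>
  Here \<open>K\<close> need not be known to be a subgroup beforehand: it is a preimage of one.
\<close>

lemma iso_subgroup_restrict:
  assumes \<Phi>: "\<Phi> \<in> iso (BijGroup A) (BijGroup B)" and "K \<subseteq> Bij A"
    and L: "subgroup L (BijGroup B)" and img: "\<Phi> ` K = L"
  shows "subgroup K (BijGroup A)" "\<Phi> \<in> iso (perm_group A K) (perm_group B L)"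
proof -
  have inj: "inj_on \<Phi> (Bij A)" using \<Phi> by (auto simp: iso_def bij_betw_def BijGroup_simps)
  have "inv_into (Bij A) \<Phi> \<in> iso (BijGroup B) (BijGroup A)"
    using group.iso_set_sym[OF group_BijGroup \<Phi>] by (simp add: BijGroup_simps)
  then have "group_hom (BijGroup B) (BijGroup A) (inv_into (Bij A) \<Phi>)"
    by (auto simp: group_hom_def group_hom_axioms_def iso_def group_BijGroup)
  from group_hom.subgroup_img_is_subgroup[OF this L] have "subgroup (inv_into (Bij A) \<Phi> ` L) (BijGroup A)" .
  moreover have "inv_into (Bij A) \<Phi> ` L = K"
    using inv_into_image_cancel[OF inj assms(2)] img by simp
  ultimately show "subgroup K (BijGroup A)" by simp
  have "bij_betw \<Phi> K L" using inj_on_subset[OF inj assms(2)] img by (simp add: bij_betw_def)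
  moreover have "\<Phi> (x \<otimes>\<^bsub>BijGroup A\<^esub> y) = \<Phi> x \<otimes>\<^bsub>BijGroup B\<^esub> \<Phi> y" if "x \<in> K" "y \<in> K" for x y
    using \<Phi> subsetD[OF assms(2) that(1)] subsetD[OF assms(2) that(2)]
    by (simp add: iso_def hom_def BijGroup_simps(1))
  ultimately show "\<Phi> \<in> iso (perm_group A K) (perm_group B L)"
    using img by (auto simp: iso_def hom_def)
qed

text \<open>
  The kernel is acted on by conjugation with the values of the section \<open>\<epsilon>\<close>, and
  \<open>(d, k) \<mapsto> d (\<epsilon> k)\<close> is the isomorphism; its inverse is \<open>g \<mapsto> (g (\<epsilon> (\<pi> g))\<^sup>-\<^sup>1, \<pi> g)\<close>.
\<close>

lemma split_extension:
  assumes G: "group G" and K: "group K" and \<pi>: "\<pi> \<in> hom G K" and \<epsilon>: "\<epsilon> \<in> hom K G"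
    and sec: "\<And>k. k \<in> carrier K \<Longrightarrow> \<pi> (\<epsilon> k) = k"
  defines "D \<equiv> kernel G K \<pi>"
  shows "\<exists>\<phi> \<in> hom K (AutoGroup (G\<lparr>carrier := D\<rparr>)).
    \<exists>\<Psi> \<in> iso (semidirect_product (G\<lparr>carrier := D\<rparr>) K \<phi>) G.
      \<forall>d \<in> D. \<Psi> (d, \<one>\<^bsub>K\<^esub>) = d \<and> (\<forall>k \<in> carrier K. \<pi> (\<Psi> (d, k)) = k)"
proof -
  interpret G: group G by fact
  interpret K: group K by fact
  interpret p: group_hom G K \<pi> using \<pi> by unfold_locales
  interpret e: group_hom K G \<epsilon> using \<epsilon> by unfold_locales
  have D: "D \<subseteq> carrier G" "subgroup D G" using p.subgroup_kernel by (auto simp: D_def kernel_def)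
  have DD: "d \<in> D \<longleftrightarrow> d \<in> carrier G \<and> \<pi> d = \<one>\<^bsub>K\<^esub>" for d by (auto simp: D_def kernel_def)
  let ?D = "G\<lparr>carrier := D\<rparr>"
  define c where "c = (\<lambda>k d. \<epsilon> k \<otimes>\<^bsub>G\<^esub> d \<otimes>\<^bsub>G\<^esub> inv\<^bsub>G\<^esub> \<epsilon> k)"
  define \<phi> where "\<phi> = (\<lambda>k. restrict (c k) D)"
  define \<Psi> where "\<Psi> = (\<lambda>(d, k). d \<otimes>\<^bsub>G\<^esub> \<epsilon> k)"
  have cD: "c k d \<in> D" if "k \<in> carrier K" "d \<in> D" for k d
    using that by (simp add: c_def DD sec)
  have c_mult: "c k (c l d) = c (k \<otimes>\<^bsub>K\<^esub> l) d" if "k \<in> carrier K" "l \<in> carrier K" "d \<in> D" for k l d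
    using that DD by (simp add: c_def G.m_assoc G.inv_mult_group)
  have c_one: "c \<one>\<^bsub>K\<^esub> d = d" if "d \<in> D" for d using that DD by (simp add: c_def)
  have bij: "bij_betw (c k) D D" if k: "k \<in> carrier K" for k
    by (rule bij_betw_byWitness[where f' = "c (inv\<^bsub>K\<^esub> k)"]) (use k cD c_mult c_one in auto)
  have \<phi>B: "\<phi> k \<in> Bij D" if "k \<in> carrier K" for k
    using bij[OF that] by (simp add: \<phi>_def Bij_def)
  have \<phi>hom: "\<phi> k \<in> hom ?D ?D" if k: "k \<in> carrier K" for k
  proof (rule homI)
    fix x y assume "x \<in> carrier ?D" "y \<in> carrier ?D"
    then have xy: "x \<in> D" "y \<in> D" "x \<otimes>\<^bsub>G\<^esub> y \<in> D" using subgroup.m_closed[OF D(2)] by auto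
    have "c k (x \<otimes>\<^bsub>G\<^esub> y) = c k x \<otimes>\<^bsub>G\<^esub> c k y"
    proof -
      have "inv\<^bsub>G\<^esub> \<epsilon> k \<otimes>\<^bsub>G\<^esub> (\<epsilon> k \<otimes>\<^bsub>G\<^esub> z) = z" if "z \<in> carrier G" for z
        using that k by (simp add: G.m_assoc[symmetric])
      then show ?thesis using k xy DD by (simp add: c_def G.m_assoc)
    qed
    then show "\<phi> k (x \<otimes>\<^bsub>?D\<^esub> y) = \<phi> k x \<otimes>\<^bsub>?D\<^esub> \<phi> k y" using xy by (simp add: \<phi>_def)
  qed (use cD k in \<open>auto simp: \<phi>_def\<close>)
  have 1: "\<phi> \<in> hom K (AutoGroup ?D)"
  proof (rule homI)
    fix k assume "k \<in> carrier K"
    then show "\<phi> k \<in> carrier (AutoGroup ?D)" using \<phi>B \<phi>hom by (simp add: AutoGroup_def auto_def)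
  next
    fix k l assume kl: "k \<in> carrier K" "l \<in> carrier K"
    have "\<phi> (k \<otimes>\<^bsub>K\<^esub> l) = compose D (\<phi> k) (\<phi> l)"
      using kl c_mult cD by (auto simp: \<phi>_def compose_def restrict_def fun_eq_iff)
    then show "\<phi> (k \<otimes>\<^bsub>K\<^esub> l) = \<phi> k \<otimes>\<^bsub>AutoGroup ?D\<^esub> \<phi> l"
      using kl \<phi>B by (simp add: AutoGroup_def BijGroup_simps)
  qed
  let ?S = "semidirect_product ?D K \<phi>"
  have S: "carrier ?S = D \<times> carrier K" by (simp add: semidirect_product_def)
  have \<pi>\<Psi>: "\<pi> (\<Psi> (d, k)) = k" if "d \<in> D" "k \<in> carrier K" for d k
    using that DD sec by (simp add: \<Psi>_def)
  have "\<Psi> \<in> hom ?S G"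
  proof (rule homI)
    fix x assume "x \<in> carrier ?S"
    then show "\<Psi> x \<in> carrier G" using D by (auto simp: S \<Psi>_def)
  next
    fix x y assume "x \<in> carrier ?S" "y \<in> carrier ?S"
    then obtain d k d' k' where xy: "x = (d, k)" "y = (d', k')" "d \<in> D" "d' \<in> D"
      "k \<in> carrier K" "k' \<in> carrier K" by (auto simp: S)
    have "inv\<^bsub>G\<^esub> \<epsilon> k \<otimes>\<^bsub>G\<^esub> (\<epsilon> k \<otimes>\<^bsub>G\<^esub> z) = z" if "z \<in> carrier G" for z
      using that xy by (simp add: G.m_assoc[symmetric])
    then have "(d \<otimes>\<^bsub>G\<^esub> c k d') \<otimes>\<^bsub>G\<^esub> \<epsilon> (k \<otimes>\<^bsub>K\<^esub> k') = (d \<otimes>\<^bsub>G\<^esub> \<epsilon> k) \<otimes>\<^bsub>G\<^esub> (d' \<otimes>\<^bsub>G\<^esub> \<epsilon> k')"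
      using xy DD by (simp add: c_def G.m_assoc)
    then show "\<Psi> (x \<otimes>\<^bsub>?S\<^esub> y) = \<Psi> x \<otimes>\<^bsub>G\<^esub> \<Psi> y"
      using xy by (simp add: semidirect_product_def \<Psi>_def \<phi>_def)
  qed
  moreover have "bij_betw \<Psi> (D \<times> carrier K) (carrier G)"
  proof (rule bij_betw_byWitness[where f' = "\<lambda>g. (g \<otimes>\<^bsub>G\<^esub> inv\<^bsub>G\<^esub> \<epsilon> (\<pi> g), \<pi> g)"])
    show "\<forall>a \<in> D \<times> carrier K. (\<Psi> a \<otimes>\<^bsub>G\<^esub> inv\<^bsub>G\<^esub> \<epsilon> (\<pi> (\<Psi> a)), \<pi> (\<Psi> a)) = a"
      using \<pi>\<Psi> D by (auto simp: \<Psi>_def G.m_assoc)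
    show "\<forall>g \<in> carrier G. \<Psi> (g \<otimes>\<^bsub>G\<^esub> inv\<^bsub>G\<^esub> \<epsilon> (\<pi> g), \<pi> g) = g"
      by (auto simp: \<Psi>_def G.m_assoc)
    show "\<Psi> ` (D \<times> carrier K) \<subseteq> carrier G" using D by (auto simp: \<Psi>_def)
    show "(\<lambda>g. (g \<otimes>\<^bsub>G\<^esub> inv\<^bsub>G\<^esub> \<epsilon> (\<pi> g), \<pi> g)) ` carrier G \<subseteq> D \<times> carrier K"
      using sec by (auto simp: DD)
  qed
  ultimately have 2: "\<Psi> \<in> iso ?S G" by (simp add: iso_def S)
  have "\<forall>d \<in> D. \<Psi> (d, \<one>\<^bsub>K\<^esub>) = d" using D by (auto simp: \<Psi>_def)
  then show ?thesis using 1 2 \<pi>\<Psi> by blast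
qed


section \<open>Generalized wreath products\<close>

lemma preserves_rel_cong:
  "(\<And>x. x \<in> A \<Longrightarrow> f x = g x) \<Longrightarrow> preserves_rel A r f \<longleftrightarrow> preserves_rel A r g"
  by (simp add: preserves_rel_def)

lemma preserves_rel_comp:
  "preserves_rel A r f \<Longrightarrow> preserves_rel A r g \<Longrightarrow> f ` A \<subseteq> A \<Longrightarrow> preserves_rel A r (\<lambda>x. g (f x))"
  unfolding preserves_rel_def by (meson image_subset_iff)

text \<open>
  The local permutation of a product \<open>g f\<close> at \<open>x\<close> is that of \<open>g\<close> at \<open>f x\<close> times that of \<open>f\<close> at \<open>x\<close>, which
  makes sense because \<open>f\<close> maps points agreeing above \<open>p\<close> to such points. Inverses are similar.
\<close>

lemma wreath_product_subgroup:
  assumes H: "\<And>p. p \<in> P \<Longrightarrow> subgroup (H p) (BijGroup (Xs p))"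
  shows "subgroup (wreath_product P prc Xs H) (BijGroup (PiE P Xs))"
proof -
  let ?X = "PiE P Xs" and ?W = "wreath_product P prc Xs H"
  let ?pres = "\<lambda>f. \<forall>p \<in> P. preserves_rel ?X (wr_sim P prc p) f \<and> preserves_rel ?X (wr_simeq P prc p) f"
  let ?loc = "\<lambda>g. \<forall>x \<in> ?X. \<forall>p \<in> P. \<exists>k \<in> H p. \<forall>y \<in> ?X. wr_sim P prc p y x \<longrightarrow> g y p = k (y p)"
  have W: "g \<in> ?W \<longleftrightarrow> g \<in> Bij ?X \<and> ?pres g \<and> ?pres (inv_into ?X g) \<and> ?loc g" for g
    by (auto simp: wreath_product_def BijGroup_simps)
  have pres_cong: "?pres f \<longleftrightarrow> ?pres g" if "\<And>x. x \<in> ?X \<Longrightarrow> f x = g x" for f g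
    by (simp only: preserves_rel_cong[of ?X f g, OF that])
  have pres_comp: "?pres (\<lambda>x. g (f x))" if "?pres f" "?pres g" "f ` ?X \<subseteq> ?X" for f g
    using that preserves_rel_comp[of ?X _ f g] by simp
  have simD: "wr_sim P prc p (f y) (f x)"
    if "?pres f" "p \<in> P" "x \<in> ?X" "y \<in> ?X" "wr_sim P prc p y x" for f p x y
    using that unfolding preserves_rel_def by blast
  have inv: "inv_into ?X g x \<in> ?X" "g (inv_into ?X g x) = x" "inv_into ?X g (g x) = x"
    if "g \<in> Bij ?X" "x \<in> ?X" for g x
    using BijD[OF that(1)] that(2) by (auto simp: bij_betw_def inv_into_into f_inv_into_f)
  show ?thesis
  proof (rule subgroup_BijGroupI)
    show "?W \<subseteq> Bij ?X" using W by blast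
    have id: "(\<lambda>x \<in> ?X. x) \<in> Bij ?X" by (rule id_Bij)
    have pid: "?pres (\<lambda>x. x)" by (simp add: preserves_rel_def)
    have "inv_into ?X (\<lambda>x \<in> ?X. x) x = x" if "x \<in> ?X" for x
      using inv(3)[OF id that] that by simp
    then have "?pres (\<lambda>x \<in> ?X. x)" "?pres (inv_into ?X (\<lambda>x \<in> ?X. x))"
      using pid by (subst pres_cong[of _ "\<lambda>x. x"]; simp)+
    moreover have "?loc (\<lambda>x \<in> ?X. x)"
    proof (intro ballI)
      fix x p assume "x \<in> ?X" "p \<in> P"
      then show "\<exists>k \<in> H p. \<forall>y \<in> ?X. wr_sim P prc p y x \<longrightarrow> (\<lambda>x \<in> ?X. x) y p = k (y p)"
        using subgroup_BijGroupD(2)[OF H] by (intro bexI[of _ "\<lambda>z \<in> Xs p. z"]) (auto simp: PiE_iff)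
    qed
    ultimately show "(\<lambda>x \<in> ?X. x) \<in> ?W" using W id by blast
  next
    fix g assume "g \<in> ?W"
    then have g: "g \<in> Bij ?X" "?pres g" "?pres (inv_into ?X g)" "?loc g" using W by blast+
    let ?i = "restrict (inv_into ?X g) ?X"
    have iB: "?i \<in> Bij ?X" by (rule restrict_inv_into_Bij[OF g(1)])
    have ii: "inv_into ?X ?i x = g x" if "x \<in> ?X" for x
      using inv(3)[OF iB, of "g x"] inv[OF g(1)] Bij_in[OF g(1)] that by simp
    have "?pres ?i" using g(3) by (subst pres_cong[of _ "inv_into ?X g"]) simp_all
    moreover have "?pres (inv_into ?X ?i)" using g(2) ii by (subst pres_cong[of _ g]) simp_all
    moreover have "?loc ?i"
    proof (intro ballI)
      fix x p assume x: "x \<in> ?X" and p: "p \<in> P"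
      note Hp = subgroup_BijGroupD[OF H[OF p]]
      obtain k where k: "k \<in> H p"
        "\<And>y. y \<in> ?X \<Longrightarrow> wr_sim P prc p y (inv_into ?X g x) \<Longrightarrow> g y p = k (y p)"
        using g(4) inv(1)[OF g(1) x] p by blast
      have kB: "bij_betw k (Xs p) (Xs p)" using BijD Hp(1) k(1) by blast
      have "?i z p = restrict (inv_into (Xs p) k) (Xs p) (z p)"
        if z: "z \<in> ?X" "wr_sim P prc p z x" for z
      proof -
        have "wr_sim P prc p (inv_into ?X g z) (inv_into ?X g x)"
          using simD[OF g(3) p x z(1) z(2)] .
        then have "z p = k (inv_into ?X g z p)"
          using k(2)[OF inv(1)[OF g(1) z(1)]] inv(2)[OF g(1) z(1)] by simp
        moreover have "inv_into ?X g z p \<in> Xs p" using inv(1)[OF g(1) z(1)] p by auto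
        ultimately show ?thesis using z p kB by (auto simp: bij_betw_def)
      qed
      then show "\<exists>k \<in> H p. \<forall>y \<in> ?X. wr_sim P prc p y x \<longrightarrow> ?i y p = k (y p)"
        using Hp(3)[OF k(1)] by blast
    qed
    ultimately show "?i \<in> ?W" using W iB by blast
  next
    fix g f assume "g \<in> ?W" "f \<in> ?W"
    then have g: "g \<in> Bij ?X" "?pres g" "?pres (inv_into ?X g)" "?loc g"
      and f: "f \<in> Bij ?X" "?pres f" "?pres (inv_into ?X f)" "?loc f" using W by blast+
    let ?c = "compose ?X g f"
    have cB: "?c \<in> Bij ?X" by (rule compose_Bij[OF g(1) f(1)])
    have "?pres (\<lambda>x. g (f x))" using pres_comp[OF f(2) g(2)] Bij_in[OF f(1)] by blast
    then have 1: "?pres ?c" by (subst pres_cong[of _ "\<lambda>x. g (f x)"]) (simp_all add: compose_def)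
    have ic: "inv_into ?X ?c x = inv_into ?X f (inv_into ?X g x)" if "x \<in> ?X" for x
      using inv(3)[OF cB, of "inv_into ?X f (inv_into ?X g x)"] inv(1,2)[OF f(1)] inv(1,2)[OF g(1)] that
      by (simp add: compose_def)
    have "?pres (\<lambda>x. inv_into ?X f (inv_into ?X g x))"
      using pres_comp[OF g(3) f(3)] inv(1)[OF g(1)] by blast
    then have 2: "?pres (inv_into ?X ?c)"
      using ic by (subst pres_cong[of _ "\<lambda>x. inv_into ?X f (inv_into ?X g x)"]) simp_all
    have "?loc ?c"
    proof (intro ballI)
      fix x p assume x: "x \<in> ?X" and p: "p \<in> P"
      note Hp = subgroup_BijGroupD[OF H[OF p]]
      obtain k where k: "k \<in> H p" "\<And>y. y \<in> ?X \<Longrightarrow> wr_sim P prc p y x \<Longrightarrow> f y p = k (y p)"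
        using f(4) x p by blast
      obtain l where l: "l \<in> H p" "\<And>y. y \<in> ?X \<Longrightarrow> wr_sim P prc p y (f x) \<Longrightarrow> g y p = l (y p)"
        using g(4) Bij_in[OF f(1) x] p by blast
      have "?c y p = compose (Xs p) l k (y p)" if y: "y \<in> ?X" "wr_sim P prc p y x" for y
      proof -
        have "wr_sim P prc p (f y) (f x)" by (rule simD[OF f(2) p x y])
        then have "g (f y) p = l (k (y p))" using l(2)[OF Bij_in[OF f(1) y(1)]] k(2)[OF y] by simp
        then show ?thesis using y p by (auto simp: compose_def)
      qed
      then show "\<exists>k \<in> H p. \<forall>y \<in> ?X. wr_sim P prc p y x \<longrightarrow> ?c y p = k (y p)"
        using Hp(4)[OF l(1) k(1)] by blast
    qed
    then show "?c \<in> ?W" using W cB 1 2 by blast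
  qed
qed


section \<open>The action on spheres\<close>

locale universal_building = colored_building W S C \<delta> c0 q h
  for W (structure) and S C \<delta> c0 q h +
  fixes F
  assumes F: "s \<in> S \<Longrightarrow> subgroup (F s) (BijGroup (colors q s))"
begin

abbreviation "U0 \<equiv> stabilizer_on (universal_group S C \<delta> q h F) c0"
abbreviation (input) "SG w \<equiv> sphere_group W S C \<delta> q h F c0 w"
abbreviation (input) "WW w \<equiv> word_wreath W q F w"

lemma U0_fixing: "g \<in> U0 \<Longrightarrow> g \<in> fixing_auts"
  by (simp add: stabilizer_on_def universal_group_def)

lemma letter_in: "red w \<Longrightarrow> p \<in> positions w \<Longrightarrow> letter w p \<in> S"
  using redD(1)[of w] nth_mem[of "p - 1" w] by (auto simp: letter_def positions_def)

lemma local_group_subgroup: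
  assumes "red w" "p \<in> positions w"
  shows "subgroup (local_group q F w p) (BijGroup (coord_range q w p))"
proof -
  let ?s = "letter w p"
  have s: "?s \<in> S" by (rule letter_in[OF assms])
  have one: "1 \<in> colors q ?s" using thick[OF s] by (simp add: colors_def)
  have "g ` {2..q ?s} = {2..q ?s}" if "g \<in> stabilizer_on (F ?s) 1" for g
  proof -
    have g: "bij_betw g (colors q ?s) (colors q ?s)" "g 1 = 1"
      using that subgroup_BijGroupD(1)[OF F[OF s]] BijD by (auto simp: stabilizer_on_def)
    have "{2..q ?s} = colors q ?s - {1}" by (auto simp: colors_def)
    moreover have "g ` (colors q ?s - {1}) = g ` colors q ?s - g ` {1}"
      using g(1) one by (intro inj_on_image_set_diff[of g "colors q ?s"]) (auto simp: bij_betw_def)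
    ultimately show ?thesis using g by (simp add: bij_betw_def)
  qed
  then show ?thesis
    unfolding local_group_def coord_range_def
    by (intro induced_on_subgroup[OF stabilizer_on_subgroup[OF F[OF s] one]]) (auto simp: colors_def)
qed

lemma wreath_subgroup: "red w \<Longrightarrow> subgroup (WW w) (BijGroup (X w))"
  unfolding word_wreath_def coord_space_def by (intro wreath_product_subgroup local_group_subgroup)

abbreviation aut_perm :: "'a list \<Rightarrow> ('c \<Rightarrow> 'c) \<Rightarrow> (nat \<Rightarrow> nat) \<Rightarrow> nat \<Rightarrow> nat"
  where "aut_perm w g \<equiv> \<lambda>x \<in> X w. crd w (g (chw w x))"

lemma aut_perm_inv:
  assumes "red w" "g \<in> fixing_auts" "x \<in> X w"
  shows "aut_perm w (restrict (inv_into C g) C) (aut_perm w g x) = x"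
    and "aut_perm w g (aut_perm w (restrict (inv_into C g) C) x) = x"
proof -
  let ?i = "restrict (inv_into C g) C"
  note g = fixing_autsD(5)[OF assms(2)]
  have v: "chw w x \<in> C" using proper_cword[OF assms(1,3)] by simp
  have gv: "g (chw w x) \<in> C" using fixing_autsD(2)[OF assms(2) v] .
  have "inv_into C g (g (chw w x)) = chw w x" by (rule bij_betw_inv_into_left[OF g v])
  then show "aut_perm w ?i (aut_perm w g x) = x"
    using aut_coords[OF assms] assms coords_chw gv by simp
  have "g (inv_into C g (chw w x)) = chw w x" by (rule bij_betw_inv_into_right[OF g v])
  then show "aut_perm w g (aut_perm w ?i x) = x"
    using aut_coords[OF assms(1) fixing_auts_inv[OF assms(2)] assms(3)] assms coords_chw v by simp
qed

lemma aut_perm_in: "red w \<Longrightarrow> g \<in> fixing_auts \<Longrightarrow> x \<in> X w \<Longrightarrow> aut_perm w g x \<in> X w"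
  using aut_coords(1) by simp

lemma aut_perm_Bij:
  assumes "red w" "g \<in> fixing_auts"
  shows "aut_perm w g \<in> Bij (X w)"
    and "x \<in> X w \<Longrightarrow> inv_into (X w) (aut_perm w g) x = aut_perm w (restrict (inv_into C g) C) x"
proof -
  let ?i = "restrict (inv_into C g) C"
  note inv = aut_perm_inv[OF assms] and i = fixing_auts_inv[OF assms(2)]
  have bij: "bij_betw (aut_perm w g) (X w) (X w)"
  proof (rule bij_betw_byWitness[where f' = "aut_perm w ?i"])
    show "aut_perm w g ` X w \<subseteq> X w" using aut_perm_in[OF assms] by blast
    show "aut_perm w ?i ` X w \<subseteq> X w" using aut_perm_in[OF assms(1) i] by blast
  qed (use inv in blast)+
  then show "aut_perm w g \<in> Bij (X w)" by (simp add: Bij_def)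
  show "inv_into (X w) (aut_perm w g) x = aut_perm w ?i x" if "x \<in> X w"
    using bij inv(2)[OF that] aut_perm_in[OF assms(1) i that]
    by (intro inv_into_f_eq) (auto simp: bij_betw_def simp del: restrict_apply)
qed

text \<open>
  The chamber of a panel nearest to \<open>c\<^sub>0\<close> has color 1, and so has its image, because \<open>g\<close> fixes \<open>c\<^sub>0\<close>.
\<close>

lemma local_stab:
  assumes "g \<in> U0" "proper cs" "red (s # map fst cs)"
  shows "local_action C \<delta> q h g s (chamber cs) \<in> stabilizer_on (F s) 1"
proof -
  have s: "s \<in> S" using red_ConsD[OF assms(3)] by blast
  note g = U0_fixing[OF assms(1)]
  have asc: "h s (chamber ds) = 1" if "proper ds" "red (s # map fst ds)" for ds
    using h_ascends[OF s, of "chamber ds"] ch_proper[OF that(1)] ascends_word[OF that(2), of "chamber ds"] by blast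
  have C: "chamber cs \<in> C" using assms(2) by simp
  have "inv_into (panel C \<delta> s (chamber cs)) (h s) 1 = chamber cs"
    using bij_betw_inv_into_left[OF h_bij[OF s C] panel_self[OF C]] asc[OF assms(2,3)] by simp
  moreover have "h s (g (chamber cs)) = 1"
    using asc[of "image_word g cs"] image_word[OF g assms(2)] assms(3) by simp
  moreover have "1 \<in> colors q s" using thick[OF s] by (simp add: colors_def)
  moreover have "local_action C \<delta> q h g s (chamber cs) \<in> F s"
    using assms(1) s C by (simp add: stabilizer_on_def universal_group_def)
  ultimately show ?thesis by (simp add: stabilizer_on_def local_action_def)
qed

lemma aut_perm_in_wreath:
  assumes "red w" "g \<in> U0"
  shows "aut_perm w g \<in> WW w"
proof -
  note g = U0_fixing[OF assms(2)]
  note i = fixing_auts_inv[OF g]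
  note fold = coord_space_def[symmetric]
  have B: "aut_perm w g \<in> carrier (BijGroup (X w))"
    using aut_perm_Bij(1)[OF assms(1) g] by (simp add: BijGroup_simps)
  have P: "\<forall>p \<in> positions w. \<forall>f \<in> {aut_perm w g, inv_into (X w) (aut_perm w g)}.
      preserves_rel (X w) (wr_sim (positions w) (prec W w) p) f \<and>
      preserves_rel (X w) (wr_simeq (positions w) (prec W w) p) f"
  proof (intro ballI)
    fix p f assume p: "p \<in> positions w" and f: "f \<in> {aut_perm w g, inv_into (X w) (aut_perm w g)}"
    obtain k where k: "k \<in> fixing_auts" "\<And>x. x \<in> X w \<Longrightarrow> f x = crd w (k (chw w x))"
    proof (cases "f = aut_perm w g")
      case True
      show ?thesis by (rule that[OF g]) (simp add: True)
    next
      case False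
      then have "f = inv_into (X w) (aut_perm w g)" using f by blast
      then show ?thesis using aut_perm_Bij(2)[OF assms(1) g] by (intro that[OF i]) simp
    qed
    show "preserves_rel (X w) (wr_sim (positions w) (prec W w) p) f \<and>
      preserves_rel (X w) (wr_simeq (positions w) (prec W w) p) f"
      using aut_preserves[OF assms(1) k(1) p k(2)] unfolding fold by blast
  qed
  have L: "\<forall>x \<in> X w. \<forall>p \<in> positions w. \<exists>k \<in> local_group q F w p. \<forall>y \<in> X w.
      wr_sim (positions w) (prec W w) p y x \<longrightarrow> aut_perm w g y p = k (y p)"
  proof (intro ballI)
    fix x p assume x: "x \<in> X w" and p: "p \<in> positions w"
    let ?s = "letter w p" and ?cs = "map (apsnd x) (past w p)"
    have px: "proper ((?s, x p) # ?cs)" by (rule aut_coord(2)[OF assms(1) g x p])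
    have st: "local_action C \<delta> q h g ?s (chamber ?cs) \<in> stabilizer_on (F ?s) 1"
      using local_stab[OF assms(2) proper_ConsD(1)[OF px]] px by (simp add: proper_def)
    let ?k = "restrict (local_action C \<delta> q h g ?s (chamber ?cs)) (coord_range q w p)"
    have "aut_perm w g y p = ?k (y p)" if y: "y \<in> X w" "wr_sim (positions w) (prec W w) p y x" for y
    proof -
      have yp: "y p \<in> coord_range q w p" using y(1) p by (auto simp: coord_space_def)
      then have yc: "y p \<in> colors q ?s" by (auto simp: coord_range_def colors_def)
      have cs: "map (apsnd y) (past w p) = ?cs"
        using y(2) prec_positions by (intro past_cong[OF assms(1) p]) (auto simp: wr_sim_def)
      have "aut_perm w g y p = h ?s (g (chamber ((?s, y p) # ?cs)))"
        using aut_coord(1)[OF assms(1) g y(1) p] y(1) unfolding cs by simp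
      then show ?thesis using yp yc by (simp add: local_action_def step_def)
    qed
    moreover have "?k \<in> local_group q F w p"
      using st unfolding local_group_def induced_on_def by blast
    ultimately show "\<exists>k \<in> local_group q F w p. \<forall>y \<in> X w.
      wr_sim (positions w) (prec W w) p y x \<longrightarrow> aut_perm w g y p = k (y p)" by blast
  qed
  show ?thesis
    unfolding word_wreath_def wreath_product_def fold using B P L by blast
qed

text \<open>
  The second claim records that the extension does as little as possible: it fixes the color of any
  letter \<open>s\<close> that is preceded by at least as many letters \<open>s\<close> as there are in \<open>w\<close>. In particular it fixes
  the color of a letter appended to \<open>w\<close>.
\<close>

lemma wreath_extension:
  assumes w: "red w" and \<gamma>: "\<gamma> \<in> WW w"
  shows "\<exists>g \<in> U0. (\<forall>x \<in> X w. g (chw w x) = chw w (\<gamma> x)) \<and>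
    (\<forall>s a cs. proper ((s, a) # cs) \<longrightarrow> count_list w s \<le> count_list (map fst cs) s \<longrightarrow>
       h s (g (chamber ((s, a) # cs))) = a)"
proof -
  note fold = coord_space_def[symmetric]
  have loc: "\<exists>k \<in> local_group q F w p. \<forall>y \<in> X w. wr_sim (positions w) (prec W w) p y x \<longrightarrow> \<gamma> y p = k (y p)"
    if "x \<in> X w" "p \<in> positions w" for x p
    using \<gamma> that unfolding word_wreath_def wreath_product_def fold by blast
  have \<gamma>X: "\<gamma> x \<in> X w" if "x \<in> X w" for x
    by (rule Bij_in[OF subsetD[OF subgroup_BijGroupD(1)[OF wreath_subgroup[OF w]] \<gamma>] that])
  \<comment> \<open>The keys at which the local permutations are prescribed by \<open>\<gamma>\<close>.\<close>
  define occurs_at where "occurs_at = (\<lambda>s \<kappa> p x. p \<in> positions w \<and> letter w p = s \<and> x \<in> X w \<and>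
     \<kappa> = key ind s (cword (take (p - 1) w) x))"
  have len: "length (\<kappa> s) = count_list (take (p - 1) w) s" if "occurs_at s \<kappa> p x" for s \<kappa> p x
    using that length_key[of ind s "cword (take (p - 1) w) x"] I_irrefl by (simp add: occurs_at_def)
  \<comment> \<open>The length of the key counts the preceding letters \<open>s\<close>, so a key belongs to one position only.\<close>
  have pos_unique: "p = p'" if "occurs_at s \<kappa> p x" "occurs_at s \<kappa> p' x'" for s \<kappa> p p' x x'
  proof -
    have "\<not> p < p'" if "occurs_at s \<kappa> p x" "occurs_at s \<kappa> p' x'" for p p' x x'
    proof
      assume "p < p'"
      then have "count_list (take (p - 1) w) s < count_list (take (p' - 1) w) s"
        using that by (intro count_list_take_less) (auto simp: occurs_at_def)
      then show False using len[OF that(1)] len[OF that(2)] by simp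
    qed
    then show ?thesis using that by (meson linorder_neqE_nat)
  qed
  \<comment> \<open>At a given position the key determines all the coordinates above it, so by the definition of
    the wreath product it determines the local permutation of \<open>\<gamma>\<close>.\<close>
  have sim: "wr_sim (positions w) (prec W w) p x y"
    if m: "occurs_at s \<kappa> p x" "occurs_at s \<kappa> p y" for s \<kappa> p x y
    unfolding wr_sim_def
  proof (intro ballI impI)
    fix j assume "prec W w p j"
    then have "j \<in> snd ` set (past w p)" using kept_eq_prec[OF w, of p] m by (auto simp: occurs_at_def)
    then obtain c where c: "c \<in> set (past w p)" "j = snd c" by blast
    have "key ind s (map (apsnd x) (cword (take (p - 1) w) id)) = key ind s (map (apsnd y) (cword (take (p - 1) w) id))"
      using m unfolding occurs_at_def by (metis cword_map)
    from key_map_eqD[OF this, of c] show "x j = y j" using c m by (simp add: occurs_at_def)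
  qed
  let ?Q = "\<lambda>s \<kappa> f. f \<in> stabilizer_on (F s) 1 \<and> (\<forall>p x. occurs_at s \<kappa> p x \<longrightarrow> \<gamma> x p = f (x p)) \<and>
    ((\<nexists>p x. occurs_at s \<kappa> p x) \<longrightarrow> (\<forall>a \<in> colors q s. f a = a))"
  have ex: "\<exists>f. ?Q s \<kappa> f" if s: "s \<in> S" for s \<kappa>
  proof (cases "\<exists>p x. occurs_at s \<kappa> p x")
    case False
    have "(\<lambda>a \<in> colors q s. a) \<in> stabilizer_on (F s) 1"
      using subgroup_BijGroupD(2)[OF F[OF s]] thick[OF s] by (simp add: stabilizer_on_def colors_def)
    then show ?thesis using False by (intro exI[of _ "\<lambda>a \<in> colors q s. a"]) simp
  next
    case True
    then obtain p x where px: "occurs_at s \<kappa> p x" by blast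
    then obtain k where k: "k \<in> local_group q F w p"
      "\<And>y. y \<in> X w \<Longrightarrow> wr_sim (positions w) (prec W w) p y x \<Longrightarrow> \<gamma> y p = k (y p)"
      using loc[of x p] by (auto simp: occurs_at_def)
    then obtain f where f: "f \<in> stabilizer_on (F s) 1" "k = restrict f (coord_range q w p)"
      using px by (auto simp: local_group_def induced_on_def occurs_at_def)
    have "\<gamma> y p' = f (y p')" if m: "occurs_at s \<kappa> p' y" for p' y
    proof -
      have [simp]: "p' = p" by (rule pos_unique[OF m px])
      have "\<gamma> y p = k (y p)" using k(2) sim[of s \<kappa> p y x] m px by (simp add: occurs_at_def)
      moreover have "y p \<in> coord_range q w p" using m by (auto simp: occurs_at_def coord_space_def)
      ultimately show ?thesis using f(2) by simp
    qed
    then show ?thesis using f(1) True by blast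
  qed
  define \<tau> where "\<tau> = (\<lambda>s \<kappa>. SOME f. ?Q s \<kappa> f)"
  have Q: "?Q s \<kappa> (\<tau> s \<kappa>)" if "s \<in> S" for s \<kappa>
    unfolding \<tau>_def by (rule someI_ex[OF ex[OF that]])
  have "\<tau> s \<kappa> \<in> stabilizer_on (F s) 1" if "s \<in> S" for s \<kappa> using Q[OF that] by blast
  moreover have "F s \<subseteq> carrier (BijGroup (colors q s))" if "s \<in> S" for s
    using subgroup.subset[OF F[OF that]] .
  ultimately obtain g where g: "g \<in> U0"
    "\<And>cs. proper cs \<Longrightarrow> g (chamber cs) = chamber (recolor ind \<tau> cs) \<and> proper (recolor ind \<tau> cs)"
    using recolor_extension[of F \<tau>] by blast
  have rec: "recolor ind \<tau> (cword (take k w) x) = cword (take k w) (\<gamma> x)"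
    if "x \<in> X w" "k \<le> length w" for k x
    using that(2)
  proof (induction k)
    case (Suc k)
    let ?s = "letter w (Suc k)"
    have p: "Suc k \<in> positions w" using Suc.prems by (simp add: positions_def)
    have "occurs_at ?s (key ind ?s (cword (take k w) x)) (Suc k) x"
      using p that(1) by (simp add: occurs_at_def)
    then show ?case using Suc Q[OF letter_in[OF w p]] by (simp add: cword_take_Suc)
  qed simp
  have "g (chw w x) = chw w (\<gamma> x)" if "x \<in> X w" for x
    using g(2)[OF proper_cword[OF w that]] rec[OF that, of "length w"] by simp
  moreover have "h s (g (chamber ((s, a) # cs))) = a"
    if p: "proper ((s, a) # cs)" and c: "count_list w s \<le> count_list (map fst cs) s" for s a cs
  proof -
    let ?\<kappa> = "key ind s cs"
    note P = proper_ConsD[OF p]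
    have "\<nexists>p x. occurs_at s ?\<kappa> p x"
    proof clarify
      fix p x assume m: "occurs_at s ?\<kappa> p x"
      have "count_list (take (p - 1) w) s < count_list (take (length w) w) s"
        using m by (intro count_list_take_less) (auto simp: occurs_at_def positions_def)
      then show False using len[OF m] length_key[of ind s cs] I_irrefl c by simp
    qed
    then have "\<tau> s ?\<kappa> a = a" using Q[OF P(2), of ?\<kappa>] P(4) by (simp add: colors_def)
    then show ?thesis
      using g(2)[OF p] ch_Cons(3)[of s a "recolor ind \<tau> cs"] by simp
  qed
  ultimately show ?thesis using g(1) by blast
qed


lemma sphere_in: "v \<in> sph w \<Longrightarrow> v \<in> C" by (simp add: sphere_def)

lemma restrict_fixing_Bij:
  assumes "red w" "g \<in> fixing_auts"
  shows "restrict g (sph w) \<in> Bij (sph w)"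
proof -
  let ?i = "restrict (inv_into C g) C"
  note g = fixing_autsD(5)[OF assms(2)] and i = fixing_auts_inv[OF assms(2)]
  have "bij_betw g (sph w) (sph w)"
  proof (rule bij_betw_byWitness[where f' = ?i])
    show "\<forall>v \<in> sph w. ?i (g v) = v"
      using bij_betw_inv_into_left[OF g] fixing_autsD(2)[OF assms(2)] sphere_in by simp
    show "\<forall>v \<in> sph w. g (?i v) = v"
      using bij_betw_inv_into_right[OF g] sphere_in by simp
    show "g ` sph w \<subseteq> sph w" using sphere_aut[OF assms] by blast
    show "?i ` sph w \<subseteq> sph w" using sphere_aut[OF assms(1) i] by blast
  qed
  then show ?thesis by (simp add: Bij_def)
qed

lemma sphere_group_iff: "k \<in> SG w \<longleftrightarrow> (\<exists>g \<in> U0. k = restrict g (sph w))"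
  by (auto simp: sphere_group_def induced_on_def)

lemma sphere_group_Bij: "red w \<Longrightarrow> SG w \<subseteq> Bij (sph w)"
  using restrict_fixing_Bij U0_fixing by (auto simp: sphere_group_iff)

abbreviation (input) "cp w \<equiv> conj_perm (crd w) (sph w) (X w)"

lemma conj_restrict:
  assumes "red w" "g \<in> fixing_auts"
  shows "cp w (restrict g (sph w)) = aut_perm w g"
  unfolding conj_perm_def
  by (rule restrict_ext) (simp add: coords_inv_into[OF assms(1)] chw_in_sphere[OF assms(1)])

lemma conj_sphere_group:
  assumes w: "red w"
  shows "cp w ` SG w = WW w"
proof
  show "cp w ` SG w \<subseteq> WW w"
    using conj_restrict[OF w U0_fixing] aut_perm_in_wreath[OF w] by (auto simp: sphere_group_iff)
  show "WW w \<subseteq> cp w ` SG w"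
  proof
    fix \<gamma> assume \<gamma>: "\<gamma> \<in> WW w"
    then obtain g where g: "g \<in> U0" "\<forall>x \<in> X w. g (chw w x) = chw w (\<gamma> x)"
      using wreath_extension[OF w] by blast
    have B: "\<gamma> \<in> Bij (X w)" using \<gamma> subgroup_BijGroupD(1)[OF wreath_subgroup[OF w]] by blast
    have "aut_perm w g = \<gamma>"
      using B g Bij_in[OF B] coords_chw[OF w]
      by (intro extensionalityI[of _ "X w"]) (auto simp: Bij_def)
    then show "\<gamma> \<in> cp w ` SG w"
      using conj_restrict[OF w U0_fixing[OF g(1)]] g(1) sphere_group_iff by (metis image_eqI)
  qed
qed

lemma sphere_group_iso:
  assumes w: "red w"
  shows "subgroup (SG w) (BijGroup (sph w))"
    and "permutational_isomorphism (crd w) (cp w) (sph w) (SG w) (X w) (WW w)"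
proof -
  note b = coords_bij[OF w]
  note * = iso_subgroup_restrict[OF conj_perm_iso[OF b] sphere_group_Bij[OF w] wreath_subgroup[OF w]
      conj_sphere_group[OF w]]
  show "subgroup (SG w) (BijGroup (sph w))" by (rule *(1))
  have "crd w (g v) = cp w g (crd w v)" if "g \<in> SG w" "v \<in> sph w" for g v
    using that coords_sphere[OF w that(2)] bij_betw_inv_into_left[OF b that(2)]
    by (simp add: conj_perm_def)
  then show "permutational_isomorphism (crd w) (cp w) (sph w) (SG w) (X w) (WW w)"
    using * b wreath_subgroup[OF w] by (simp add: permutational_isomorphism_def)
qed

end


section \<open>Forgetting the last letter\<close>

text \<open>
  In this part \<open>u\<close> is the word \<open>w'\<close> of the statement and \<open>u @ [s]\<close> is \<open>w\<close>.
\<close>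

locale last_letter = universal_building W S C \<delta> c0 q h F
  for W (structure) and S C \<delta> c0 q h F +
  fixes u s
  assumes red: "reduced_word W S (u @ [s])"
begin

abbreviation (input) "w \<equiv> u @ [s]"
abbreviation (input) "n \<equiv> Suc (length u)"

lemma red_u: "red u" by (rule red_appendD1[OF red])

lemma s_in: "s \<in> S" using redD(1)[OF red] by simp

lemma positions_w: "positions w = insert n (positions u)" by (auto simp: positions_def)
lemma n_notin: "n \<notin> positions u" by (simp add: positions_def)

lemma coord_space_w: "x \<in> X w \<longleftrightarrow> restrict x (positions u) \<in> X u \<and> x n \<in> {2..q s} \<and> x \<in> extensional (positions w)"
proof -
  have "coord_range q w i = coord_range q u i" if "i \<in> positions u" for i
    using letter_snoc[OF that] by (simp add: coord_range_def)
  moreover have "coord_range q w n = {2..q s}" by (simp add: coord_range_def letter_def)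
  ultimately show ?thesis
    unfolding coord_space_def PiE_iff positions_w by auto
qed

text \<open>
  The last but one chamber of the gallery of type \<open>u @ [s]\<close> from \<open>c\<^sub>0\<close> to \<open>v\<close>.
\<close>

definition parent :: "'c \<Rightarrow> 'c"
  where "parent v = chw u (crd w v)"

lemma parent_ch: "x \<in> X w \<Longrightarrow> parent (chw w x) = chw u x"
  by (simp add: parent_def coords_chw[OF red])

lemma parent_sphere: "v \<in> sph w \<Longrightarrow> parent v \<in> sph u \<and> crd u (parent v) = restrict (crd w v) (positions u)"
proof -
  assume v: "v \<in> sph w"
  let ?x = "restrict (crd w v) (positions u)"
  have x: "?x \<in> X u" using coords_sphere(1)[OF red v] coord_space_w by blast
  have "parent v = chw u ?x"
    unfolding parent_def by (rule arg_cong[of _ _ chamber], rule cword_cong) simp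
  then show ?thesis using chw_in_sphere[OF red_u x] coords_chw[OF red_u x] by simp
qed

lemma sphere_step:
  assumes "v \<in> sph w"
  shows "h s v = crd w v n" "v = chamber ((s, crd w v n) # cword u (crd w v))"
    "proper ((s, crd w v n) # cword u (crd w v))"
proof -
  note c = coords_sphere[OF red assms]
  show v: "v = chamber ((s, crd w v n) # cword u (crd w v))"
    using c(2) by (simp add: cword_snoc)
  show p: "proper ((s, crd w v n) # cword u (crd w v))"
    using proper_cword[OF red c(1)] by (simp add: cword_snoc)
  show "h s v = crd w v n" using ch_Cons(3)[OF p] v by simp
qed

lemma sphere_eqI:
  assumes "v \<in> sph w" "v' \<in> sph w" "parent v = parent v'" "h s v = h s v'"
  shows "v = v'"
proof -
  have *: "step (s, h s z) (parent z) = z" if "z \<in> sph w" for z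
    unfolding sphere_step(1)[OF that] parent_def ch_simps(2)[symmetric]
    by (rule sphere_step(2)[OF that, symmetric])
  show ?thesis using *[OF assms(1)] *[OF assms(2)] assms(3,4) by metis
qed

text \<open>
  The color 2 exists because panels have at least two chambers.
\<close>

lemma sphere_extend:
  assumes y: "y \<in> sph u"
  shows "\<exists>v \<in> sph w. parent v = y"
proof -
  let ?x = "(crd u y)(n := 2)"
  have y': "crd u y \<in> X u" "chw u (crd u y) = y" using coords_sphere[OF red_u y] by auto
  have "crd u y \<in> extensional (positions u)" using y'(1) by (simp add: coord_space_def PiE_def)
  then have "restrict ?x (positions u) = crd u y" "?x \<in> extensional (positions w)"
    using n_notin by (auto simp: extensional_def fun_eq_iff positions_w)
  then have x: "?x \<in> X w" using y'(1) thick[OF s_in] coord_space_w[of ?x] by simp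
  have "chw u ?x = y"
  proof -
    have "cword u ?x = cword u (crd u y)" using n_notin by (intro cword_cong) auto
    then show ?thesis using y'(2) by simp
  qed
  then have "parent (chw w ?x) = y" using parent_ch[OF x] by simp
  with chw_in_sphere[OF red x] show ?thesis by blast
qed

lemma lies_over_iff:
  "v \<in> sph w \<Longrightarrow> y \<in> sph u \<Longrightarrow> lies_over C \<delta> h c0 w v y \<longleftrightarrow> y = parent v"
  using parent_sphere[of v] coords_sphere(2)[OF red_u, of y] coords_sphere(2)[OF red_u, of "parent v"]
  by (auto simp: lies_over_def)

lemma parent_aut:
  assumes g: "g \<in> fixing_auts" and v: "v \<in> sph w"
  shows "parent (g v) = g (parent v)"
proof -
  note c = coords_sphere[OF red v]
  have "image_word g (cword w (crd w v)) = cword w (crd w (g v))"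
    using aut_coords(3)[OF red g c(1)] c(2) by simp
  then have "image_word g (cword u (crd w v)) = cword u (crd w (g v))"
    by (simp add: cword_snoc)
  then show ?thesis
    using image_word(2)[OF g proper_ConsD(1)[OF sphere_step(3)[OF v]]] by (simp add: parent_def)
qed

abbreviation (input) "ind_map \<equiv> induced_map W C \<delta> h c0 w"

text \<open>
  The induced map is well defined because \<open>parent\<close> commutes with automorphisms.
\<close>

lemma induced_map_restrict:
  assumes g: "g \<in> fixing_auts"
  shows "ind_map (restrict g (sph w)) = restrict g (sph u)"
proof -
  have "(THE y'. y' \<in> sph u \<and> (\<exists>v \<in> sph w. lies_over C \<delta> h c0 w v y \<and>
      lies_over C \<delta> h c0 w (restrict g (sph w) v) y')) = g y" if y: "y \<in> sph u" for y
  proof (rule the_equality)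
    obtain v where v: "v \<in> sph w" "parent v = y" using sphere_extend[OF y] by blast
    have gv: "g v \<in> sph w" "g y \<in> sph u" using sphere_aut[OF red g v(1)] sphere_aut[OF red_u g y] by auto
    have "lies_over C \<delta> h c0 w v y" "lies_over C \<delta> h c0 w (g v) (g y)"
      using v y gv parent_aut[OF g v(1)] by (simp_all add: lies_over_iff)
    then show "g y \<in> sph u \<and> (\<exists>v \<in> sph w. lies_over C \<delta> h c0 w v y \<and>
      lies_over C \<delta> h c0 w (restrict g (sph w) v) (g y))" using v(1) gv by auto
    fix y' assume "y' \<in> sph u \<and> (\<exists>v \<in> sph w. lies_over C \<delta> h c0 w v y \<and>
      lies_over C \<delta> h c0 w (restrict g (sph w) v) y')"
    then obtain v' where v': "v' \<in> sph w" "lies_over C \<delta> h c0 w v' y" "lies_over C \<delta> h c0 w (g v') y'"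
      and y': "y' \<in> sph u" by auto
    then show "y' = g y"
      using lies_over_iff[OF v'(1) y] lies_over_iff[OF sphere_aut[OF red g v'(1)] y'] parent_aut[OF g v'(1)]
      by simp
  qed
  then show ?thesis unfolding induced_map_def by (auto simp: fun_eq_iff)
qed

abbreviation (input) "Dw \<equiv> last_kernel W S C \<delta> q h F c0 w"

lemma last_kernel_restrict:
  assumes "g \<in> U0"
  shows "restrict g (sph w) \<in> Dw \<longleftrightarrow> (\<forall>y \<in> sph u. g y = y)"
  using assms induced_map_restrict[OF U0_fixing[OF assms]]
  by (auto simp: last_kernel_def sphere_group_iff)

lemma last_kernel_coordinate:
  assumes g: "g \<in> U0"
  shows "cp w (restrict g (sph w)) \<in> coordinate_subgroup (positions w) (coord_range q w) (WW w) (length w)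
    \<longleftrightarrow> restrict g (sph w) \<in> Dw"
proof -
  note gf = U0_fixing[OF g]
  have "(\<forall>x \<in> X w. \<forall>j \<in> positions w. j \<noteq> n \<longrightarrow> aut_perm w g x j = x j) \<longleftrightarrow> (\<forall>y \<in> sph u. g y = y)"
  proof
    assume L: "\<forall>x \<in> X w. \<forall>j \<in> positions w. j \<noteq> n \<longrightarrow> aut_perm w g x j = x j"
    show "\<forall>y \<in> sph u. g y = y"
    proof
      fix y assume "y \<in> sph u"
      then obtain v where v: "v \<in> sph w" "parent v = y" using sphere_extend by blast
      note c = coords_sphere[OF red v(1)]
      have "crd w (g v) j = crd w v j" if "j \<in> positions u" for j
      proof -
        have "j \<in> positions w" "j \<noteq> n" using that n_notin by (auto simp: positions_w)
        then have "aut_perm w g (crd w v) j = crd w v j" using L c(1) by blast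
        then show ?thesis using c by simp
      qed
      then have "parent (g v) = parent v" unfolding parent_def by (metis cword_cong)
      then show "g y = y" using parent_aut[OF gf v(1)] v(2) by simp
    qed
  next
    assume R: "\<forall>y \<in> sph u. g y = y"
    show "\<forall>x \<in> X w. \<forall>j \<in> positions w. j \<noteq> n \<longrightarrow> aut_perm w g x j = x j"
    proof (intro ballI impI)
      fix x j assume x: "x \<in> X w" and j: "j \<in> positions w" "j \<noteq> n"
      have v: "chw w x \<in> sph w" by (rule chw_in_sphere[OF red x])
      have gv: "g (chw w x) \<in> sph w" by (rule sphere_aut[OF red gf v])
      have "parent (g (chw w x)) = parent (chw w x)"
        using parent_aut[OF gf v] R parent_sphere[OF v] by simp
      then have "restrict (crd w (g (chw w x))) (positions u) = restrict x (positions u)"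
        using parent_sphere[OF v] parent_sphere[OF gv] coords_chw[OF red x] by simp
      then have "crd w (g (chw w x)) j = x j"
        using j by (auto simp: positions_w fun_eq_iff restrict_def split: if_splits)
      then show "aut_perm w g x j = x j" using x by simp
    qed
  qed
  then show ?thesis
    using last_kernel_restrict[OF g] aut_perm_in_wreath[OF red g] conj_restrict[OF red gf]
    by (simp add: coordinate_subgroup_def coord_space_def[symmetric])
qed

lemma last_kernel_image:
  "cp w ` Dw = coordinate_subgroup (positions w) (coord_range q w) (WW w) (length w)"
proof
  show "cp w ` Dw \<subseteq> coordinate_subgroup (positions w) (coord_range q w) (WW w) (length w)"
  proof (rule image_subsetI)
    fix d assume d: "d \<in> Dw"
    then obtain g where "g \<in> U0" "d = restrict g (sph w)" by (auto simp: last_kernel_def sphere_group_iff)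
    then show "cp w d \<in> coordinate_subgroup (positions w) (coord_range q w) (WW w) (length w)"
      using last_kernel_coordinate d by blast
  qed
  show "coordinate_subgroup (positions w) (coord_range q w) (WW w) (length w) \<subseteq> cp w ` Dw"
  proof
    fix \<gamma> assume \<gamma>: "\<gamma> \<in> coordinate_subgroup (positions w) (coord_range q w) (WW w) (length w)"
    then have "\<gamma> \<in> cp w ` SG w" unfolding conj_sphere_group[OF red] by (simp add: coordinate_subgroup_def)
    then obtain g where "g \<in> U0" "\<gamma> = cp w (restrict g (sph w))" by (auto simp: sphere_group_iff)
    then show "\<gamma> \<in> cp w ` Dw" using last_kernel_coordinate \<gamma> by blast
  qed
qed

text \<open>
  The colored past of the appended letter \<open>s\<close> contains every letter \<open>s\<close> of \<open>u\<close>, so the minimal extension of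
  \<open>wreath_extension\<close> does not touch the last coordinate.
\<close>

lemma lift_exists:
  assumes k: "k \<in> SG u"
  shows "\<exists>g \<in> U0. restrict g (sph u) = k \<and> (\<forall>v \<in> sph w. h s (g v) = h s v)"
proof -
  obtain k0 where k0: "k0 \<in> U0" "k = restrict k0 (sph u)" using k by (auto simp: sphere_group_iff)
  have "aut_perm u k0 \<in> WW u" by (rule aut_perm_in_wreath[OF red_u k0(1)])
  from wreath_extension[OF red_u this] obtain g where g: "g \<in> U0"
    "\<forall>x \<in> X u. g (chw u x) = chw u (aut_perm u k0 x)"
    "\<And>s a cs. proper ((s, a) # cs) \<Longrightarrow> count_list u s \<le> count_list (map fst cs) s \<Longrightarrow>
       h s (g (chamber ((s, a) # cs))) = a"
    by blast
  have "g y = k0 y" if "y \<in> sph u" for y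
  proof -
    note c = coords_sphere[OF red_u that]
    show ?thesis using bspec[OF g(2) c(1)] c aut_coords(2)[OF red_u U0_fixing[OF k0(1)] c(1)] by simp
  qed
  then have "restrict g (sph u) = k" using k0(2) by auto
  moreover have "h s (g v) = h s v" if "v \<in> sph w" for v
    using g(3)[OF sphere_step(3)[OF that]] sphere_step[OF that] by simp
  ultimately show ?thesis using g(1) by blast
qed

lemma mult_restrict:
  assumes "red v" "g \<in> SG v" "f \<in> SG v"
  shows "g \<otimes>\<^bsub>BijGroup (sph v)\<^esub> f = compose (sph v) g f" "compose (sph v) g f \<in> SG v"
proof -
  have "g \<in> Bij (sph v)" "f \<in> Bij (sph v)" using sphere_group_Bij[OF assms(1)] assms(2,3) by auto
  then show "g \<otimes>\<^bsub>BijGroup (sph v)\<^esub> f = compose (sph v) g f" by (rule BijGroup_simps)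
  show "compose (sph v) g f \<in> SG v"
    by (rule subgroup_BijGroupD(4)[OF sphere_group_iso(1)[OF assms(1)] assms(2,3)])
qed

lemma induced_map_in: "g \<in> SG w \<Longrightarrow> ind_map g \<in> SG u"
  using induced_map_restrict[OF U0_fixing] by (auto simp: sphere_group_iff)

lemma induced_map_parent:
  assumes "g \<in> SG w" "v \<in> sph w"
  shows "parent (g v) = ind_map g (parent v)"
proof -
  obtain g0 where "g0 \<in> U0" "g = restrict g0 (sph w)" using assms(1) by (auto simp: sphere_group_iff)
  then show ?thesis
    using assms(2) induced_map_restrict[OF U0_fixing] parent_aut[OF U0_fixing] parent_sphere by simp
qed

lemma SG_in: "red v \<Longrightarrow> g \<in> SG v \<Longrightarrow> x \<in> sph v \<Longrightarrow> g x \<in> sph v"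
  by (rule Bij_in[OF subsetD[OF sphere_group_Bij]])

lemma induced_map_hom: "ind_map \<in> hom (perm_group (sph w) (SG w)) (perm_group (sph u) (SG u))"
proof (rule homI)
  fix g f assume "g \<in> carrier (perm_group (sph w) (SG w))" "f \<in> carrier (perm_group (sph w) (SG w))"
  then have gf: "g \<in> SG w" "f \<in> SG w" by simp_all
  note c = mult_restrict[OF red gf] and c' = mult_restrict[OF red_u induced_map_in[OF gf(1)] induced_map_in[OF gf(2)]]
  have "ind_map (compose (sph w) g f) = compose (sph u) (ind_map g) (ind_map f)"
  proof (rule extensionalityI[of _ "sph u"])
    show "ind_map (compose (sph w) g f) \<in> extensional (sph u)" by (simp add: induced_map_def)
    show "compose (sph u) (ind_map g) (ind_map f) \<in> extensional (sph u)" by (simp add: compose_def)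
    fix y assume y: "y \<in> sph u"
    then obtain v where v: "v \<in> sph w" "parent v = y" using sphere_extend by blast
    have fv: "f v \<in> sph w" by (rule SG_in[OF red gf(2) v(1)])
    have "ind_map (compose (sph w) g f) y = parent (compose (sph w) g f v)"
      using induced_map_parent[OF c(2) v(1)] v(2) by simp
    also have "\<dots> = parent (g (f v))" using v(1) by (simp add: compose_def)
    also have "\<dots> = ind_map g (ind_map f y)"
      using induced_map_parent[OF gf(1) fv] induced_map_parent[OF gf(2) v(1)] v(2) by simp
    finally show "ind_map (compose (sph w) g f) y = compose (sph u) (ind_map g) (ind_map f) y"
      using y by (simp add: compose_def)
  qed
  then show "ind_map (g \<otimes>\<^bsub>perm_group (sph w) (SG w)\<^esub> f) =
      ind_map g \<otimes>\<^bsub>perm_group (sph u) (SG u)\<^esub> ind_map f"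
    using c c' by simp
qed (use induced_map_in in simp)

text \<open>
  Lifts of the same element preserving the last color agree on the sphere, by \<open>sphere_eqI\<close>. Hence choosing such
  lifts is automatically multiplicative.
\<close>

lemma section_exists:
  "\<exists>\<epsilon> \<in> hom (perm_group (sph u) (SG u)) (perm_group (sph w) (SG w)). \<forall>k \<in> SG u. ind_map (\<epsilon> k) = k"
proof -
  obtain E where E: "\<And>k. k \<in> SG u \<Longrightarrow> E k \<in> U0 \<and> restrict (E k) (sph u) = k \<and> (\<forall>v \<in> sph w. h s (E k v) = h s v)"
    using lift_exists by metis
  define \<epsilon> where "\<epsilon> = (\<lambda>k. restrict (E k) (sph w))"
  have \<epsilon>: "\<epsilon> k \<in> SG w" "ind_map (\<epsilon> k) = k" "v \<in> sph w \<Longrightarrow> h s (\<epsilon> k v) = h s v" if "k \<in> SG u" for k v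
    using E[OF that] induced_map_restrict[OF U0_fixing, of "E k"] by (auto simp: \<epsilon>_def sphere_group_iff)
  have "\<epsilon> \<in> hom (perm_group (sph u) (SG u)) (perm_group (sph w) (SG w))"
  proof (rule homI)
    fix k l assume "k \<in> carrier (perm_group (sph u) (SG u))" "l \<in> carrier (perm_group (sph u) (SG u))"
    then have kl: "k \<in> SG u" "l \<in> SG u" by simp_all
    note c = mult_restrict[OF red_u kl] and c' = mult_restrict[OF red \<epsilon>(1)[OF kl(1)] \<epsilon>(1)[OF kl(2)]]
    have "\<epsilon> (compose (sph u) k l) = compose (sph w) (\<epsilon> k) (\<epsilon> l)"
    proof (rule extensionalityI[of _ "sph w"])
      show "\<epsilon> (compose (sph u) k l) \<in> extensional (sph w)" by (simp add: \<epsilon>_def)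
      show "compose (sph w) (\<epsilon> k) (\<epsilon> l) \<in> extensional (sph w)" by (simp add: compose_def)
      fix v assume v: "v \<in> sph w"
      have lv: "\<epsilon> l v \<in> sph w" by (rule SG_in[OF red \<epsilon>(1)[OF kl(2)] v])
      have "\<epsilon> (compose (sph u) k l) v = \<epsilon> k (\<epsilon> l v)"
      proof (rule sphere_eqI)
        show "\<epsilon> (compose (sph u) k l) v \<in> sph w" by (rule SG_in[OF red \<epsilon>(1)[OF c(2)] v])
        show "\<epsilon> k (\<epsilon> l v) \<in> sph w" by (rule SG_in[OF red \<epsilon>(1)[OF kl(1)] lv])
        show "parent (\<epsilon> (compose (sph u) k l) v) = parent (\<epsilon> k (\<epsilon> l v))"
          using induced_map_parent[OF \<epsilon>(1)[OF c(2)] v] induced_map_parent[OF \<epsilon>(1)[OF kl(1)] lv]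
            induced_map_parent[OF \<epsilon>(1)[OF kl(2)] v] \<epsilon>(2)[OF c(2)] \<epsilon>(2)[OF kl(1)] \<epsilon>(2)[OF kl(2)]
            parent_sphere[OF v] by (simp add: compose_def)
        show "h s (\<epsilon> (compose (sph u) k l) v) = h s (\<epsilon> k (\<epsilon> l v))"
          using \<epsilon>(3)[OF c(2) v] \<epsilon>(3)[OF kl(1) lv] \<epsilon>(3)[OF kl(2) v] by simp
      qed
      then show "\<epsilon> (compose (sph u) k l) v = compose (sph w) (\<epsilon> k) (\<epsilon> l) v"
        using v by (simp add: compose_def)
    qed
    then show "\<epsilon> (k \<otimes>\<^bsub>perm_group (sph u) (SG u)\<^esub> l) = \<epsilon> k \<otimes>\<^bsub>perm_group (sph w) (SG w)\<^esub> \<epsilon> l"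
      using c c' by simp
  qed (use \<epsilon> in simp)
  then show ?thesis using \<epsilon> by blast
qed

lemma last_kernel_eq_kernel:
  "Dw = kernel (perm_group (sph w) (SG w)) (perm_group (sph u) (SG u)) ind_map"
proof -
  have "(\<forall>y \<in> sph u. ind_map g y = y) \<longleftrightarrow> ind_map g = (\<lambda>y \<in> sph u. y)" for g
  proof
    assume "\<forall>y \<in> sph u. ind_map g y = y"
    then show "ind_map g = (\<lambda>y \<in> sph u. y)"
      by (intro extensionalityI[of _ "sph u"]) (auto simp: induced_map_def)
  qed simp
  then show ?thesis by (auto simp: last_kernel_def kernel_def BijGroup_simps)
qed

lemma sphere_group_split:
  "(\<exists>\<Phi>. permutational_isomorphism (crd w) \<Phi> (sph w) (SG w) (X w) (WW w) \<and>
       \<Phi> ` Dw = coordinate_subgroup (positions w) (coord_range q w) (WW w) (length w)) \<and>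
   subgroup Dw (perm_group (sph w) (SG w)) \<and>
   (\<exists>\<phi> \<in> hom (perm_group (sph u) (SG u)) (AutoGroup (perm_group (sph w) Dw)).
     \<exists>\<Psi> \<in> iso (semidirect_product (perm_group (sph w) Dw) (perm_group (sph u) (SG u)) \<phi>)
              (perm_group (sph w) (SG w)).
       \<forall>d \<in> Dw. \<Psi> (d, \<one>\<^bsub>perm_group (sph u) (SG u)\<^esub>) = d \<and>
         (\<forall>k \<in> SG u. ind_map (\<Psi> (d, k)) = k))"
proof (intro conjI)
  let ?G = "perm_group (sph w) (SG w)" and ?K = "perm_group (sph u) (SG u)"
  show "\<exists>\<Phi>. permutational_isomorphism (crd w) \<Phi> (sph w) (SG w) (X w) (WW w) \<and>
       \<Phi> ` Dw = coordinate_subgroup (positions w) (coord_range q w) (WW w) (length w)"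
    using sphere_group_iso(2)[OF red] last_kernel_image by blast
  have G: "group ?G" "group ?K"
    using subgroup.subgroup_is_group[OF sphere_group_iso(1) group_BijGroup] red red_u by auto
  have "group_hom ?G ?K ind_map"
    using G induced_map_hom by (simp add: group_hom_def group_hom_axioms_def)
  from group_hom.subgroup_kernel[OF this] show "subgroup Dw ?G" by (simp only: last_kernel_eq_kernel)
  obtain \<epsilon> where e: "\<epsilon> \<in> hom ?K ?G" "\<And>k. k \<in> carrier ?K \<Longrightarrow> ind_map (\<epsilon> k) = k"
    using section_exists by auto
  show "\<exists>\<phi> \<in> hom ?K (AutoGroup (perm_group (sph w) Dw)).
     \<exists>\<Psi> \<in> iso (semidirect_product (perm_group (sph w) Dw) ?K \<phi>) ?G.
       \<forall>d \<in> Dw. \<Psi> (d, \<one>\<^bsub>?K\<^esub>) = d \<and> (\<forall>k \<in> SG u. ind_map (\<Psi> (d, k)) = k)"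
    using split_extension[OF G induced_map_hom e(1)] e(2)
    unfolding last_kernel_eq_kernel[symmetric] by simp
qed

end

theorem proposition4p11:
  fixes W :: "('a, 'm) monoid_scheme" and S :: "'a set"
    and C :: "'c set" and \<delta> :: "'c \<Rightarrow> 'c \<Rightarrow> 'a" and c0 :: 'c
    and q :: "'a \<Rightarrow> nat" and h :: "'a \<Rightarrow> 'c \<Rightarrow> nat" and F :: "'a \<Rightarrow> (nat \<Rightarrow> nat) set"
    and w :: "'a list"
  assumes "right_angled_building W S C \<delta>"
    and "\<forall>s \<in> S. q s \<ge> 3"
    and "semi_regular S C \<delta> q"
    and "c0 \<in> C"
    and "\<forall>s \<in> S. directed_legal_coloring W S C \<delta> q c0 s (h s)"
    and "\<forall>s \<in> S. subgroup (F s) (BijGroup (colors q s)) \<and>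
           transitive_action (perm_group (colors q s) (F s)) (colors q s) (\<lambda>g. g)"
    and "reduced_word W S w" and "w \<noteq> []"
  defines "\<Omega> \<equiv> sphere W C \<delta> c0 w"
    and "\<Omega>' \<equiv> sphere W C \<delta> c0 (butlast w)"
    and "A \<equiv> sphere_group W S C \<delta> q h F c0 w"
    and "A' \<equiv> sphere_group W S C \<delta> q h F c0 (butlast w)"
    and "D \<equiv> last_kernel W S C \<delta> q h F c0 w"
    and "G \<equiv> word_wreath W q F w"
  shows "(\<exists>\<Phi>. permutational_isomorphism (coords C \<delta> h c0 w) \<Phi> \<Omega> A (coord_space q w) G \<and>
            \<Phi> ` D = coordinate_subgroup (positions w) (coord_range q w) G (length w)) \<and>
         subgroup D (perm_group \<Omega> A) \<and>
         (\<exists>\<phi> \<in> hom (perm_group \<Omega>' A') (AutoGroup (perm_group \<Omega> D)).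
          \<exists>\<Psi> \<in> iso (semidirect_product (perm_group \<Omega> D) (perm_group \<Omega>' A') \<phi>) (perm_group \<Omega> A).
            \<forall>d \<in> D. \<Psi> (d, \<one>\<^bsub>perm_group \<Omega>' A'\<^esub>) = d \<and>
              (\<forall>k \<in> A'. induced_map W C \<delta> h c0 w (\<Psi> (d, k)) = k))"
proof -
  obtain u s where w: "w = u @ [s]" "butlast w = u"
    using \<open>w \<noteq> []\<close> by (metis append_butlast_last_id)
  interpret right_angled_building W S C \<delta> by fact
  interpret last_letter W S C \<delta> c0 q h F u s
    using assms(1,2,4-7) unfolding w
    by (intro last_letter.intro universal_building.intro colored_building.intro
        last_letter_axioms.intro universal_building_axioms.intro colored_building_axioms.intro) auto
  show ?thesis
    unfolding \<Omega>_def \<Omega>'_def A_def A'_def D_def G_def w using sphere_group_split by simp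
qed

end
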